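(* Let $\mathbb{A}$ be an abelian framed bicategory, $\mathcal{C}$ a category and $M\colon \mathcal{C}\to \mathrm{Ch}(\mathbb{A})$ a functor. Consider a good cover of an object $X$ of $\mathcal{C}$, i.e. a commutative square of relative pairs with arrows $X_1\cap X_2\to X_1$, $X_1\cap X_2\to X_2$, $X_1\to X$, $X_2\to X$ satisfying the excision property. Then there is a long exact sequence in the abelian category $\mathcal{A}(L(X),R(X))$: $$\cdots\to H_{i+1}(X)\to {}^{X}H_i(X_1\cap X_2)\to {}^{X}H_i(X_1)\oplus{}^{X}H_i(X_2)\to H_i(X)\to\cdots\to {}^{X}H_0(X_1)\oplus{}^{X}H_0(X_2)\to H_0(X)\to 0 .$$
   Context: Double categories. A (pseudo) double category $\mathbb{D}$ consists of a vertical category $\mathbb{D}_0$ (objects and vertical arrows), a horizontal category $\mathbb{D}_1$ (its objects are called 1-cells, its arrows 2-cells), and functors $U\colon\mathbb{D}_0\to\mathbb{D}_1$, $L,R\colon\mathbb{D}_1\to\mathbb{D}_0$, $\odot\colon\mathbb{D}_1\times_{\mathbb{D}_0}\mathbb{D}_1\to\mathbb{D}_1$ (pullback of $R$ and $L$) with $LU=RU=\mathrm{id}$, $L(M\odot N)=LM$, $R(M\odot N)=RN$, such that $\odot$ is associative and unital (unit $U_A=U(A)$) up to coherent natural isomorphisms satisfying the bicategory axioms. Write $M\colon A\nrightarrow B$ if $LM=A$, $RM=B$. A 2-cell $\alpha\colon M\to N$ lies over $(f,g)$ if $L\alpha=f$, $R\alpha=g$; it is globular if it lies over identities. The local category $\mathcal{D}(A,B)$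 has the 1-cells $A\nrightarrow B$ and globular 2-cells. Framed bicategories. A framed bicategory is a double category such that $(L,R)\colon\mathbb{D}_1\to\mathbb{D}_0\times\mathbb{D}_0$ is a bifibration. Choosing (co)cartesian lifts: for vertical arrows $f\colon A\to B$, $g\colon C\to D$ there are a restriction functor $f^*(-)g^*\colon\mathcal{D}(B,D)\to\mathcal{D}(A,C)$ with cartesian 2-cells $f^*Mg^*\to M$ over $(f,g)$, and an extension functor $f_!(-)g_!\colon\mathcal{D}(A,C)\to\mathcal{D}(B,D)$ with cocartesian 2-cells $N\to f_!Ng_!$ over $(f,g)$; extension is left adjoint to restriction. Abelian framed bicategories. An abelian framed bicategory $\mathbb{A}$ is a framed bicategory all of whose local categories $\mathcal{A}(A,B)$ are abelian and for which $\odot\colon\mathcal{A}(A,B)\times\mathcal{A}(B,C)\to\mathcal{A}(A,C)$ is additive (in each variable). Chain complexes. An object of $\mathrm{Ch}(\mathbb{A})$ is a non-negatively graded chain complex in some local category $\mathcal{A}(A,B)$. A morphism from $(M_i)$ in $\mathcal{A}(A,B)$ to $(N_i)$ in $\mathcal{A}(C,D)$ consists of vertical arrows $f\colon A\to C$, $g\colon B\to D$ and 2-cells $\alpha_i\colon M_i\to N_i$ over $(f,g)$ with $\partial_{i+1}\circ\alpha_{i+1}=\alpha_i\circ\partial_{i+1}$. Restriction and extension of complexes are taken degreewise. Homology. For $X$ in $\mathcal{C}$ the complex $M(X)$ lives in $\mathcal{A}(L(X),R(X))$ and $H_*(X)$ denotes its homology there. For $f\colon Y\to X$ in $\mathcal{C}$,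 $M(f)$ lies over vertical arrows $L(f)\colon L(Y)\to L(X)$, $R(f)\colon R(Y)\to R(X)$; write ${}^{X}(-)=L(f)_!(-)R(f)_!$. The morphism $M(f)$ factors uniquely through the cocartesian morphism $M(Y)\to{}^{X}M(Y)$ as a morphism ${}^{X}M(Y)\to M(X)$ in complexes in $\mathcal{A}(L(X),R(X))$; $M(X,Y)$ denotes its cokernel and $H_*(X,Y)$ the homology of $M(X,Y)$. Relative pairs. A relative pair $(X,Y)$ is an arrow $f\colon Y\to X$ of $\mathcal{C}$ such that (1) the functor ${}^{X}(-)$ is exact, and (2) the factorization ${}^{X}M(Y)\to M(X)$ of $M(f)$ is a monomorphism. Relative pairs compose, so in a commutative square of relative pairs the diagonal is also a relative pair. Good covers. A good cover of $X$ is a commutative square in $\mathcal{C}$ with arrows $X_1\cap X_2\to X_1\to X$ and $X_1\cap X_2\to X_2\to X$ (where $X_1\cap X_2$ is just a name for an object), all four arrows being relative pairs, such that the following excision property holds. The factorization ${}^{X}M(X_1)\to M(X)$ of $M(X_1\to X)$ descends uniquely to a canonical morphism ${}^{X}M(X_1,X_1\cap X_2)\to M(X,X_2)$ (compatible with the quotient maps ${}^XM(X_1)\to{}^XM(X_1,X_1\cap X_2)$ and $M(X)\to M(X,X_2)$), and this canonical morphism is required to induce an isomorphism in homology ${}^{X}H_*(X_1,X_1\cap X_2)\cong H_*(X,X_2)$. *)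

theory Defs
  imports "HOL-Algebra.Group"
begin

section \<open>Categories and functors\<close>

record ('o, 'a) cat =
  ob :: "'o set"
  ar :: "'a set"
  src :: "'a \<Rightarrow> 'o"
  tgt :: "'a \<Rightarrow> 'o"
  idt :: "'o \<Rightarrow> 'a"
  cmp :: "'a \<Rightarrow> 'a \<Rightarrow> 'a"  (infixr "\<cdot>\<index>" 70)

text \<open>\<open>g \<cdot>\<^bsub>C\<^esub> f\<close> is \<open>g\<close> after \<open>f\<close>.\<close>

definition Hom :: "('o, 'a, 'z) cat_scheme \<Rightarrow> 'o \<Rightarrow> 'o \<Rightarrow> 'a set" where
  "Hom C x y = {f \<in> ar C. src C f = x \<and> tgt C f = y}"

locale category =
  fixes C :: "('o, 'a, 'z) cat_scheme" (structure)
  assumes src_ob: "f \<in> ar C \<Longrightarrow> src C f \<in> ob C"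
    and tgt_ob: "f \<in> ar C \<Longrightarrow> tgt C f \<in> ob C"
    and idt_Hom: "x \<in> ob C \<Longrightarrow> idt C x \<in> Hom C x x"
    and cmp_Hom: "f \<in> Hom C x y \<Longrightarrow> g \<in> Hom C y z \<Longrightarrow> g \<cdot> f \<in> Hom C x z"
    and idt_left: "f \<in> Hom C x y \<Longrightarrow> idt C y \<cdot> f = f"
    and idt_right: "f \<in> Hom C x y \<Longrightarrow> f \<cdot> idt C x = f"
    and cmp_assoc: "f \<in> Hom C w x \<Longrightarrow> g \<in> Hom C x y \<Longrightarrow> h \<in> Hom C y z
      \<Longrightarrow> (h \<cdot> g) \<cdot> f = h \<cdot> (g \<cdot> f)"

definition isom :: "('o, 'a, 'z) cat_scheme \<Rightarrow> 'a \<Rightarrow> bool" where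
  "isom C f \<longleftrightarrow> f \<in> ar C \<and> (\<exists>g \<in> Hom C (tgt C f) (src C f).
     g \<cdot>\<^bsub>C\<^esub> f = idt C (src C f) \<and> f \<cdot>\<^bsub>C\<^esub> g = idt C (tgt C f))"

definition monic :: "('o, 'a, 'z) cat_scheme \<Rightarrow> 'a \<Rightarrow> bool" where
  "monic C f \<longleftrightarrow> f \<in> ar C \<and> (\<forall>x \<in> ob C. \<forall>g \<in> Hom C x (src C f). \<forall>h \<in> Hom C x (src C f).
     f \<cdot>\<^bsub>C\<^esub> g = f \<cdot>\<^bsub>C\<^esub> h \<longrightarrow> g = h)"

definition epic :: "('o, 'a, 'z) cat_scheme \<Rightarrow> 'a \<Rightarrow> bool" where
  "epic C f \<longleftrightarrow> f \<in> ar C \<and> (\<forall>x \<in> ob C. \<forall>g \<in> Hom C (tgt C f) x. \<forall>h \<in> Hom C (tgt C f) x.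
     g \<cdot>\<^bsub>C\<^esub> f = h \<cdot>\<^bsub>C\<^esub> f \<longrightarrow> g = h)"

record ('o, 'a, 'p, 'b) fnctr =
  on_ob :: "'o \<Rightarrow> 'p"
  on_ar :: "'a \<Rightarrow> 'b"

locale cat_functor = source: category C + target: category D
  for C :: "('o, 'a, 'y) cat_scheme" and D :: "('p, 'b, 'z) cat_scheme" +
  fixes F :: "('o, 'a, 'p, 'b) fnctr"
  assumes on_ob: "x \<in> ob C \<Longrightarrow> on_ob F x \<in> ob D"
    and on_ar: "f \<in> Hom C x y \<Longrightarrow> on_ar F f \<in> Hom D (on_ob F x) (on_ob F y)"
    and on_idt: "x \<in> ob C \<Longrightarrow> on_ar F (idt C x) = idt D (on_ob F x)"
    and on_cmp: "f \<in> Hom C x y \<Longrightarrow> g \<in> Hom C y z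
      \<Longrightarrow> on_ar F (g \<cdot>\<^bsub>C\<^esub> f) = on_ar F g \<cdot>\<^bsub>D\<^esub> on_ar F f"

definition prod_cat ::
  "('o, 'a, 'y) cat_scheme \<Rightarrow> ('p, 'b, 'z) cat_scheme \<Rightarrow> ('o \<times> 'p, 'a \<times> 'b) cat" where
  "prod_cat C D =
     \<lparr>ob = ob C \<times> ob D, ar = ar C \<times> ar D,
      src = map_prod (src C) (src D), tgt = map_prod (tgt C) (tgt D),
      idt = map_prod (idt C) (idt D),
      cmp = (\<lambda>(g, g') (f, f'). (g \<cdot>\<^bsub>C\<^esub> f, g' \<cdot>\<^bsub>D\<^esub> f'))\<rparr>"

definition pairing ::
  "('o, 'a, 'p, 'b) fnctr \<Rightarrow> ('o, 'a, 'q, 'c) fnctr \<Rightarrow> ('o, 'a, 'p \<times> 'q, 'b \<times> 'c) fnctr" where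
  "pairing F G = \<lparr>on_ob = (\<lambda>x. (on_ob F x, on_ob G x)), on_ar = (\<lambda>f. (on_ar F f, on_ar G f))\<rparr>"

definition cartesian :: "('o, 'a, 'y) cat_scheme \<Rightarrow> ('p, 'b, 'z) cat_scheme
    \<Rightarrow> ('o, 'a, 'p, 'b) fnctr \<Rightarrow> 'a \<Rightarrow> bool" where
  "cartesian E B P \<phi> \<longleftrightarrow> \<phi> \<in> ar E \<and>
     (\<forall>\<psi> \<in> ar E. \<forall>w \<in> Hom B (on_ob P (src E \<psi>)) (on_ob P (src E \<phi>)).
        tgt E \<psi> = tgt E \<phi> \<and> on_ar P \<phi> \<cdot>\<^bsub>B\<^esub> w = on_ar P \<psi> \<longrightarrow>
        (\<exists>!\<chi>. \<chi> \<in> Hom E (src E \<psi>) (src E \<phi>) \<and> on_ar P \<chi> = w \<and> \<phi> \<cdot>\<^bsub>E\<^esub> \<chi> = \<psi>))"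

definition cocartesian :: "('o, 'a, 'y) cat_scheme \<Rightarrow> ('p, 'b, 'z) cat_scheme
    \<Rightarrow> ('o, 'a, 'p, 'b) fnctr \<Rightarrow> 'a \<Rightarrow> bool" where
  "cocartesian E B P \<phi> \<longleftrightarrow> \<phi> \<in> ar E \<and>
     (\<forall>\<psi> \<in> ar E. \<forall>w \<in> Hom B (on_ob P (tgt E \<phi>)) (on_ob P (tgt E \<psi>)).
        src E \<psi> = src E \<phi> \<and> w \<cdot>\<^bsub>B\<^esub> on_ar P \<phi> = on_ar P \<psi> \<longrightarrow>
        (\<exists>!\<chi>. \<chi> \<in> Hom E (tgt E \<phi>) (tgt E \<psi>) \<and> on_ar P \<chi> = w \<and> \<chi> \<cdot>\<^bsub>E\<^esub> \<phi> = \<psi>))"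

locale bifibration = cat_functor E B P
  for E :: "('o, 'a, 'y) cat_scheme" and B :: "('p, 'b, 'z) cat_scheme" and P +
  assumes cartesian_lift:
      "e \<in> ob E \<Longrightarrow> f \<in> ar B \<Longrightarrow> tgt B f = on_ob P e
        \<Longrightarrow> \<exists>\<phi>. cartesian E B P \<phi> \<and> tgt E \<phi> = e \<and> on_ar P \<phi> = f"
    and cocartesian_lift:
      "e \<in> ob E \<Longrightarrow> f \<in> ar B \<Longrightarrow> src B f = on_ob P e
        \<Longrightarrow> \<exists>\<phi>. cocartesian E B P \<phi> \<and> src E \<phi> = e \<and> on_ar P \<phi> = f"


section \<open>Abelian categories\<close>

record ('o, 'a) abcat = "('o, 'a) cat" +
  padd :: "'a \<Rightarrow> 'a \<Rightarrow> 'a"  (infixl "\<boxplus>\<index>" 65)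
  pzero :: "'o \<Rightarrow> 'o \<Rightarrow> 'a"

definition is_kernel :: "('o, 'a, 'z) abcat_scheme \<Rightarrow> 'a \<Rightarrow> 'a \<Rightarrow> bool" where
  "is_kernel C f k \<longleftrightarrow> f \<in> ar C \<and> k \<in> ar C \<and> tgt C k = src C f \<and>
     f \<cdot>\<^bsub>C\<^esub> k = pzero C (src C k) (tgt C f) \<and>
     (\<forall>x \<in> ob C. \<forall>g \<in> Hom C x (src C f). f \<cdot>\<^bsub>C\<^esub> g = pzero C x (tgt C f) \<longrightarrow>
        (\<exists>!h. h \<in> Hom C x (src C k) \<and> k \<cdot>\<^bsub>C\<^esub> h = g))"

definition is_cokernel :: "('o, 'a, 'z) abcat_scheme \<Rightarrow> 'a \<Rightarrow> 'a \<Rightarrow> bool" where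
  "is_cokernel C f c \<longleftrightarrow> f \<in> ar C \<and> c \<in> ar C \<and> src C c = tgt C f \<and>
     c \<cdot>\<^bsub>C\<^esub> f = pzero C (src C f) (tgt C c) \<and>
     (\<forall>x \<in> ob C. \<forall>g \<in> Hom C (tgt C f) x. g \<cdot>\<^bsub>C\<^esub> f = pzero C (src C f) x \<longrightarrow>
        (\<exists>!h. h \<in> Hom C (tgt C c) x \<and> h \<cdot>\<^bsub>C\<^esub> c = g))"

definition is_zero_ob :: "('o, 'a, 'z) cat_scheme \<Rightarrow> 'o \<Rightarrow> bool" where
  "is_zero_ob C z \<longleftrightarrow> z \<in> ob C \<and>
     (\<forall>x \<in> ob C. (\<exists>!f. f \<in> Hom C z x) \<and> (\<exists>!f. f \<in> Hom C x z))"

definition is_biproduct ::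
  "('o, 'a, 'z) abcat_scheme \<Rightarrow> 'o \<Rightarrow> 'o \<Rightarrow> 'o \<Rightarrow> 'a \<Rightarrow> 'a \<Rightarrow> 'a \<Rightarrow> 'a \<Rightarrow> bool" where
  "is_biproduct C x y s i j p q \<longleftrightarrow> s \<in> ob C \<and>
     i \<in> Hom C x s \<and> j \<in> Hom C y s \<and> p \<in> Hom C s x \<and> q \<in> Hom C s y \<and>
     p \<cdot>\<^bsub>C\<^esub> i = idt C x \<and> q \<cdot>\<^bsub>C\<^esub> j = idt C y \<and>
     p \<cdot>\<^bsub>C\<^esub> j = pzero C y x \<and> q \<cdot>\<^bsub>C\<^esub> i = pzero C x y \<and>
     (i \<cdot>\<^bsub>C\<^esub> p) \<boxplus>\<^bsub>C\<^esub> (j \<cdot>\<^bsub>C\<^esub> q) = idt C s"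

locale preadditive_category = category C
  for C :: "('o, 'a, 'z) abcat_scheme" (structure) +
  assumes Hom_comm_group: "x \<in> ob C \<Longrightarrow> y \<in> ob C \<Longrightarrow>
      comm_group \<lparr>carrier = Hom C x y, mult = padd C, one = pzero C x y\<rparr>"
    and cmp_padd_left: "f \<in> Hom C x y \<Longrightarrow> g \<in> Hom C y z \<Longrightarrow> g' \<in> Hom C y z
      \<Longrightarrow> (g \<boxplus> g') \<cdot> f = (g \<cdot> f) \<boxplus> (g' \<cdot> f)"
    and cmp_padd_right: "f \<in> Hom C x y \<Longrightarrow> f' \<in> Hom C x y \<Longrightarrow> g \<in> Hom C y z
      \<Longrightarrow> g \<cdot> (f \<boxplus> f') = (g \<cdot> f) \<boxplus> (g \<cdot> f')"

locale abelian_category = preadditive_category C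
  for C :: "('o, 'a, 'z) abcat_scheme" (structure) +
  assumes ex_zero_ob: "\<exists>z. is_zero_ob C z"
    and ex_biproduct: "x \<in> ob C \<Longrightarrow> y \<in> ob C \<Longrightarrow> \<exists>s i j p q. is_biproduct C x y s i j p q"
    and ex_kernel: "f \<in> ar C \<Longrightarrow> \<exists>k. is_kernel C f k"
    and ex_cokernel: "f \<in> ar C \<Longrightarrow> \<exists>c. is_cokernel C f c"
    and monic_normal: "monic C f \<Longrightarrow> \<exists>g. is_kernel C g f"
    and epic_normal: "epic C f \<Longrightarrow> \<exists>g. is_cokernel C g f"

text \<open>Chosen (co)kernels, zero object and direct sums. A (co)kernel is an arrow; the
  corresponding object is its source (target).\<close>

definition kernel_of :: "('o, 'a, 'z) abcat_scheme \<Rightarrow> 'a \<Rightarrow> 'a" where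
  "kernel_of C f = (SOME k. is_kernel C f k)"

definition cokernel_of :: "('o, 'a, 'z) abcat_scheme \<Rightarrow> 'a \<Rightarrow> 'a" where
  "cokernel_of C f = (SOME c. is_cokernel C f c)"

definition zero_ob :: "('o, 'a, 'z) cat_scheme \<Rightarrow> 'o" where
  "zero_ob C = (SOME z. is_zero_ob C z)"

definition direct_sum :: "('o, 'a, 'z) abcat_scheme \<Rightarrow> 'o \<Rightarrow> 'o \<Rightarrow> 'o" where
  "direct_sum C x y = (SOME s. \<exists>i j p q. is_biproduct C x y s i j p q)"

text \<open>Exactness of \<open>f\<close>, \<open>g\<close> at the target of \<open>f\<close>: the image of \<open>f\<close>, i.e. the kernel \<open>k\<close> of
  its cokernel, is the kernel of \<open>g\<close>.\<close>

definition exact_at :: "('o, 'a, 'z) abcat_scheme \<Rightarrow> 'a \<Rightarrow> 'a \<Rightarrow> bool" where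
  "exact_at C f g \<longleftrightarrow> (\<exists>c k. is_cokernel C f c \<and> is_kernel C c k \<and> is_kernel C g k)"

definition short_exact :: "('o, 'a, 'z) abcat_scheme \<Rightarrow> 'a \<Rightarrow> 'a \<Rightarrow> bool" where
  "short_exact C f g \<longleftrightarrow> monic C f \<and> exact_at C f g \<and> epic C g"

locale exact_functor = cat_functor C D F
  for C :: "('o, 'a, 'y) abcat_scheme" and D :: "('p, 'b, 'z) abcat_scheme" and F +
  assumes additive: "f \<in> Hom C x y \<Longrightarrow> g \<in> Hom C x y
      \<Longrightarrow> on_ar F (f \<boxplus>\<^bsub>C\<^esub> g) = on_ar F f \<boxplus>\<^bsub>D\<^esub> on_ar F g"
    and short_exact: "short_exact C f g \<Longrightarrow> short_exact D (on_ar F f) (on_ar F g)"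


section \<open>Double categories and framed bicategories\<close>

record ('o, 'v, 'm, 'c) dblcat =
  vert :: "('o, 'v) cat"
  horz :: "('m, 'c) cat"
  unitf :: "('o, 'v, 'm, 'c) fnctr"
  leftf :: "('m, 'c, 'o, 'v) fnctr"
  rightf :: "('m, 'c, 'o, 'v) fnctr"
  hcomp :: "('m \<times> 'm, 'c \<times> 'c, 'm, 'c) fnctr"
  assoc :: "'m \<Rightarrow> 'm \<Rightarrow> 'm \<Rightarrow> 'c"
  lunit :: "'m \<Rightarrow> 'c"
  runit :: "'m \<Rightarrow> 'c"

abbreviation "Lo D M \<equiv> on_ob (leftf D) M"
abbreviation "La D \<alpha> \<equiv> on_ar (leftf D) \<alpha>"
abbreviation "Ro D M \<equiv> on_ob (rightf D) M"
abbreviation "Ra D \<alpha> \<equiv> on_ar (rightf D) \<alpha>"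

abbreviation hco  (infixr "\<odot>\<index>" 75) where "M \<odot>\<^bsub>D\<^esub> N \<equiv> on_ob (hcomp D) (M, N)"
abbreviation hca  (infixr "\<odot>\<odot>\<index>" 75) where "\<alpha> \<odot>\<odot>\<^bsub>D\<^esub> \<beta> \<equiv> on_ar (hcomp D) (\<alpha>, \<beta>)"

definition composable_pairs ::
  "('o, 'v, 'm, 'c, 'z) dblcat_scheme \<Rightarrow> ('m \<times> 'm, 'c \<times> 'c) cat" where
  "composable_pairs D = (prod_cat (horz D) (horz D))
     \<lparr>ob := {(M, N). M \<in> ob (horz D) \<and> N \<in> ob (horz D) \<and> Ro D M = Lo D N},
      ar := {(\<alpha>, \<beta>). \<alpha> \<in> ar (horz D) \<and> \<beta> \<in> ar (horz D) \<and> Ra D \<alpha> = La D \<beta>}\<rparr>"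

definition local_cat :: "('o, 'v, 'm, 'c, 'z) dblcat_scheme \<Rightarrow> 'o \<Rightarrow> 'o \<Rightarrow> ('m, 'c) cat" where
  "local_cat D a b = (horz D)
     \<lparr>ob := {M \<in> ob (horz D). Lo D M = a \<and> Ro D M = b},
      ar := {\<alpha> \<in> ar (horz D). La D \<alpha> = idt (vert D) a \<and> Ra D \<alpha> = idt (vert D) b}\<rparr>"

text \<open>The coherence isomorphisms are globular, i.e. isomorphisms of the local categories, and
  natural with respect to all 2-cells.\<close>

locale double_category =
  fixes D :: "('o, 'v, 'm, 'c, 'z) dblcat_scheme" (structure)
  assumes unit_functor: "cat_functor (vert D) (horz D) (unitf D)"
    and left_functor: "cat_functor (horz D) (vert D) (leftf D)"
    and right_functor: "cat_functor (horz D) (vert D) (rightf D)"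
    and hcomp_functor: "cat_functor (composable_pairs D) (horz D) (hcomp D)"
    and unit_ob: "a \<in> ob (vert D) \<Longrightarrow>
      Lo D (on_ob (unitf D) a) = a \<and> Ro D (on_ob (unitf D) a) = a"
    and unit_ar: "f \<in> ar (vert D) \<Longrightarrow>
      La D (on_ar (unitf D) f) = f \<and> Ra D (on_ar (unitf D) f) = f"
    and hcomp_ob: "(M, N) \<in> ob (composable_pairs D) \<Longrightarrow>
      Lo D (M \<odot> N) = Lo D M \<and> Ro D (M \<odot> N) = Ro D N"
    and hcomp_ar: "(\<alpha>, \<beta>) \<in> ar (composable_pairs D) \<Longrightarrow>
      La D (\<alpha> \<odot>\<odot> \<beta>) = La D \<alpha> \<and> Ra D (\<alpha> \<odot>\<odot> \<beta>) = Ra D \<beta>"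
    and assoc_iso: "(M, N) \<in> ob (composable_pairs D) \<Longrightarrow> (N, P) \<in> ob (composable_pairs D) \<Longrightarrow>
      assoc D M N P \<in> Hom (local_cat D (Lo D M) (Ro D P)) ((M \<odot> N) \<odot> P) (M \<odot> (N \<odot> P)) \<and>
      isom (local_cat D (Lo D M) (Ro D P)) (assoc D M N P)"
    and assoc_natural:
      "(\<alpha>, \<beta>) \<in> ar (composable_pairs D) \<Longrightarrow> (\<beta>, \<gamma>) \<in> ar (composable_pairs D) \<Longrightarrow>
       \<alpha> \<in> Hom (horz D) M M' \<Longrightarrow> \<beta> \<in> Hom (horz D) N N' \<Longrightarrow> \<gamma> \<in> Hom (horz D) P P' \<Longrightarrow>
       assoc D M' N' P' \<cdot>\<^bsub>horz D\<^esub> ((\<alpha> \<odot>\<odot> \<beta>) \<odot>\<odot> \<gamma>) = (\<alpha> \<odot>\<odot> (\<beta> \<odot>\<odot> \<gamma>)) \<cdot>\<^bsub>horz D\<^esub> assoc D M N P"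
    and lunit_iso: "M \<in> ob (horz D) \<Longrightarrow>
      lunit D M \<in> Hom (local_cat D (Lo D M) (Ro D M)) (on_ob (unitf D) (Lo D M) \<odot> M) M \<and>
      isom (local_cat D (Lo D M) (Ro D M)) (lunit D M)"
    and lunit_natural: "\<alpha> \<in> Hom (horz D) M M' \<Longrightarrow>
      lunit D M' \<cdot>\<^bsub>horz D\<^esub> (on_ar (unitf D) (La D \<alpha>) \<odot>\<odot> \<alpha>) = \<alpha> \<cdot>\<^bsub>horz D\<^esub> lunit D M"
    and runit_iso: "M \<in> ob (horz D) \<Longrightarrow>
      runit D M \<in> Hom (local_cat D (Lo D M) (Ro D M)) (M \<odot> on_ob (unitf D) (Ro D M)) M \<and>
      isom (local_cat D (Lo D M) (Ro D M)) (runit D M)"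
    and runit_natural: "\<alpha> \<in> Hom (horz D) M M' \<Longrightarrow>
      runit D M' \<cdot>\<^bsub>horz D\<^esub> (\<alpha> \<odot>\<odot> on_ar (unitf D) (Ra D \<alpha>)) = \<alpha> \<cdot>\<^bsub>horz D\<^esub> runit D M"
    and pentagon:
      "(M, N) \<in> ob (composable_pairs D) \<Longrightarrow> (N, P) \<in> ob (composable_pairs D) \<Longrightarrow>
       (P, Q) \<in> ob (composable_pairs D) \<Longrightarrow>
       (idt (horz D) M \<odot>\<odot> assoc D N P Q) \<cdot>\<^bsub>horz D\<^esub> assoc D M (N \<odot> P) Q
         \<cdot>\<^bsub>horz D\<^esub> (assoc D M N P \<odot>\<odot> idt (horz D) Q)
       = assoc D M N (P \<odot> Q) \<cdot>\<^bsub>horz D\<^esub> assoc D (M \<odot> N) P Q"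
    and triangle: "(M, N) \<in> ob (composable_pairs D) \<Longrightarrow>
       (idt (horz D) M \<odot>\<odot> lunit D N) \<cdot>\<^bsub>horz D\<^esub> assoc D M (on_ob (unitf D) (Ro D M)) N
       = runit D M \<odot>\<odot> idt (horz D) N"

locale framed_bicategory = double_category D
  for D :: "('o, 'v, 'm, 'c, 'z) dblcat_scheme" (structure) +
  assumes LR_bifibration:
    "bifibration (horz D) (prod_cat (vert D) (vert D)) (pairing (leftf D) (rightf D))"

text \<open>The group structure on the sets of globular 2-cells between parallel 1-cells is carried
  as data; it is determined by the underlying local category as soon as that is abelian.\<close>

record ('o, 'v, 'm, 'c) ab_dblcat = "('o, 'v, 'm, 'c) dblcat" +
  cell_add :: "'c \<Rightarrow> 'c \<Rightarrow> 'c"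
  cell_zero :: "'m \<Rightarrow> 'm \<Rightarrow> 'c"

definition local_ab ::
  "('o, 'v, 'm, 'c, 'z) ab_dblcat_scheme \<Rightarrow> 'o \<Rightarrow> 'o \<Rightarrow> ('m, 'c) abcat" where
  "local_ab A a b = cat.extend (local_cat A a b) (abcat.fields (cell_add A) (cell_zero A))"

locale abelian_framed_bicategory = framed_bicategory A
  for A :: "('o, 'v, 'm, 'c, 'z) ab_dblcat_scheme" (structure) +
  assumes local_abelian: "a \<in> ob (vert A) \<Longrightarrow> b \<in> ob (vert A) \<Longrightarrow> abelian_category (local_ab A a b)"
    and hcomp_additive_left:
      "\<alpha> \<in> Hom (local_ab A a b) M M' \<Longrightarrow> \<alpha>' \<in> Hom (local_ab A a b) M M' \<Longrightarrow>
       \<beta> \<in> Hom (local_ab A b c) N N' \<Longrightarrow>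
       cell_add A \<alpha> \<alpha>' \<odot>\<odot> \<beta> = cell_add A (\<alpha> \<odot>\<odot> \<beta>) (\<alpha>' \<odot>\<odot> \<beta>)"
    and hcomp_additive_right:
      "\<alpha> \<in> Hom (local_ab A a b) M M' \<Longrightarrow>
       \<beta> \<in> Hom (local_ab A b c) N N' \<Longrightarrow> \<beta>' \<in> Hom (local_ab A b c) N N' \<Longrightarrow>
       \<alpha> \<odot>\<odot> cell_add A \<beta> \<beta>' = cell_add A (\<alpha> \<odot>\<odot> \<beta>) (\<alpha> \<odot>\<odot> \<beta>')"

text \<open>A choice of cocartesian lifts: \<open>\<kappa> f g N\<close> is the chosen 2-cell from \<open>N\<close> to
  \<open>f\<^sub>! N g\<^sub>!\<close> over \<open>(f, g)\<close>.\<close>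

definition cocartesian_choice ::
  "('o, 'v, 'm, 'c, 'z) dblcat_scheme \<Rightarrow> ('v \<Rightarrow> 'v \<Rightarrow> 'm \<Rightarrow> 'c) \<Rightarrow> bool" where
  "cocartesian_choice D \<kappa> \<longleftrightarrow>
     (\<forall>f \<in> ar (vert D). \<forall>g \<in> ar (vert D). \<forall>N \<in> ob (horz D).
        Lo D N = src (vert D) f \<and> Ro D N = src (vert D) g \<longrightarrow>
        cocartesian (horz D) (prod_cat (vert D) (vert D)) (pairing (leftf D) (rightf D)) (\<kappa> f g N) \<and>
        src (horz D) (\<kappa> f g N) = N \<and> La D (\<kappa> f g N) = f \<and> Ra D (\<kappa> f g N) = g)"

definition extension :: "('o, 'v, 'm, 'c, 'z) dblcat_scheme \<Rightarrow> ('v \<Rightarrow> 'v \<Rightarrow> 'm \<Rightarrow> 'c)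
    \<Rightarrow> 'v \<Rightarrow> 'v \<Rightarrow> ('m, 'c, 'm, 'c) fnctr" where
  "extension D \<kappa> f g =
     \<lparr>on_ob = (\<lambda>N. tgt (horz D) (\<kappa> f g N)),
      on_ar = (\<lambda>\<beta>. THE \<chi>.
        \<chi> \<in> Hom (local_cat D (tgt (vert D) f) (tgt (vert D) g))
              (tgt (horz D) (\<kappa> f g (src (horz D) \<beta>))) (tgt (horz D) (\<kappa> f g (tgt (horz D) \<beta>))) \<and>
        \<chi> \<cdot>\<^bsub>horz D\<^esub> \<kappa> f g (src (horz D) \<beta>) = \<kappa> f g (tgt (horz D) \<beta>) \<cdot>\<^bsub>horz D\<^esub> \<beta>)\<rparr>"


section \<open>Chain complexes and homology\<close>

text \<open>The differential \<open>bd X i\<close> goes from degree \<open>i + 1\<close> to degree \<open>i\<close>.\<close>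

datatype ('m, 'c) cplx = Cplx (cell: "nat \<Rightarrow> 'm") (bd: "nat \<Rightarrow> 'c")

datatype ('m, 'c) cmap =
  CMap (csrc: "('m, 'c) cplx") (ctgt: "('m, 'c) cplx") (component: "nat \<Rightarrow> 'c")

definition is_complex :: "('m, 'c, 'z) abcat_scheme \<Rightarrow> ('m, 'c) cplx \<Rightarrow> bool" where
  "is_complex C X \<longleftrightarrow>
     (\<forall>i. cell X i \<in> ob C \<and> bd X i \<in> Hom C (cell X (Suc i)) (cell X i) \<and>
          bd X i \<cdot>\<^bsub>C\<^esub> bd X (Suc i) = pzero C (cell X (Suc (Suc i))) (cell X i))"

definition complexes :: "('m, 'c, 'z) abcat_scheme \<Rightarrow> (('m, 'c) cplx, ('m, 'c) cmap) abcat" where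
  "complexes C =
     \<lparr>ob = {X. is_complex C X},
      ar = {\<phi>. is_complex C (csrc \<phi>) \<and> is_complex C (ctgt \<phi>) \<and>
             (\<forall>i. component \<phi> i \<in> Hom C (cell (csrc \<phi>) i) (cell (ctgt \<phi>) i) \<and>
                  bd (ctgt \<phi>) i \<cdot>\<^bsub>C\<^esub> component \<phi> (Suc i) = component \<phi> i \<cdot>\<^bsub>C\<^esub> bd (csrc \<phi>) i)},
      src = csrc, tgt = ctgt,
      idt = (\<lambda>X. CMap X X (\<lambda>i. idt C (cell X i))),
      cmp = (\<lambda>\<psi> \<phi>. CMap (csrc \<phi>) (ctgt \<psi>) (\<lambda>i. component \<psi> i \<cdot>\<^bsub>C\<^esub> component \<phi> i)),
      padd = (\<lambda>\<phi> \<psi>. CMap (csrc \<phi>) (ctgt \<phi>) (\<lambda>i. component \<phi> i \<boxplus>\<^bsub>C\<^esub> component \<psi> i)),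
      pzero = (\<lambda>X Y. CMap X Y (\<lambda>i. pzero C (cell X i) (cell Y i)))\<rparr>"

definition degreewise :: "('m, 'c, 'n, 'd) fnctr
    \<Rightarrow> (('m, 'c) cplx, ('m, 'c) cmap, ('n, 'd) cplx, ('n, 'd) cmap) fnctr" where
  "degreewise F =
     (let Fc = (\<lambda>X. Cplx (\<lambda>i. on_ob F (cell X i)) (\<lambda>i. on_ar F (bd X i))) in
      \<lparr>on_ob = Fc,
       on_ar = (\<lambda>\<phi>. CMap (Fc (csrc \<phi>)) (Fc (ctgt \<phi>)) (\<lambda>i. on_ar F (component \<phi> i)))\<rparr>)"

text \<open>The vertical arrows \<open>f\<close>, \<open>g\<close> belonging to a morphism of \<open>Ch A\<close> are recovered from any of
  its components as \<open>La\<close>, \<open>Ra\<close>, so they are not stored separately. Likewise the local category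
  of a complex is recovered from its degree zero cell.\<close>

definition Ch :: "('o, 'v, 'm, 'c, 'z) ab_dblcat_scheme \<Rightarrow> (('m, 'c) cplx, ('m, 'c) cmap) cat" where
  "Ch A =
     (let Obs = {X. \<exists>a \<in> ob (vert A). \<exists>b \<in> ob (vert A). is_complex (local_ab A a b) X} in
      \<lparr>ob = Obs,
       ar = {\<phi>. csrc \<phi> \<in> Obs \<and> ctgt \<phi> \<in> Obs \<and>
              (\<exists>f \<in> ar (vert A). \<exists>g \<in> ar (vert A). \<forall>i.
                 component \<phi> i \<in> Hom (horz A) (cell (csrc \<phi>) i) (cell (ctgt \<phi>) i) \<and>
                 La A (component \<phi> i) = f \<and> Ra A (component \<phi> i) = g \<and>
                 bd (ctgt \<phi>) i \<cdot>\<^bsub>horz A\<^esub> component \<phi> (Suc i) = component \<phi> i \<cdot>\<^bsub>horz A\<^esub> bd (csrc \<phi>) i)},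
       src = csrc, tgt = ctgt,
       idt = (\<lambda>X. CMap X X (\<lambda>i. idt (horz A) (cell X i))),
       cmp = (\<lambda>\<psi> \<phi>. CMap (csrc \<phi>) (ctgt \<psi>) (\<lambda>i. component \<psi> i \<cdot>\<^bsub>horz A\<^esub> component \<phi> i))\<rparr>)"

text \<open>The differential leaving degree \<open>i\<close>; in degree zero it is the map to the zero object.\<close>

definition out_bd :: "('m, 'c, 'z) abcat_scheme \<Rightarrow> ('m, 'c) cplx \<Rightarrow> nat \<Rightarrow> 'c" where
  "out_bd C X i = (case i of 0 \<Rightarrow> pzero C (cell X 0) (zero_ob C) | Suc j \<Rightarrow> bd X j)"

definition cycle_incl :: "('m, 'c, 'z) abcat_scheme \<Rightarrow> ('m, 'c) cplx \<Rightarrow> nat \<Rightarrow> 'c" where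
  "cycle_incl C X i = kernel_of C (out_bd C X i)"

definition bd_to_cycles :: "('m, 'c, 'z) abcat_scheme \<Rightarrow> ('m, 'c) cplx \<Rightarrow> nat \<Rightarrow> 'c" where
  "bd_to_cycles C X i =
     (THE b. b \<in> Hom C (cell X (Suc i)) (src C (cycle_incl C X i)) \<and>
             cycle_incl C X i \<cdot>\<^bsub>C\<^esub> b = bd X i)"

definition homology_proj :: "('m, 'c, 'z) abcat_scheme \<Rightarrow> ('m, 'c) cplx \<Rightarrow> nat \<Rightarrow> 'c" where
  "homology_proj C X i = cokernel_of C (bd_to_cycles C X i)"

definition homology :: "('m, 'c, 'z) abcat_scheme \<Rightarrow> ('m, 'c) cplx \<Rightarrow> nat \<Rightarrow> 'm" where
  "homology C X i = tgt C (homology_proj C X i)"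

text \<open>For an exact functor \<open>F\<close> from \<open>C\<close> to \<open>D\<close> and a chain map \<open>\<phi>\<close> from \<open>F X\<close> to \<open>Y\<close>, the
  morphism \<open>F (H\<^sub>i X) \<rightarrow> H\<^sub>i Y\<close> induced by \<open>\<phi>\<close>. Under the canonical identification of
  \<open>F (H\<^sub>i X)\<close> with \<open>H\<^sub>i (F X)\<close> it is \<open>H\<^sub>i \<phi>\<close>.\<close>

definition induced_on_cycles :: "('m, 'c, 'y) abcat_scheme \<Rightarrow> ('n, 'd, 'z) abcat_scheme
    \<Rightarrow> ('m, 'c, 'n, 'd) fnctr \<Rightarrow> ('m, 'c) cplx \<Rightarrow> ('n, 'd) cmap \<Rightarrow> nat \<Rightarrow> 'd" where
  "induced_on_cycles C D F X \<phi> i =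
     (THE z. z \<in> Hom D (on_ob F (src C (cycle_incl C X i))) (src D (cycle_incl D (ctgt \<phi>) i)) \<and>
             cycle_incl D (ctgt \<phi>) i \<cdot>\<^bsub>D\<^esub> z = component \<phi> i \<cdot>\<^bsub>D\<^esub> on_ar F (cycle_incl C X i))"

definition induced_on_homology :: "('m, 'c, 'y) abcat_scheme \<Rightarrow> ('n, 'd, 'z) abcat_scheme
    \<Rightarrow> ('m, 'c, 'n, 'd) fnctr \<Rightarrow> ('m, 'c) cplx \<Rightarrow> ('n, 'd) cmap \<Rightarrow> nat \<Rightarrow> 'd" where
  "induced_on_homology C D F X \<phi> i =
     (THE h. h \<in> Hom D (on_ob F (homology C X i)) (homology D (ctgt \<phi>) i) \<and>
             h \<cdot>\<^bsub>D\<^esub> on_ar F (homology_proj C X i)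
             = homology_proj D (ctgt \<phi>) i \<cdot>\<^bsub>D\<^esub> induced_on_cycles C D F X \<phi> i)"


section \<open>Relative pairs and good covers\<close>

text \<open>Throughout, \<open>A\<close> is an abelian framed bicategory with chosen cocartesian lifts \<open>\<kappa>\<close>, \<open>C\<close> a
  category, and \<open>M\<close> a functor from \<open>C\<close> to \<open>Ch A\<close>.\<close>

definition ambient :: "('o, 'v, 'm, 'c) ab_dblcat \<Rightarrow> ('x, 'y, ('m, 'c) cplx, ('m, 'c) cmap) fnctr
    \<Rightarrow> 'x \<Rightarrow> ('m, 'c) abcat" where
  "ambient A M x =
     local_ab A (Lo A (cell (on_ob M x) 0)) (Ro A (cell (on_ob M x) 0))"

definition pushforward :: "('o, 'v, 'm, 'c) ab_dblcat \<Rightarrow> ('v \<Rightarrow> 'v \<Rightarrow> 'm \<Rightarrow> 'c)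
    \<Rightarrow> ('x, 'y, ('m, 'c) cplx, ('m, 'c) cmap) fnctr \<Rightarrow> 'y \<Rightarrow> ('m, 'c, 'm, 'c) fnctr" where
  "pushforward A \<kappa> M f =
     extension A \<kappa> (La A (component (on_ar M f) 0)) (Ra A (component (on_ar M f) 0))"

definition cocartesian_map :: "('o, 'v, 'm, 'c) ab_dblcat \<Rightarrow> ('v \<Rightarrow> 'v \<Rightarrow> 'm \<Rightarrow> 'c)
    \<Rightarrow> ('x, 'y) cat \<Rightarrow> ('x, 'y, ('m, 'c) cplx, ('m, 'c) cmap) fnctr \<Rightarrow> 'y \<Rightarrow> ('m, 'c) cmap" where
  "cocartesian_map A \<kappa> C M f =
     CMap (on_ob M (src C f)) (on_ob (degreewise (pushforward A \<kappa> M f)) (on_ob M (src C f)))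
       (\<lambda>i. \<kappa> (La A (component (on_ar M f) 0)) (Ra A (component (on_ar M f) 0)) (cell (on_ob M (src C f)) i))"

definition factorization :: "('o, 'v, 'm, 'c) ab_dblcat \<Rightarrow> ('v \<Rightarrow> 'v \<Rightarrow> 'm \<Rightarrow> 'c)
    \<Rightarrow> ('x, 'y) cat \<Rightarrow> ('x, 'y, ('m, 'c) cplx, ('m, 'c) cmap) fnctr \<Rightarrow> 'y \<Rightarrow> ('m, 'c) cmap" where
  "factorization A \<kappa> C M f =
     (THE \<phi>. \<phi> \<in> Hom (complexes (ambient A M (tgt C f)))
                  (on_ob (degreewise (pushforward A \<kappa> M f)) (on_ob M (src C f)))
                  (on_ob M (tgt C f)) \<and>
             \<phi> \<cdot>\<^bsub>Ch A\<^esub> cocartesian_map A \<kappa> C M f = on_ar M f)"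

definition relative_pair :: "('o, 'v, 'm, 'c) ab_dblcat \<Rightarrow> ('v \<Rightarrow> 'v \<Rightarrow> 'm \<Rightarrow> 'c)
    \<Rightarrow> ('x, 'y) cat \<Rightarrow> ('x, 'y, ('m, 'c) cplx, ('m, 'c) cmap) fnctr \<Rightarrow> 'y \<Rightarrow> bool" where
  "relative_pair A \<kappa> C M f \<longleftrightarrow> f \<in> ar C \<and>
     exact_functor (ambient A M (src C f)) (ambient A M (tgt C f)) (pushforward A \<kappa> M f) \<and>
     monic (complexes (ambient A M (tgt C f))) (factorization A \<kappa> C M f)"

text \<open>For \<open>f : Y \<rightarrow> X\<close>, the quotient map \<open>M(X) \<rightarrow> M(X, Y)\<close> and the complex \<open>M(X, Y)\<close>.\<close>

definition rel_quotient :: "('o, 'v, 'm, 'c) ab_dblcat \<Rightarrow> ('v \<Rightarrow> 'v \<Rightarrow> 'm \<Rightarrow> 'c)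
    \<Rightarrow> ('x, 'y) cat \<Rightarrow> ('x, 'y, ('m, 'c) cplx, ('m, 'c) cmap) fnctr \<Rightarrow> 'y \<Rightarrow> ('m, 'c) cmap" where
  "rel_quotient A \<kappa> C M f =
     cokernel_of (complexes (ambient A M (tgt C f))) (factorization A \<kappa> C M f)"

definition rel_complex :: "('o, 'v, 'm, 'c) ab_dblcat \<Rightarrow> ('v \<Rightarrow> 'v \<Rightarrow> 'm \<Rightarrow> 'c)
    \<Rightarrow> ('x, 'y) cat \<Rightarrow> ('x, 'y, ('m, 'c) cplx, ('m, 'c) cmap) fnctr \<Rightarrow> 'y \<Rightarrow> ('m, 'c) cplx" where
  "rel_complex A \<kappa> C M f = ctgt (rel_quotient A \<kappa> C M f)"

text \<open>For a square with \<open>j\<^sub>1 : X\<^sub>1\<^sub>2 \<rightarrow> X\<^sub>1\<close>, \<open>k\<^sub>1 : X\<^sub>1 \<rightarrow> X\<close> and \<open>k\<^sub>2 : X\<^sub>2 \<rightarrow> X\<close>, the canonical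
  morphism from the pushforward of \<open>M(X\<^sub>1, X\<^sub>1\<^sub>2)\<close> along \<open>k\<^sub>1\<close> to \<open>M(X, X\<^sub>2)\<close>.\<close>

definition excision_map :: "('o, 'v, 'm, 'c) ab_dblcat \<Rightarrow> ('v \<Rightarrow> 'v \<Rightarrow> 'm \<Rightarrow> 'c)
    \<Rightarrow> ('x, 'y) cat \<Rightarrow> ('x, 'y, ('m, 'c) cplx, ('m, 'c) cmap) fnctr
    \<Rightarrow> 'y \<Rightarrow> 'y \<Rightarrow> 'y \<Rightarrow> ('m, 'c) cmap" where
  "excision_map A \<kappa> C M j1 k1 k2 =
     (let Ch_X = complexes (ambient A M (tgt C k1)); push = degreewise (pushforward A \<kappa> M k1) in
      THE \<epsilon>. \<epsilon> \<in> Hom Ch_X (on_ob push (rel_complex A \<kappa> C M j1)) (rel_complex A \<kappa> C M k2) \<and>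
             \<epsilon> \<cdot>\<^bsub>Ch_X\<^esub> on_ar push (rel_quotient A \<kappa> C M j1)
             = rel_quotient A \<kappa> C M k2 \<cdot>\<^bsub>Ch_X\<^esub> factorization A \<kappa> C M k1)"

definition excisive :: "('o, 'v, 'm, 'c) ab_dblcat \<Rightarrow> ('v \<Rightarrow> 'v \<Rightarrow> 'm \<Rightarrow> 'c)
    \<Rightarrow> ('x, 'y) cat \<Rightarrow> ('x, 'y, ('m, 'c) cplx, ('m, 'c) cmap) fnctr \<Rightarrow> 'y \<Rightarrow> 'y \<Rightarrow> 'y \<Rightarrow> bool" where
  "excisive A \<kappa> C M j1 k1 k2 \<longleftrightarrow>
     (\<forall>i. isom (ambient A M (tgt C k1))
        (induced_on_homology (ambient A M (tgt C j1)) (ambient A M (tgt C k1))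
           (pushforward A \<kappa> M k1) (rel_complex A \<kappa> C M j1) (excision_map A \<kappa> C M j1 k1 k2) i))"

definition good_cover :: "('o, 'v, 'm, 'c) ab_dblcat \<Rightarrow> ('v \<Rightarrow> 'v \<Rightarrow> 'm \<Rightarrow> 'c)
    \<Rightarrow> ('x, 'y) cat \<Rightarrow> ('x, 'y, ('m, 'c) cplx, ('m, 'c) cmap) fnctr
    \<Rightarrow> 'x \<Rightarrow> 'x \<Rightarrow> 'x \<Rightarrow> 'x \<Rightarrow> 'y \<Rightarrow> 'y \<Rightarrow> 'y \<Rightarrow> 'y \<Rightarrow> bool" where
  "good_cover A \<kappa> C M X X1 X2 X12 j1 j2 k1 k2 \<longleftrightarrow>
     j1 \<in> Hom C X12 X1 \<and> j2 \<in> Hom C X12 X2 \<and> k1 \<in> Hom C X1 X \<and> k2 \<in> Hom C X2 X \<and>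
     k1 \<cdot>\<^bsub>C\<^esub> j1 = k2 \<cdot>\<^bsub>C\<^esub> j2 \<and>
     relative_pair A \<kappa> C M j1 \<and> relative_pair A \<kappa> C M j2 \<and>
     relative_pair A \<kappa> C M k1 \<and> relative_pair A \<kappa> C M k2 \<and>
     excisive A \<kappa> C M j1 k1 k2"

definition obj_homology :: "('o, 'v, 'm, 'c) ab_dblcat
    \<Rightarrow> ('x, 'y, ('m, 'c) cplx, ('m, 'c) cmap) fnctr \<Rightarrow> 'x \<Rightarrow> nat \<Rightarrow> 'm" where
  "obj_homology A M x i = homology (ambient A M x) (on_ob M x) i"

text \<open>For \<open>f : Y \<rightarrow> X\<close>, the homology of \<open>Y\<close> pushed forward to the local category of \<open>X\<close>.\<close>

definition push_homology :: "('o, 'v, 'm, 'c) ab_dblcat \<Rightarrow> ('v \<Rightarrow> 'v \<Rightarrow> 'm \<Rightarrow> 'c)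
    \<Rightarrow> ('x, 'y) cat \<Rightarrow> ('x, 'y, ('m, 'c) cplx, ('m, 'c) cmap) fnctr \<Rightarrow> 'y \<Rightarrow> nat \<Rightarrow> 'm" where
  "push_homology A \<kappa> C M f i = on_ob (pushforward A \<kappa> M f) (obj_homology A M (src C f) i)"

end

theory Submission
  imports Defs
begin

text \<open>Let \<open>P12\<close>, \<open>P1\<close>, \<open>P2\<close> be the complexes of the intersection and of the two pieces, pushed forward to
  the local category of \<open>X\<close>, and let \<open>N\<close> be the complex of \<open>X\<close>. They form a commutative square of
  chain maps \<open>a1 : P12 \<rightarrow> P1\<close>, \<open>a2 : P12 \<rightarrow> P2\<close>, \<open>b1 : P1 \<rightarrow> N\<close>, \<open>b2 : P2 \<rightarrow> N\<close>, in which \<open>a1\<close> and \<open>b2\<close>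
  are degreewise monic. Excision says that \<open>P1 / P12 \<rightarrow> N / P2\<close> is an isomorphism in homology. Read
  on chains, surjectivity and injectivity become two statements:
  \<^item> a chain \<open>n\<close> of \<open>N\<close> whose boundary lies in \<open>P2\<close> is a sum \<open>b1 p1 + b2 p2 + \<partial>n'\<close> where the boundary of
    \<open>p1\<close> lies in \<open>P12\<close>;
  \<^item> a chain \<open>p1\<close> of \<open>P1\<close> whose boundary lies in \<open>P12\<close> and whose image in \<open>N\<close> is a chain of \<open>P2\<close> plus
    a boundary is itself a chain of \<open>P12\<close> plus a boundary.

  With these two statements the Mayer-Vietoris sequence is built directly. The maps \<open>\<alpha> = (a1, a2)\<close> and
  \<open>\<beta> = b1 - b2\<close> are the evident ones. By the first statement every class of \<open>N\<close> has a representative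
  \<open>b1 p1 - b2 p2\<close> with \<open>\<partial>p1 = a1 p12\<close> and \<open>\<partial>p2 = a2 p12\<close> for a cycle \<open>p12\<close>; by the second the class of
  \<open>p12\<close> does not depend on the choices. It is the value of \<open>\<delta>\<close>, and each of the exactness claims is a
  short chase.

  The chases use generalised elements: an element of \<open>x\<close> is an arrow from an arbitrary object \<open>t\<close> to
  \<open>x\<close>, and existence statements are allowed to replace \<open>t\<close> by an object covering it, that is, to
  precompose with an epic arrow. This is sound because epic arrows can be lifted against
  (\<open>epic_lift\<close>), and a single-valued additive relation between generalised elements which is total up
  to covers defines an arrow (\<open>functional_relation\<close>); \<open>\<delta>\<close> is obtained in this way.

  Two facts link this to the framed bicategory. An exact functor \<open>F\<close> carries the kernel and cokernel
  that define the homology of a complex to a kernel and a cokernel, so \<open>F (H\<^sub>i)\<close> can be used as the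
  homology of the pushed forward complex (\<open>F_presents\<close>). And composites of cocartesian arrows are
  cocartesian, so pushing forward from the intersection in two steps gives an object isomorphic to the
  one-step pushforward; transporting the homology of \<open>P12\<close> along this isomorphism gives the term in
  the theorem.\<close>

section \<open>Categories\<close>

lemma Hom_ar: "f \<in> ar C \<Longrightarrow> f \<in> Hom C (src C f) (tgt C f)"
  by (simp add: Hom_def)

context category
begin

lemma cmp_ar: "f \<in> ar C \<Longrightarrow> g \<in> ar C \<Longrightarrow> src C g = tgt C f \<Longrightarrow> g \<cdot> f \<in> ar C"
  and src_cmp: "f \<in> ar C \<Longrightarrow> g \<in> ar C \<Longrightarrow> src C g = tgt C f \<Longrightarrow> src C (g \<cdot> f) = src C f"
  and tgt_cmp: "f \<in> ar C \<Longrightarrow> g \<in> ar C \<Longrightarrow> src C g = tgt C f \<Longrightarrow> tgt C (g \<cdot> f) = tgt C g"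
  using cmp_Hom[of f "src C f" "tgt C f" g "tgt C g"] by (auto simp: Hom_def)

lemma idt_ar: "x \<in> ob C \<Longrightarrow> idt C x \<in> ar C"
  and src_idt: "x \<in> ob C \<Longrightarrow> src C (idt C x) = x"
  and tgt_idt: "x \<in> ob C \<Longrightarrow> tgt C (idt C x) = x"
  using idt_Hom[of x] by (auto simp: Hom_def)

lemma assoc_ar: "f \<in> ar C \<Longrightarrow> g \<in> ar C \<Longrightarrow> h \<in> ar C \<Longrightarrow> src C g = tgt C f \<Longrightarrow> src C h = tgt C g
    \<Longrightarrow> (h \<cdot> g) \<cdot> f = h \<cdot> (g \<cdot> f)"
  by (rule cmp_assoc) (auto simp: Hom_def)

lemma idt_left_ar: "f \<in> ar C \<Longrightarrow> tgt C f = y \<Longrightarrow> idt C y \<cdot> f = f"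
  and idt_right_ar: "f \<in> ar C \<Longrightarrow> src C f = x \<Longrightarrow> f \<cdot> idt C x = f"
  by (auto intro!: idt_left idt_right simp: Hom_def)

lemmas cat_simps = cmp_ar src_cmp tgt_cmp idt_ar src_idt tgt_idt assoc_ar idt_left_ar
  idt_right_ar src_ob tgt_ob

lemma Hom_ob: "f \<in> Hom C x y \<Longrightarrow> x \<in> ob C" "f \<in> Hom C x y \<Longrightarrow> y \<in> ob C"
  by (auto simp: Hom_def src_ob tgt_ob)

lemma monicD:
  "monic C f \<Longrightarrow> f \<in> Hom C x y \<Longrightarrow> g \<in> Hom C t x \<Longrightarrow> h \<in> Hom C t x \<Longrightarrow> f \<cdot> g = f \<cdot> h \<Longrightarrow> g = h"
  using Hom_ob(1)[of g t x] by (auto simp: monic_def Hom_def)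

lemma epicD:
  "epic C f \<Longrightarrow> f \<in> Hom C x y \<Longrightarrow> g \<in> Hom C y t \<Longrightarrow> h \<in> Hom C y t \<Longrightarrow> g \<cdot> f = h \<cdot> f \<Longrightarrow> g = h"
  using Hom_ob(2)[of g y t] by (auto simp: epic_def Hom_def)

lemma monic_cmp:
  assumes "monic C f" "monic C g" "f \<in> Hom C x y" "g \<in> Hom C y z"
  shows "monic C (g \<cdot> f)"
  unfolding monic_def
proof (intro conjI ballI impI)
  show "g \<cdot> f \<in> ar C" using assms by (simp add: Hom_def cat_simps)
  fix t u v assume *: "u \<in> Hom C t (src C (g \<cdot> f))" "v \<in> Hom C t (src C (g \<cdot> f))"
    "(g \<cdot> f) \<cdot> u = (g \<cdot> f) \<cdot> v"
  have h: "u \<in> Hom C t x" "v \<in> Hom C t x" using * assms by (simp_all add: Hom_def cat_simps)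
  then have "g \<cdot> (f \<cdot> u) = g \<cdot> (f \<cdot> v)" using *(3) assms by (simp add: Hom_def cat_simps)
  then have "f \<cdot> u = f \<cdot> v"
    using monicD[OF assms(2) assms(4)] cmp_Hom[OF _ assms(3)] h by blast
  then show "u = v" using monicD[OF assms(1) assms(3)] h by blast
qed

lemma epic_cmp:
  assumes "epic C f" "epic C g" "f \<in> Hom C x y" "g \<in> Hom C y z"
  shows "epic C (g \<cdot> f)"
  unfolding epic_def
proof (intro conjI ballI impI)
  show "g \<cdot> f \<in> ar C" using assms by (simp add: Hom_def cat_simps)
  fix t u v assume *: "u \<in> Hom C (tgt C (g \<cdot> f)) t" "v \<in> Hom C (tgt C (g \<cdot> f)) t"
    "u \<cdot> (g \<cdot> f) = v \<cdot> (g \<cdot> f)"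
  have h: "u \<in> Hom C z t" "v \<in> Hom C z t" using * assms by (simp_all add: Hom_def cat_simps)
  then have "(u \<cdot> g) \<cdot> f = (v \<cdot> g) \<cdot> f" using *(3) assms by (simp add: Hom_def cat_simps)
  then have "u \<cdot> g = v \<cdot> g"
    using epicD[OF assms(1) assms(3)] cmp_Hom[OF assms(4)] h by blast
  then show "u = v" using epicD[OF assms(2) assms(4)] h by blast
qed

lemma isomE:
  assumes "isom C f" "f \<in> Hom C x y"
  obtains g where "g \<in> Hom C y x" "g \<cdot> f = idt C x" "f \<cdot> g = idt C y"
  using assms by (auto simp: isom_def Hom_def)

lemma isom_epic:
  assumes "isom C f" shows "epic C f"
proof -
  have f: "f \<in> Hom C (src C f) (tgt C f)" using assms by (simp add: isom_def Hom_def)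
  obtain g where g: "g \<in> Hom C (tgt C f) (src C f)" "f \<cdot> g = idt C (tgt C f)"
    using isomE[OF assms f] by blast
  have "u = v" if "u \<in> Hom C (tgt C f) t" "v \<in> Hom C (tgt C f) t" "u \<cdot> f = v \<cdot> f" for t u v
  proof -
    have "u = u \<cdot> (f \<cdot> g)" "v = v \<cdot> (f \<cdot> g)" using that g f by (simp_all add: Hom_def cat_simps)
    then show ?thesis using that cmp_assoc[OF g(1) f] by metis
  qed
  then show ?thesis using f by (auto simp: epic_def Hom_def)
qed

lemma isom_monic:
  assumes "isom C f" shows "monic C f"
proof -
  have f: "f \<in> Hom C (src C f) (tgt C f)" using assms by (simp add: isom_def Hom_def)
  obtain g where g: "g \<in> Hom C (tgt C f) (src C f)" "g \<cdot> f = idt C (src C f)"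
    using isomE[OF assms f] by blast
  have "u = v" if "u \<in> Hom C t (src C f)" "v \<in> Hom C t (src C f)" "f \<cdot> u = f \<cdot> v" for t u v
  proof -
    have "u = (g \<cdot> f) \<cdot> u" "v = (g \<cdot> f) \<cdot> v" using that g f by (simp_all add: Hom_def cat_simps)
    then show ?thesis using that cmp_assoc[OF _ f g(1)] by metis
  qed
  then show ?thesis using f by (auto simp: monic_def Hom_def)
qed

end


section \<open>Preadditive categories\<close>

definition pneg :: "('o, 'a, 'z) abcat_scheme \<Rightarrow> 'a \<Rightarrow> 'a" where
  "pneg C f = m_inv \<lparr>carrier = Hom C (src C f) (tgt C f), mult = padd C,
     one = pzero C (src C f) (tgt C f)\<rparr> f"

definition psub :: "('o, 'a, 'z) abcat_scheme \<Rightarrow> 'a \<Rightarrow> 'a \<Rightarrow> 'a"  (infixl "\<boxminus>\<index>" 65) where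
  "f \<boxminus>\<^bsub>C\<^esub> g = f \<boxplus>\<^bsub>C\<^esub> pneg C g"

context preadditive_category
begin

abbreviation zro where "zro x y \<equiv> pzero C x y"

abbreviation hom_group where
  "hom_group x y \<equiv> \<lparr>carrier = Hom C x y, mult = padd C, one = pzero C x y\<rparr>"

lemma hom_group: "f \<in> Hom C x y \<Longrightarrow> comm_group (hom_group x y)"
  using Hom_comm_group Hom_ob by blast

lemma zro_Hom: "x \<in> ob C \<Longrightarrow> y \<in> ob C \<Longrightarrow> zro x y \<in> Hom C x y"
  using Hom_comm_group[of x y] by (auto simp: comm_group_def group_def dest: monoid.one_closed)

lemma pneg_Hom: "f \<in> Hom C x y \<Longrightarrow> pneg C f \<in> Hom C x y"
  using group.inv_closed[of "hom_group x y" f] hom_group[of f x y]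
  by (auto simp: pneg_def comm_group_def Hom_def)

lemma padd_Hom: "f \<in> Hom C x y \<Longrightarrow> g \<in> Hom C x y \<Longrightarrow> f \<boxplus> g \<in> Hom C x y"
  using monoid.m_closed[of "hom_group x y" f g] hom_group[of f x y]
  by (auto simp: comm_group_def group_def)

lemma psub_Hom: "f \<in> Hom C x y \<Longrightarrow> g \<in> Hom C x y \<Longrightarrow> f \<boxminus> g \<in> Hom C x y"
  by (simp add: psub_def padd_Hom pneg_Hom)

lemma padd_assoc: "f \<in> Hom C x y \<Longrightarrow> g \<in> Hom C x y \<Longrightarrow> h \<in> Hom C x y
    \<Longrightarrow> (f \<boxplus> g) \<boxplus> h = f \<boxplus> (g \<boxplus> h)"
  using monoid.m_assoc[of "hom_group x y" f g h] hom_group[of f x y]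
  by (auto simp: comm_group_def group_def)

lemma padd_comm: "f \<in> Hom C x y \<Longrightarrow> g \<in> Hom C x y \<Longrightarrow> f \<boxplus> g = g \<boxplus> f"
  using comm_monoid.m_comm[of "hom_group x y" f g] hom_group[of f x y]
  by (auto simp: comm_group_def)

lemma padd_zro: "f \<in> Hom C x y \<Longrightarrow> f \<boxplus> zro x y = f" "f \<in> Hom C x y \<Longrightarrow> zro x y \<boxplus> f = f"
  using monoid.r_one[of "hom_group x y" f] monoid.l_one[of "hom_group x y" f] hom_group[of f x y]
  by (auto simp: comm_group_def group_def)

lemma padd_pneg: "f \<in> Hom C x y \<Longrightarrow> f \<boxplus> pneg C f = zro x y"
  using group.r_inv[of "hom_group x y" f] hom_group[of f x y]
  by (auto simp: comm_group_def pneg_def Hom_def)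

lemma padd_left_cancel:
  assumes "f \<in> Hom C x y" "g \<in> Hom C x y" "h \<in> Hom C x y" "f \<boxplus> g = f \<boxplus> h"
  shows "g = h"
proof -
  have "group (hom_group x y)" using hom_group[OF assms(1)] by (simp add: comm_group_def)
  from group.right_cancel[OF this, of f g h] show ?thesis
    using assms padd_comm[OF assms(1,2)] padd_comm[OF assms(1,3)] by simp
qed

lemma psub_self: "f \<in> Hom C x y \<Longrightarrow> f \<boxminus> f = zro x y"
  by (simp add: psub_def padd_pneg)

lemma psub_padd: "f \<in> Hom C x y \<Longrightarrow> g \<in> Hom C x y \<Longrightarrow> (f \<boxminus> g) \<boxplus> g = f"
  using padd_assoc[of f x y "pneg C g" g] padd_comm[of g x y "pneg C g"] padd_pneg[of g x y]
    padd_zro(1)[of f x y] pneg_Hom[of g x y] by (simp add: psub_def)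

lemma psub_eq_iff:
  assumes "f \<in> Hom C x y" "g \<in> Hom C x y" "h \<in> Hom C x y"
  shows "f \<boxminus> g = h \<longleftrightarrow> f = g \<boxplus> h"
proof -
  have d: "f \<boxminus> g \<in> Hom C x y" and "g \<boxplus> (f \<boxminus> g) = f"
    using psub_Hom assms psub_padd[OF assms(1,2)] padd_comm[of "f \<boxminus> g" x y g] by auto
  then show ?thesis using padd_left_cancel[OF assms(2) d assms(3)] by auto
qed

lemma psub_zro_iff:
  assumes "f \<in> Hom C x y" "g \<in> Hom C x y"
  shows "f \<boxminus> g = zro x y \<longleftrightarrow> f = g"
  using psub_eq_iff[OF assms zro_Hom] Hom_ob[OF assms(1)] padd_zro(1)[OF assms(2)] by simp

lemma psub_zro: "f \<in> Hom C x y \<Longrightarrow> f \<boxminus> zro x y = f"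
  using psub_eq_iff[of f x y "zro x y" f] zro_Hom Hom_ob[of f x y] padd_zro by simp

lemma cmp_zro:
  assumes "f \<in> Hom C x y" "z \<in> ob C"
  shows "f \<cdot> zro z x = zro z y" "zro y z \<cdot> f = zro x z"
proof -
  have ob: "x \<in> ob C" "y \<in> ob C" using Hom_ob[OF assms(1)] by auto
  have z: "zro z x \<in> Hom C z x" "zro y z \<in> Hom C y z" using zro_Hom ob assms by auto
  have c: "f \<cdot> zro z x \<in> Hom C z y" "zro y z \<cdot> f \<in> Hom C x z" using cmp_Hom z assms by auto
  have "f \<cdot> zro z x \<boxplus> f \<cdot> zro z x = f \<cdot> zro z x \<boxplus> zro z y"
    using cmp_padd_right[OF z(1) z(1) assms(1)] padd_zro z c by metis
  then show "f \<cdot> zro z x = zro z y" using padd_left_cancel c(1) zro_Hom ob assms(2) by metis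
  have "zro y z \<cdot> f \<boxplus> zro y z \<cdot> f = zro y z \<cdot> f \<boxplus> zro x z"
    using cmp_padd_left[OF assms(1) z(2) z(2)] padd_zro z c by metis
  then show "zro y z \<cdot> f = zro x z" using padd_left_cancel c(2) zro_Hom ob assms(2) by metis
qed

lemma cmp_psub_right:
  assumes "f \<in> Hom C x y" "f' \<in> Hom C x y" "g \<in> Hom C y z"
  shows "g \<cdot> (f \<boxminus> f') = (g \<cdot> f) \<boxminus> (g \<cdot> f')"
proof -
  have h: "g \<cdot> f \<in> Hom C x z" "g \<cdot> f' \<in> Hom C x z" "g \<cdot> (f \<boxminus> f') \<in> Hom C x z"
    using cmp_Hom psub_Hom assms by metis+
  have "g \<cdot> f = g \<cdot> f' \<boxplus> g \<cdot> (f \<boxminus> f')"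
    using assms psub_padd[OF assms(1,2)] cmp_padd_right[OF psub_Hom[OF assms(1,2)] assms(2,3)]
      padd_comm[OF h(2,3)] by simp
  then show ?thesis using psub_eq_iff[OF h] by simp
qed

lemma cmp_psub_left:
  assumes "f \<in> Hom C x y" "g \<in> Hom C y z" "g' \<in> Hom C y z"
  shows "(g \<boxminus> g') \<cdot> f = (g \<cdot> f) \<boxminus> (g' \<cdot> f)"
proof -
  have h: "g \<cdot> f \<in> Hom C x z" "g' \<cdot> f \<in> Hom C x z" "(g \<boxminus> g') \<cdot> f \<in> Hom C x z"
    using cmp_Hom psub_Hom assms by metis+
  have "g \<cdot> f = g' \<cdot> f \<boxplus> (g \<boxminus> g') \<cdot> f"
    using assms psub_padd[OF assms(2,3)] cmp_padd_left[OF assms(1) psub_Hom[OF assms(2,3)] assms(3)]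
      padd_comm[OF h(2,3)] by simp
  then show ?thesis using psub_eq_iff[OF h] by simp
qed

text \<open>The arrow-based forms let the simplifier discharge typing conditions of composites.\<close>

lemma add_ar:
  assumes "f \<in> ar C" "g \<in> ar C" "src C f = src C g" "tgt C f = tgt C g"
  shows "f \<boxplus> g \<in> ar C" "src C (f \<boxplus> g) = src C g" "tgt C (f \<boxplus> g) = tgt C g"
    "f \<boxminus> g \<in> ar C" "src C (f \<boxminus> g) = src C g" "tgt C (f \<boxminus> g) = tgt C g"
  using padd_Hom[of f "src C g" "tgt C g" g] psub_Hom[of f "src C g" "tgt C g" g] assms
  by (auto simp: Hom_def)

lemma zro_ar:
  assumes "x \<in> ob C" "y \<in> ob C"
  shows "zro x y \<in> ar C" "src C (zro x y) = x" "tgt C (zro x y) = y"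
  using zro_Hom[OF assms] by (auto simp: Hom_def)

lemma cmp_add_ar:
  assumes "f \<in> ar C" "g \<in> ar C" "src C f = src C g" "tgt C f = tgt C g" "h \<in> ar C"
  shows "src C h = tgt C g \<Longrightarrow> h \<cdot> (f \<boxplus> g) = h \<cdot> f \<boxplus> h \<cdot> g"
    "tgt C h = src C g \<Longrightarrow> (f \<boxplus> g) \<cdot> h = f \<cdot> h \<boxplus> g \<cdot> h"
    "src C h = tgt C g \<Longrightarrow> h \<cdot> (f \<boxminus> g) = h \<cdot> f \<boxminus> h \<cdot> g"
    "tgt C h = src C g \<Longrightarrow> (f \<boxminus> g) \<cdot> h = f \<cdot> h \<boxminus> g \<cdot> h"
  using assms cmp_padd_right[of f "src C g" "tgt C g" g h "tgt C h"]
    cmp_padd_left[of h "src C h" "src C g" f "tgt C g" g]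
    cmp_psub_right[of f "src C g" "tgt C g" g h "tgt C h"]
    cmp_psub_left[of h "src C h" "src C g" f "tgt C g" g] by (simp_all add: Hom_def)

lemma cmp_zro_ar:
  assumes "f \<in> ar C"
  shows "z \<in> ob C \<Longrightarrow> src C f = x \<Longrightarrow> f \<cdot> zro z x = zro z (tgt C f)"
    "z \<in> ob C \<Longrightarrow> tgt C f = x \<Longrightarrow> zro x z \<cdot> f = zro (src C f) z"
  using cmp_zro[OF Hom_ar[OF assms]] by auto

lemma add_zro_ar:
  assumes "f \<in> ar C" "src C f = x" "tgt C f = y"
  shows "f \<boxplus> zro x y = f" "zro x y \<boxplus> f = f" "f \<boxminus> zro x y = f" "f \<boxminus> f = zro x y"
  using padd_zro psub_zro psub_self assms by (auto simp: Hom_def)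

lemmas add_simps = cat_simps add_ar zro_ar cmp_add_ar cmp_zro_ar add_zro_ar

lemma monic_zroI:
  assumes "f \<in> Hom C x y"
    and "\<And>t g. g \<in> Hom C t x \<Longrightarrow> f \<cdot> g = zro t y \<Longrightarrow> g = zro t x"
  shows "monic C f"
  unfolding monic_def
proof (intro conjI ballI impI)
  show "f \<in> ar C" using assms by (simp add: Hom_def)
  fix t g h assume *: "g \<in> Hom C t (src C f)" "h \<in> Hom C t (src C f)" "f \<cdot> g = f \<cdot> h"
  then have gh: "g \<in> Hom C t x" "h \<in> Hom C t x" using assms by (auto simp: Hom_def)
  have "f \<cdot> (g \<boxminus> h) = zro t y"
    using cmp_psub_right[OF gh assms(1)] psub_self cmp_Hom gh assms(1) * by metis
  then have "g \<boxminus> h = zro t x" using assms(2) psub_Hom gh by blast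
  then show "g = h" using psub_zro_iff gh by simp
qed

lemma epic_zroI:
  assumes "f \<in> Hom C x y"
    and "\<And>t g. g \<in> Hom C y t \<Longrightarrow> g \<cdot> f = zro x t \<Longrightarrow> g = zro y t"
  shows "epic C f"
  unfolding epic_def
proof (intro conjI ballI impI)
  show "f \<in> ar C" using assms by (simp add: Hom_def)
  fix t g h assume *: "g \<in> Hom C (tgt C f) t" "h \<in> Hom C (tgt C f) t" "g \<cdot> f = h \<cdot> f"
  then have gh: "g \<in> Hom C y t" "h \<in> Hom C y t" using assms by (auto simp: Hom_def)
  have "(g \<boxminus> h) \<cdot> f = zro x t"
    using cmp_psub_left[OF assms(1) gh] psub_self cmp_Hom gh assms(1) * by metis
  then have "g \<boxminus> h = zro y t" using assms(2) psub_Hom gh by blast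
  then show "g = h" using psub_zro_iff gh by simp
qed

lemma monic_zroD:
  assumes "monic C f" "f \<in> Hom C x y" "g \<in> Hom C t x" "f \<cdot> g = zro t y"
  shows "g = zro t x"
  using monicD[OF assms(1,2,3) zro_Hom] assms(4) Hom_ob[OF assms(3)] cmp_zro(1)[OF assms(2)] by simp

lemma epic_zroD:
  assumes "epic C f" "f \<in> Hom C x y" "g \<in> Hom C y t" "g \<cdot> f = zro x t"
  shows "g = zro y t"
  using epicD[OF assms(1,2,3) zro_Hom] assms(4) Hom_ob[OF assms(3)] cmp_zro(2)[OF assms(2)] by simp

lemma kernel_Hom:
  assumes "is_kernel C f k" "f \<in> Hom C x y"
  shows "k \<in> Hom C (src C k) x" "f \<cdot> k = zro (src C k) y"
  using assms by (auto simp: is_kernel_def Hom_def)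

lemma kernel_lift:
  assumes "is_kernel C f k" "f \<in> Hom C x y" "g \<in> Hom C t x" "f \<cdot> g = zro t y"
  obtains h where "h \<in> Hom C t (src C k)" "k \<cdot> h = g"
proof -
  have "t \<in> ob C" using Hom_ob assms by blast
  moreover have "src C f = x" "tgt C f = y" using assms by (auto simp: Hom_def)
  ultimately have "\<exists>!h. h \<in> Hom C t (src C k) \<and> k \<cdot> h = g"
    using assms(1,3,4) by (simp add: is_kernel_def)
  then show ?thesis using that by blast
qed

lemma kernel_monic:
  assumes "is_kernel C f k" shows "monic C k"
  unfolding monic_def
proof (intro conjI ballI impI)
  have k: "f \<in> ar C" "k \<in> ar C" "tgt C k = src C f" "f \<cdot> k = zro (src C k) (tgt C f)"
    using assms by (auto simp: is_kernel_def)
  show "k \<in> ar C" by fact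
  fix t g h assume *: "t \<in> ob C" "g \<in> Hom C t (src C k)" "h \<in> Hom C t (src C k)" "k \<cdot> g = k \<cdot> h"
  have kg: "k \<cdot> g \<in> Hom C t (src C f)" using * k by (simp add: Hom_def cat_simps)
  have "f \<cdot> (k \<cdot> g) = zro (src C k) (tgt C f) \<cdot> g"
    using cmp_assoc[OF *(2), of k "src C f" f "tgt C f"] k by (simp add: Hom_def)
  then have "f \<cdot> (k \<cdot> g) = zro t (tgt C f)" using cmp_zro(2)[OF *(2)] k tgt_ob by simp
  then have "\<exists>!u. u \<in> Hom C t (src C k) \<and> k \<cdot> u = k \<cdot> g"
    using assms kg *(1) by (auto simp: is_kernel_def)
  then show "g = h" using * by metis
qed

lemma kernelI:
  assumes "f \<in> Hom C x y" "k \<in> Hom C w x" "f \<cdot> k = zro w y" "monic C k"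
    and "\<And>t g. g \<in> Hom C t x \<Longrightarrow> f \<cdot> g = zro t y \<Longrightarrow> \<exists>h \<in> Hom C t w. k \<cdot> h = g"
  shows "is_kernel C f k"
  unfolding is_kernel_def
proof (intro conjI ballI impI)
  fix t g assume *: "g \<in> Hom C t (src C f)" "f \<cdot> g = zro t (tgt C f)"
  have "\<exists>h \<in> Hom C t w. k \<cdot> h = g" using assms(1,5) * by (auto simp: Hom_def)
  then show "\<exists>!h. h \<in> Hom C t (src C k) \<and> k \<cdot> h = g"
    using monicD[OF assms(4,2)] assms(2) by (auto simp: Hom_def)
qed (use assms in \<open>auto simp: Hom_def\<close>)

lemma cokernel_Hom:
  assumes "is_cokernel C f c" "f \<in> Hom C x y"
  shows "c \<in> Hom C y (tgt C c)" "c \<cdot> f = zro x (tgt C c)"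
  using assms by (auto simp: is_cokernel_def Hom_def)

lemma cokernel_desc:
  assumes "is_cokernel C f c" "f \<in> Hom C x y" "g \<in> Hom C y t" "g \<cdot> f = zro x t"
  obtains h where "h \<in> Hom C (tgt C c) t" "h \<cdot> c = g"
proof -
  have "t \<in> ob C" using Hom_ob assms by blast
  moreover have "src C f = x" "tgt C f = y" using assms by (auto simp: Hom_def)
  ultimately have "\<exists>!h. h \<in> Hom C (tgt C c) t \<and> h \<cdot> c = g"
    using assms(1,3,4) by (simp add: is_cokernel_def)
  then show ?thesis using that by blast
qed

lemma cokernel_epic:
  assumes "is_cokernel C f k" shows "epic C k"
  unfolding epic_def
proof (intro conjI ballI impI)
  have k: "f \<in> ar C" "k \<in> ar C" "src C k = tgt C f" "k \<cdot> f = zro (src C f) (tgt C k)"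
    using assms by (auto simp: is_cokernel_def)
  show "k \<in> ar C" by fact
  fix t g h assume *: "t \<in> ob C" "g \<in> Hom C (tgt C k) t" "h \<in> Hom C (tgt C k) t" "g \<cdot> k = h \<cdot> k"
  have kg: "g \<cdot> k \<in> Hom C (tgt C f) t" using * k by (simp add: Hom_def cat_simps)
  have "(g \<cdot> k) \<cdot> f = g \<cdot> zro (src C f) (tgt C k)"
    using cmp_assoc[of f "src C f" "tgt C f" k "tgt C k" g t] *(2) k by (simp add: Hom_def)
  then have "(g \<cdot> k) \<cdot> f = zro (src C f) t" using cmp_zro(1)[OF *(2)] k src_ob by simp
  then have "\<exists>!u. u \<in> Hom C (tgt C k) t \<and> u \<cdot> k = g \<cdot> k"
    using assms kg *(1) by (auto simp: is_cokernel_def)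
  then show "g = h" using * by metis
qed

lemma cokernelI:
  assumes "f \<in> Hom C x y" "k \<in> Hom C y w" "k \<cdot> f = zro x w" "epic C k"
    and "\<And>t g. g \<in> Hom C y t \<Longrightarrow> g \<cdot> f = zro x t \<Longrightarrow> \<exists>h \<in> Hom C w t. h \<cdot> k = g"
  shows "is_cokernel C f k"
  unfolding is_cokernel_def
proof (intro conjI ballI impI)
  fix t g assume *: "g \<in> Hom C (tgt C f) t" "g \<cdot> f = zro (src C f) t"
  have "\<exists>h \<in> Hom C w t. h \<cdot> k = g" using assms(1,5) * by (auto simp: Hom_def)
  then show "\<exists>!h. h \<in> Hom C (tgt C k) t \<and> h \<cdot> k = g"
    using epicD[OF assms(4,2)] assms(2) by (auto simp: Hom_def)
qed (use assms in \<open>auto simp: Hom_def\<close>)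

lemma cokernel_isom:
  assumes c: "is_cokernel C f c" and t: "isom C t"
    and H: "f \<in> Hom C x y" "c \<in> Hom C y z" "t \<in> Hom C z w"
  shows "is_cokernel C f (t \<cdot> c)"
proof (rule cokernelI[OF H(1) cmp_Hom[OF H(2,3)]])
  have "c \<cdot> f = zro x z" using cokernel_Hom[OF c H(1)] H(2) by (simp add: Hom_def)
  then show "(t \<cdot> c) \<cdot> f = zro x w"
    using cmp_assoc[OF H] cmp_zro(1)[OF H(3)] Hom_ob[OF H(1)] by simp
  show "epic C (t \<cdot> c)" using epic_cmp[OF cokernel_epic[OF c] isom_epic[OF t] H(2,3)] .
  fix v g assume g: "g \<in> Hom C y v" "g \<cdot> f = zro x v"
  obtain r where "r \<in> Hom C (tgt C c) v" "r \<cdot> c = g" using cokernel_desc[OF c H(1) g] .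
  then have r: "r \<in> Hom C z v" "r \<cdot> c = g" using H(2) by (auto simp: Hom_def)
  obtain t' where t': "t' \<in> Hom C w z" "t' \<cdot> t = idt C z" using isomE[OF t H(3)] by metis
  have "(r \<cdot> t') \<cdot> (t \<cdot> c) = r \<cdot> ((t' \<cdot> t) \<cdot> c)"
    using cmp_assoc[OF cmp_Hom[OF H(2,3)] t'(1) r(1)] cmp_assoc[OF H(2,3) t'(1)] by simp
  then show "\<exists>h\<in>Hom C w v. h \<cdot> (t \<cdot> c) = g"
    using t'(2) idt_left[OF H(2)] r(2) cmp_Hom[OF t'(1) r(1)] by auto
qed

end


section \<open>Abelian categories\<close>

context abelian_category
begin

text \<open>A monic arrow is the kernel of some arrow, and that arrow factors through the cokernel, so the
  cokernel already has the right kernel.\<close>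

lemma monic_kernel_of_cokernel:
  assumes "monic C m" "is_cokernel C m c"
  shows "is_kernel C c m"
proof -
  obtain g where g: "is_kernel C g m" using monic_normal[OF assms(1)] by blast
  define x y z where "x = src C m" and "y = tgt C m" and "z = tgt C g"
  have h: "m \<in> Hom C x y" "g \<in> Hom C y z"
    using g by (auto simp: is_kernel_def Hom_def x_def y_def z_def)
  have c: "c \<in> Hom C y (tgt C c)" "c \<cdot> m = zro x (tgt C c)" using cokernel_Hom[OF assms(2) h(1)] by auto
  have gm: "g \<cdot> m = zro x z" using kernel_Hom[OF g h(2)] x_def by simp
  obtain u where u: "u \<in> Hom C (tgt C c) z" "u \<cdot> c = g"
    using cokernel_desc[OF assms(2) h gm] by blast
  show ?thesis
  proof (rule kernelI[OF c(1) h(1) c(2) assms(1)])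
    fix t v assume v: "v \<in> Hom C t y" "c \<cdot> v = zro t (tgt C c)"
    have "g \<cdot> v = u \<cdot> (c \<cdot> v)" using u v c by (auto simp: Hom_def cat_simps)
    also have "\<dots> = zro t z" using v u Hom_ob cmp_zro by metis
    finally show "\<exists>h\<in>Hom C t x. m \<cdot> h = v" using kernel_lift[OF g h(2) v(1)] x_def by metis
  qed
qed

lemma epic_cokernel_of_kernel:
  assumes "epic C m" "is_kernel C m c"
  shows "is_cokernel C c m"
proof -
  obtain g where g: "is_cokernel C g m" using epic_normal[OF assms(1)] by blast
  define x y z where "x = src C m" and "y = tgt C m" and "z = src C g"
  have h: "m \<in> Hom C x y" "g \<in> Hom C z x"
    using g by (auto simp: is_cokernel_def Hom_def x_def y_def z_def)
  have c: "c \<in> Hom C (src C c) x" "m \<cdot> c = zro (src C c) y" using kernel_Hom[OF assms(2) h(1)] by auto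
  have gm: "m \<cdot> g = zro z y" using cokernel_Hom[OF g h(2)] y_def by simp
  obtain u where u: "u \<in> Hom C z (src C c)" "c \<cdot> u = g"
    using kernel_lift[OF assms(2) h gm] by blast
  show ?thesis
  proof (rule cokernelI[OF c(1) h(1) c(2) assms(1)])
    fix t v assume v: "v \<in> Hom C x t" "v \<cdot> c = zro (src C c) t"
    have "v \<cdot> g = (v \<cdot> c) \<cdot> u" using cmp_assoc[OF u(1) c(1) v(1)] u(2) by simp
    also have "\<dots> = zro z t" using v u Hom_ob cmp_zro by metis
    finally show "\<exists>h\<in>Hom C y t. h \<cdot> m = v" using cokernel_desc[OF g h(2) v(1)] y_def by metis
  qed
qed

text \<open>If \<open>u\<close> kills the first factor, the kernel of \<open>u\<close> is a smaller subobject through which the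
  arrow factors; being normal, it must contain the kernel of the cokernel, so \<open>u\<close> vanishes.\<close>

lemma image_part_epic:
  assumes f: "f \<in> Hom C x y" and c: "is_cokernel C f c" and k: "is_kernel C c k"
    and e: "e \<in> Hom C x (src C k)" "k \<cdot> e = f"
  shows "epic C e"
proof (rule epic_zroI[OF e(1)])
  fix w u assume u: "u \<in> Hom C (src C k) w" "u \<cdot> e = zro x w"
  have cH: "c \<in> Hom C y (tgt C c)" "c \<cdot> f = zro x (tgt C c)" using cokernel_Hom[OF c f] by auto
  have kH: "k \<in> Hom C (src C k) y" "c \<cdot> k = zro (src C k) (tgt C c)" using kernel_Hom[OF k cH(1)] by auto
  obtain m where m: "is_kernel C u m" using ex_kernel u by (auto simp: Hom_def)
  have mH: "m \<in> Hom C (src C m) (src C k)" "u \<cdot> m = zro (src C m) w" using kernel_Hom[OF m u(1)] by auto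
  obtain e' where e': "e' \<in> Hom C x (src C m)" "m \<cdot> e' = e" using kernel_lift[OF m u(1) e(1) u(2)] .
  have km: "k \<cdot> m \<in> Hom C (src C m) y" using cmp_Hom mH kH by blast
  have "monic C (k \<cdot> m)" using monic_cmp kernel_monic k m mH kH by blast
  then obtain g where g: "is_kernel C g (k \<cdot> m)" using monic_normal by blast
  define z where "z = tgt C g"
  have gH: "g \<in> Hom C y z" using g km by (auto simp: is_kernel_def Hom_def z_def)
  have gkm: "g \<cdot> (k \<cdot> m) = zro (src C m) z" using kernel_Hom[OF g gH] km by (auto simp: Hom_def)
  have "g \<cdot> f = (g \<cdot> (k \<cdot> m)) \<cdot> e'" using gH km mH kH e' e by (auto simp: Hom_def cat_simps)
  also have "\<dots> = zro x z" using gkm e' Hom_ob[OF gH] cmp_zro by metis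
  finally obtain g' where g': "g' \<in> Hom C (tgt C c) z" "g' \<cdot> c = g"
    using cokernel_desc[OF c f gH] by blast
  have "g \<cdot> k = g' \<cdot> (c \<cdot> k)" using g' cH kH by (auto simp: Hom_def cat_simps)
  also have "\<dots> = zro (src C k) z" using kH g' Hom_ob cmp_zro by metis
  finally obtain v where v: "v \<in> Hom C (src C k) (src C m)" "(k \<cdot> m) \<cdot> v = k"
    using kernel_lift[OF g gH kH(1)] km by (auto simp: Hom_def)
  have "k \<cdot> (m \<cdot> v) = k \<cdot> idt C (src C k)" using v kH mH by (auto simp: Hom_def cat_simps)
  then have "m \<cdot> v = idt C (src C k)"
    using monicD[OF kernel_monic[OF k] kH(1)] cmp_Hom[OF v(1) mH(1)] idt_Hom Hom_ob[OF mH(1)] by blast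
  then have "u = (u \<cdot> m) \<cdot> v" using cmp_assoc[OF v(1) mH(1) u(1)] idt_right[OF u(1)] by simp
  then show "u = zro (src C k) w" using mH v cmp_zro Hom_ob[OF u(1)] by metis
qed

lemma image_factorization:
  assumes "f \<in> Hom C x y"
  obtains i e m where "e \<in> Hom C x i" "epic C e" "m \<in> Hom C i y" "monic C m" "m \<cdot> e = f"
proof -
  obtain c where c: "is_cokernel C f c" using ex_cokernel assms by (auto simp: Hom_def)
  have cH: "c \<in> Hom C y (tgt C c)" "c \<cdot> f = zro x (tgt C c)" using cokernel_Hom[OF c assms] by auto
  obtain k where k: "is_kernel C c k" using ex_kernel cH by (auto simp: Hom_def)
  obtain e where e: "e \<in> Hom C x (src C k)" "k \<cdot> e = f" using kernel_lift[OF k cH(1) assms cH(2)] .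
  show ?thesis using that e image_part_epic[OF assms c k e] kernel_Hom[OF k cH(1)] kernel_monic[OF k]
    by blast
qed

text \<open>Exactness is defined through the image; for a monic first arrow and an epic second arrow it says
  that each is the (co)kernel of the other.\<close>

lemma short_exact_iff:
  "short_exact C f g \<longleftrightarrow> is_kernel C g f \<and> is_cokernel C f g"
proof
  assume "short_exact C f g"
  then obtain c k where *: "monic C f" "epic C g" "is_cokernel C f c" "is_kernel C c k" "is_kernel C g k"
    unfolding short_exact_def exact_at_def by blast
  have "is_kernel C c f" using monic_kernel_of_cokernel * by blast
  define x y z where "x = src C f" and "y = tgt C f" and "z = tgt C g"
  have H: "f \<in> Hom C x y" using * by (auto simp: is_cokernel_def Hom_def x_def y_def)
  have cH: "c \<in> Hom C y (tgt C c)" "c \<cdot> f = zro x (tgt C c)" using cokernel_Hom[OF *(3) H] by auto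
  have kH: "k \<in> Hom C (src C k) y" using kernel_Hom[OF *(4) cH(1)] by auto
  have gH: "g \<in> Hom C y z" using *(5) kH by (auto simp: is_kernel_def Hom_def z_def)
  have gk: "g \<cdot> k = zro (src C k) z" using kernel_Hom[OF *(5) gH] by simp
  obtain f' where f': "f' \<in> Hom C x (src C k)" "k \<cdot> f' = f" using kernel_lift[OF *(4) cH(1) H cH(2)] .
  have gf: "g \<cdot> f = zro x z" using f' gk gH kH cmp_assoc[OF f'(1) kH gH] cmp_zro Hom_ob by metis
  have ker: "is_kernel C g f"
  proof (rule kernelI[OF gH H gf *(1)])
    fix t v assume v: "v \<in> Hom C t y" "g \<cdot> v = zro t z"
    obtain w where w: "w \<in> Hom C t (src C k)" "k \<cdot> w = v" using kernel_lift[OF *(5) gH v] .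
    have "c \<cdot> v = (c \<cdot> k) \<cdot> w" using w kH cH by (auto simp: Hom_def cat_simps)
    also have "\<dots> = zro t (tgt C c)" using kernel_Hom[OF *(4) cH(1)] w cmp_zro Hom_ob[OF cH(1)] by metis
    finally show "\<exists>h\<in>Hom C t x. f \<cdot> h = v"
      using kernel_lift[OF \<open>is_kernel C c f\<close> cH(1) v(1)] x_def by metis
  qed
  then show "is_kernel C g f \<and> is_cokernel C f g" using epic_cokernel_of_kernel * by blast
next
  assume *: "is_kernel C g f \<and> is_cokernel C f g"
  then show "short_exact C f g"
    unfolding short_exact_def exact_at_def using kernel_monic cokernel_epic by blast
qed


section \<open>Generalised elements\<close>

definition cover :: "'a \<Rightarrow> 'o \<Rightarrow> 'o \<Rightarrow> bool" where
  "cover e t' t \<longleftrightarrow> e \<in> Hom C t' t \<and> epic C e"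

lemma cover_cmp: "cover e t' t \<Longrightarrow> cover e' t'' t' \<Longrightarrow> cover (e \<cdot> e') t'' t"
  using epic_cmp cmp_Hom by (auto simp: cover_def)

lemma cover_Hom: "cover e t' t \<Longrightarrow> e \<in> Hom C t' t"
  by (simp add: cover_def)

lemma cover_cancel:
  "cover e t' t \<Longrightarrow> f \<in> Hom C t x \<Longrightarrow> g \<in> Hom C t x \<Longrightarrow> f \<cdot> e = g \<cdot> e \<Longrightarrow> f = g"
  using epicD by (auto simp: cover_def)

lemma cover_zro: "cover e t' t \<Longrightarrow> f \<in> Hom C t x \<Longrightarrow> f \<cdot> e = zro t' x \<Longrightarrow> f = zro t x"
  using epic_zroD by (auto simp: cover_def)

text \<open>Epic arrows are stable under pullback. The pullback of \<open>f\<close> and \<open>g\<close> is the kernel of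
  \<open>w = f p - g q\<close> on the biproduct. As \<open>w\<close> is epic, it is the cokernel of that kernel; an arrow that
  kills the projection of the kernel to \<open>t\<close> therefore factors through \<open>w\<close>, and restricting the
  factorization to the summand \<open>x\<close> shows that it vanishes.\<close>

lemma epic_lift:
  assumes f: "epic C f" "f \<in> Hom C x y" and g: "g \<in> Hom C t y"
  obtains t' e u where "cover e t' t" "u \<in> Hom C t' x" "f \<cdot> u = g \<cdot> e"
proof -
  have ob: "x \<in> ob C" "y \<in> ob C" "t \<in> ob C" using Hom_ob f g by blast+
  obtain s i j p q where "is_biproduct C x t s i j p q" using ex_biproduct ob by blast
  then have b: "i \<in> Hom C x s" "j \<in> Hom C t s" "p \<in> Hom C s x" "q \<in> Hom C s t"
      "p \<cdot> i = idt C x" "q \<cdot> j = idt C t" "p \<cdot> j = zro t x" "q \<cdot> i = zro x t"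
    by (auto simp: is_biproduct_def)
  have fp: "f \<cdot> p \<in> Hom C s y" and gq: "g \<cdot> q \<in> Hom C s y" using cmp_Hom b f g by blast+
  define w where "w = f \<cdot> p \<boxminus> g \<cdot> q"
  have w: "w \<in> Hom C s y" using psub_Hom[OF fp gq] w_def by simp
  have "w \<cdot> i = f \<cdot> (p \<cdot> i) \<boxminus> g \<cdot> (q \<cdot> i)"
    using b(1-4) f(2) g unfolding w_def by (simp add: Hom_def add_simps)
  also have "\<dots> = f" using b f(2) g ob by (simp add: Hom_def add_simps)
  finally have wi: "w \<cdot> i = f" .
  have we: "epic C w"
  proof (rule epic_zroI[OF w])
    fix v h assume h: "h \<in> Hom C y v" "h \<cdot> w = zro s v"
    have "h \<cdot> f = (h \<cdot> w) \<cdot> i" using cmp_assoc[OF b(1) w h(1)] wi by simp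
    also have "\<dots> = zro x v" using h cmp_zro(2)[OF b(1)] Hom_ob[OF h(1)] by simp
    finally show "h = zro y v" using epic_zroD f h by blast
  qed
  obtain m where m: "is_kernel C w m" using ex_kernel w by (auto simp: Hom_def)
  define t' where "t' = src C m"
  have mH: "m \<in> Hom C t' s" "w \<cdot> m = zro t' y" using kernel_Hom[OF m w] t'_def by auto
  have cok: "is_cokernel C m w" using epic_cokernel_of_kernel we m by blast
  have qm: "q \<cdot> m \<in> Hom C t' t" and pm: "p \<cdot> m \<in> Hom C t' x" using cmp_Hom b mH by blast+
  have "epic C (q \<cdot> m)"
  proof (rule epic_zroI[OF qm])
    fix v h assume h: "h \<in> Hom C t v" "h \<cdot> (q \<cdot> m) = zro t' v"
    have hq: "h \<cdot> q \<in> Hom C s v" "(h \<cdot> q) \<cdot> m = zro t' v"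
      using h b mH by (simp_all add: Hom_def cat_simps)
    obtain r where r: "r \<in> Hom C y v" "r \<cdot> w = h \<cdot> q"
      using cokernel_desc[OF cok mH(1) hq] w by (auto simp: Hom_def)
    have v: "v \<in> ob C" using h Hom_ob by blast
    have "r \<cdot> f = (h \<cdot> q) \<cdot> i" using wi r(2) cmp_assoc[OF b(1) w r(1)] by simp
    also have "\<dots> = h \<cdot> zro x t" using cmp_assoc[OF b(1) b(4) h(1)] b(8) by simp
    also have "\<dots> = zro x v" using cmp_zro(1)[OF h(1) ob(1)] .
    finally have "r = zro y v" using epic_zroD f r by blast
    then have "h \<cdot> q = zro s v" using r(2) cmp_zro(2)[OF w v] by simp
    then have "(h \<cdot> q) \<cdot> j = zro t v" using cmp_zro(2)[OF b(2) v] by simp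
    then show "h = zro t v" using b h by (simp add: Hom_def cat_simps)
  qed
  then have "cover (q \<cdot> m) t' t" using qm by (simp add: cover_def)
  moreover have "f \<cdot> (p \<cdot> m) = g \<cdot> (q \<cdot> m)"
  proof -
    have "f \<cdot> (p \<cdot> m) \<boxminus> g \<cdot> (q \<cdot> m) = w \<cdot> m"
      using w_def b(1-4) f g mH(1) by (simp add: Hom_def add_simps)
    then show ?thesis using mH(2) psub_zro_iff[OF cmp_Hom[OF pm f(2)] cmp_Hom[OF qm g]] by simp
  qed
  ultimately show ?thesis using that pm by blast
qed

text \<open>Elementwise exactness at the target of an arrow: what its cokernel kills comes, after passing to
  a cover, from its source. This combines the epic part of the image factorization with \<open>epic_lift\<close>.\<close>

lemma cokernel_lift:
  assumes f: "f \<in> Hom C x y" and c: "is_cokernel C f c" and g: "g \<in> Hom C t y" "c \<cdot> g = zro t (tgt C c)"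
  obtains t' e u where "cover e t' t" "u \<in> Hom C t' x" "f \<cdot> u = g \<cdot> e"
proof -
  have cH: "c \<in> Hom C y (tgt C c)" "c \<cdot> f = zro x (tgt C c)" using cokernel_Hom[OF c f] by auto
  obtain k where k: "is_kernel C c k" using ex_kernel cH by (auto simp: Hom_def)
  have kH: "k \<in> Hom C (src C k) y" using kernel_Hom[OF k cH(1)] by auto
  obtain i where i: "i \<in> Hom C x (src C k)" "k \<cdot> i = f" using kernel_lift[OF k cH(1) f cH(2)] .
  obtain v where v: "v \<in> Hom C t (src C k)" "k \<cdot> v = g" using kernel_lift[OF k cH(1) g] .
  obtain t' e u where u: "cover e t' t" "u \<in> Hom C t' x" "i \<cdot> u = v \<cdot> e"
    using epic_lift[OF image_part_epic[OF f c k i] i(1) v(1)] .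
  have "f \<cdot> u = g \<cdot> e" using cmp_assoc[OF u(2) i(1) kH] cmp_assoc[OF cover_Hom[OF u(1)] v(1) kH] i v u by simp
  then show ?thesis using that u by blast
qed

text \<open>The elementwise criterion through which all exactness claims are proved: the image of \<open>f\<close> and
  the kernel of \<open>g\<close> are subobjects with the same generalised elements.\<close>

lemma exact_atI:
  assumes f: "f \<in> Hom C x y" and g: "g \<in> Hom C y z" and gf: "g \<cdot> f = zro x z"
    and lift: "\<And>t v. v \<in> Hom C t y \<Longrightarrow> g \<cdot> v = zro t z \<Longrightarrow>
      \<exists>t' e u. cover e t' t \<and> u \<in> Hom C t' x \<and> f \<cdot> u = v \<cdot> e"
  shows "exact_at C f g"
proof -
  obtain c where c: "is_cokernel C f c" using ex_cokernel f by (auto simp: Hom_def)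
  have cH: "c \<in> Hom C y (tgt C c)" "c \<cdot> f = zro x (tgt C c)" using cokernel_Hom[OF c f] by auto
  obtain k where k: "is_kernel C c k" using ex_kernel cH by (auto simp: Hom_def)
  have kH: "k \<in> Hom C (src C k) y" "c \<cdot> k = zro (src C k) (tgt C c)" using kernel_Hom[OF k cH(1)] by auto
  obtain g' where g': "g' \<in> Hom C (tgt C c) z" "g' \<cdot> c = g" using cokernel_desc[OF c f g gf] .
  have "g \<cdot> k = g' \<cdot> (c \<cdot> k)" using g' cH kH cmp_assoc by metis
  also have "\<dots> = zro (src C k) z" using g' kH cmp_zro Hom_ob by metis
  finally have gk: "g \<cdot> k = zro (src C k) z" .
  have "is_kernel C g k"
  proof (rule kernelI[OF g kH(1) gk kernel_monic[OF k]])
    fix t v assume v: "v \<in> Hom C t y" "g \<cdot> v = zro t z"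
    obtain t' e u where u: "cover e t' t" "u \<in> Hom C t' x" "f \<cdot> u = v \<cdot> e" using lift[OF v] by blast
    have e: "e \<in> Hom C t' t" using u cover_Hom by blast
    have "(c \<cdot> v) \<cdot> e = (c \<cdot> f) \<cdot> u" using u v e cH f cmp_assoc by metis
    also have "\<dots> = zro t' (tgt C c)" using cH u cmp_zro Hom_ob by metis
    finally have "c \<cdot> v = zro t (tgt C c)" using cover_zro u cmp_Hom v cH by blast
    then show "\<exists>h\<in>Hom C t (src C k). k \<cdot> h = v" using kernel_lift[OF k cH(1) v(1)] by metis
  qed
  then show ?thesis using c k by (auto simp: exact_at_def)
qed

text \<open>A single-valued additive relation between generalised elements that is total after passing
  to covers is the graph of an arrow: apply totality to the identity.\<close>

lemma functional_relation:
  assumes ob: "x \<in> ob C" "y \<in> ob C"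
    and hom: "\<And>t u v. Q t u v \<Longrightarrow> u \<in> Hom C t x \<and> v \<in> Hom C t y"
    and stable: "\<And>t t' u v e. Q t u v \<Longrightarrow> e \<in> Hom C t' t \<Longrightarrow> Q t' (u \<cdot> e) (v \<cdot> e)"
    and diff: "\<And>t u v u' v'. Q t u v \<Longrightarrow> Q t u' v' \<Longrightarrow> Q t (u \<boxminus> u') (v \<boxminus> v')"
    and single: "\<And>t v. Q t (zro t x) v \<Longrightarrow> v = zro t y"
    and total: "\<And>t u. u \<in> Hom C t x \<Longrightarrow> \<exists>t' e v. cover e t' t \<and> Q t' (u \<cdot> e) v"
  obtains d where "d \<in> Hom C x y" "\<And>t u v. Q t u v \<Longrightarrow> v = d \<cdot> u"
proof -
  obtain t0 e v where ev: "cover e t0 x" "Q t0 (idt C x \<cdot> e) v" using total[OF idt_Hom] ob by blast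
  have e: "e \<in> Hom C t0 x" "epic C e" using ev by (auto simp: cover_def)
  have Q0: "Q t0 e v" using ev e by (simp add: idt_left)
  have v: "v \<in> Hom C t0 y" using hom Q0 by blast
  obtain k where k: "is_kernel C e k" using ex_kernel e by (auto simp: Hom_def)
  have kH: "k \<in> Hom C (src C k) t0" "e \<cdot> k = zro (src C k) x" using kernel_Hom[OF k e(1)] by auto
  have "v \<cdot> k = zro (src C k) y" using single stable[OF Q0 kH(1)] kH(2) by simp
  then obtain d where "d \<in> Hom C (tgt C e) y" and dv: "d \<cdot> e = v"
    using cokernel_desc[OF epic_cokernel_of_kernel[OF e(2) k] kH(1) v] by blast
  then have d: "d \<in> Hom C x y" using e by (simp add: Hom_def)
  have "w = d \<cdot> u" if Q: "Q t u w" for t u w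
  proof -
    have uw: "u \<in> Hom C t x" "w \<in> Hom C t y" using hom Q by auto
    obtain t' e' s where s: "cover e' t' t" "s \<in> Hom C t' t0" "e \<cdot> s = u \<cdot> e'"
      using epic_lift[OF e(2,1) uw(1)] .
    have e': "e' \<in> Hom C t' t" using s cover_Hom by blast
    have "Q t' (u \<cdot> e' \<boxminus> e \<cdot> s) (w \<cdot> e' \<boxminus> v \<cdot> s)"
      using diff stable[OF Q e'] stable[OF Q0 s(2)] by blast
    then have "w \<cdot> e' \<boxminus> v \<cdot> s = zro t' y"
      using single s(3) psub_self[OF cmp_Hom[OF e' uw(1)]] by simp
    then have "w \<cdot> e' = v \<cdot> s" using psub_zro_iff[OF cmp_Hom[OF e' uw(2)] cmp_Hom[OF s(2) v]] by simp
    also have "\<dots> = d \<cdot> (e \<cdot> s)" using cmp_assoc[OF s(2) e(1) d] dv by simp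
    also have "\<dots> = (d \<cdot> u) \<cdot> e'" using cmp_assoc[OF e' uw(1) d] s(3) by simp
    finally show "w = d \<cdot> u" using cover_cancel[OF s(1) uw(2) cmp_Hom[OF uw(1) d]] by simp
  qed
  then show ?thesis using that d by blast
qed

end


section \<open>Rearranging sums of arrows\<close>

context preadditive_category
begin

context
  fixes f g h
  assumes ar: "f \<in> ar C" "g \<in> ar C" "h \<in> ar C"
    and par: "src C f = src C h" "tgt C f = tgt C h" "src C g = src C h" "tgt C g = tgt C h"
begin

private lemma hom: "f \<in> Hom C (src C h) (tgt C h)" "g \<in> Hom C (src C h) (tgt C h)"
    "h \<in> Hom C (src C h) (tgt C h)"
  using ar par by (auto simp: Hom_def)

lemma padd_assoc_ar: "(f \<boxplus> g) \<boxplus> h = f \<boxplus> (g \<boxplus> h)" "f \<boxplus> (g \<boxplus> h) = g \<boxplus> (f \<boxplus> h)"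
  using padd_assoc hom padd_comm by metis+

lemma psub_eq: "f \<boxminus> g = h \<longleftrightarrow> f = g \<boxplus> h" "h = f \<boxminus> g \<longleftrightarrow> f = g \<boxplus> h"
  using psub_eq_iff hom by metis+

text \<open>These rules bring an expression in sums and differences to the form of one difference of two sums;
  together with \<open>psub_eq\<close> they turn equations between such expressions into equations between sums.\<close>

lemma psub_move: "(f \<boxminus> g) \<boxplus> h = (f \<boxplus> h) \<boxminus> g" "h \<boxplus> (f \<boxminus> g) = (h \<boxplus> f) \<boxminus> g"
    "(f \<boxminus> g) \<boxminus> h = f \<boxminus> (g \<boxplus> h)" "h \<boxminus> (f \<boxminus> g) = (h \<boxplus> g) \<boxminus> f"
proof -
  have fg: "f \<boxminus> g \<in> Hom C (src C h) (tgt C h)" "f \<boxminus> g \<boxplus> g = f" "g \<boxplus> (f \<boxminus> g) = f"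
    using psub_Hom psub_padd padd_comm hom by metis+
  have h': "(f \<boxminus> g) \<boxplus> h \<in> Hom C (src C h) (tgt C h)" "f \<boxplus> h \<in> Hom C (src C h) (tgt C h)"
      "g \<boxplus> h \<in> Hom C (src C h) (tgt C h)" "(f \<boxminus> g) \<boxminus> h \<in> Hom C (src C h) (tgt C h)"
      "h \<boxplus> g \<in> Hom C (src C h) (tgt C h)" "h \<boxminus> (f \<boxminus> g) \<in> Hom C (src C h) (tgt C h)"
    using padd_Hom[OF fg(1) hom(3)] padd_Hom hom psub_Hom[OF fg(1) hom(3)]
      psub_Hom[OF hom(3) fg(1)] by metis+
  have "f \<boxplus> h = g \<boxplus> ((f \<boxminus> g) \<boxplus> h)" using padd_assoc[OF hom(2) fg(1) hom(3)] fg by simp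
  then show 1: "(f \<boxminus> g) \<boxplus> h = (f \<boxplus> h) \<boxminus> g" using psub_eq_iff[OF h'(2) hom(2) h'(1)] by simp
  then show "h \<boxplus> (f \<boxminus> g) = (h \<boxplus> f) \<boxminus> g"
    using padd_comm[OF hom(3) fg(1)] padd_comm[OF hom(3) hom(1)] by simp
  have "f = g \<boxplus> (h \<boxplus> ((f \<boxminus> g) \<boxminus> h))"
    using fg psub_padd[OF fg(1) hom(3)] padd_comm[OF hom(3) h'(4)] by simp
  then have "f = (g \<boxplus> h) \<boxplus> ((f \<boxminus> g) \<boxminus> h)" using padd_assoc[OF hom(2,3) h'(4)] by simp
  then show "(f \<boxminus> g) \<boxminus> h = f \<boxminus> (g \<boxplus> h)" using psub_eq_iff[OF hom(1) h'(3,4)] by simp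
  have "h \<boxplus> g = (h \<boxminus> (f \<boxminus> g)) \<boxplus> ((f \<boxminus> g) \<boxplus> g)"
    using psub_padd[OF hom(3) fg(1)] padd_assoc[OF h'(6) fg(1) hom(2)] by simp
  then have "h \<boxplus> g = f \<boxplus> (h \<boxminus> (f \<boxminus> g))" using fg padd_comm[OF h'(6) hom(1)] by simp
  then show "h \<boxminus> (f \<boxminus> g) = (h \<boxplus> g) \<boxminus> f" using psub_eq_iff[OF h'(5) hom(1) h'(6)] by simp
qed

end

lemma padd_comm_ar: "f \<in> ar C \<Longrightarrow> g \<in> ar C \<Longrightarrow> src C f = src C g \<Longrightarrow> tgt C f = tgt C g \<Longrightarrow> f \<boxplus> g = g \<boxplus> f"
  using padd_comm[of f "src C g" "tgt C g" g] by (simp add: Hom_def)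

lemmas sum_simps = add_simps padd_assoc_ar padd_comm_ar psub_eq psub_move

text \<open>Composites are kept nested to the right, so an equation for a composite of two arrows is needed
  in the form in which it acts on an element.\<close>

lemma cmp_eq_Hom: "f \<in> Hom C x y \<Longrightarrow> g \<in> Hom C y z \<Longrightarrow> g \<cdot> f = k \<Longrightarrow> u \<in> ar C \<Longrightarrow> tgt C u = x
    \<Longrightarrow> g \<cdot> (f \<cdot> u) = k \<cdot> u"
  using cmp_assoc[of u "src C u" x f y g z] by (simp add: Hom_def)

end


section \<open>Homology by cycles and representatives\<close>

context abelian_category
begin

text \<open>For composable differentials \<open>d1 : X1 \<rightarrow> X\<close> and \<open>d0 : X \<rightarrow> X0\<close>, the arrow \<open>z\<close> is an inclusion of the
  cycles and \<open>h\<close> a projection of the cycles to the homology object \<open>H\<close>. The homology is a relation and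
  not a chosen object: it is preserved by exact functors, and \<open>H\<close> may be replaced by an isomorphic
  object.\<close>

definition presents :: "'o \<Rightarrow> 'o \<Rightarrow> 'o \<Rightarrow> 'o \<Rightarrow> 'a \<Rightarrow> 'a \<Rightarrow> 'a \<Rightarrow> 'a \<Rightarrow> bool" where
  "presents X1 X X0 H d1 d0 z h \<longleftrightarrow> d1 \<in> Hom C X1 X \<and> d0 \<in> Hom C X X0 \<and> is_kernel C d0 z \<and>
     h \<in> Hom C (src C z) H \<and> (\<exists>b \<in> Hom C X1 (src C z). z \<cdot> b = d1 \<and> is_cokernel C b h)"

text \<open>The element \<open>c\<close> is a cycle with homology class \<open>x\<close>; both are generalised elements defined on \<open>t\<close>.\<close>

definition reps :: "'a \<Rightarrow> 'a \<Rightarrow> 'o \<Rightarrow> 'a \<Rightarrow> 'a \<Rightarrow> bool" where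
  "reps z h t c x \<longleftrightarrow> (\<exists>u \<in> Hom C t (src C z). z \<cdot> u = c \<and> h \<cdot> u = x)"

context
  fixes X1 X X0 H d1 d0 z h
  assumes P: "presents X1 X X0 H d1 d0 z h"
begin

private lemma typing: "d1 \<in> Hom C X1 X" "d0 \<in> Hom C X X0" "z \<in> Hom C (src C z) X" "h \<in> Hom C (src C z) H"
    "d0 \<cdot> z = zro (src C z) X0" "epic C h" "monic C z"
  using P kernel_Hom[of d0 z X X0] kernel_monic cokernel_epic by (auto simp: presents_def)

lemma presents_bd: "d1 \<in> Hom C X1 X" "d0 \<in> Hom C X X0" "d0 \<cdot> d1 = zro X1 X0"
proof -
  show "d1 \<in> Hom C X1 X" "d0 \<in> Hom C X X0" using typing by auto
  obtain b where "b \<in> Hom C X1 (src C z)" "z \<cdot> b = d1" using P by (auto simp: presents_def)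
  then show "d0 \<cdot> d1 = zro X1 X0" using cmp_assoc[of b X1 "src C z" z X d0 X0] typing
      cmp_zro(2) Hom_ob(2)[OF typing(2)] by simp
qed

lemma reps_Hom:
  assumes "reps z h t c x"
  shows "c \<in> Hom C t X" "x \<in> Hom C t H" "d0 \<cdot> c = zro t X0"
proof -
  obtain u where u: "u \<in> Hom C t (src C z)" "z \<cdot> u = c" "h \<cdot> u = x" using assms by (auto simp: reps_def)
  show "c \<in> Hom C t X" "x \<in> Hom C t H" using u cmp_Hom typing by blast+
  show "d0 \<cdot> c = zro t X0" using cmp_assoc[OF u(1) typing(3,2)] u typing cmp_zro(2) Hom_ob(2)[OF typing(2)] by simp
qed

lemma reps_cycle:
  assumes "c \<in> Hom C t X" "d0 \<cdot> c = zro t X0"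
  obtains x where "reps z h t c x"
proof -
  have "is_kernel C d0 z" using P by (simp add: presents_def)
  then obtain u where "u \<in> Hom C t (src C z)" "z \<cdot> u = c" using kernel_lift typing assms by blast
  then show ?thesis using that by (auto simp: reps_def)
qed

lemma reps_lift:
  assumes "x \<in> Hom C t H"
  obtains t' e c where "cover e t' t" "reps z h t' c (x \<cdot> e)"
proof -
  obtain t' e u where "cover e t' t" "u \<in> Hom C t' (src C z)" "h \<cdot> u = x \<cdot> e"
    using epic_lift[OF typing(6,4) assms] .
  then show ?thesis using that[of e t' "z \<cdot> u"] by (auto simp: reps_def)
qed

lemma reps_stable:
  assumes "reps z h t c x" "e \<in> Hom C t' t" shows "reps z h t' (c \<cdot> e) (x \<cdot> e)"
proof -
  obtain u where u: "u \<in> Hom C t (src C z)" "z \<cdot> u = c" "h \<cdot> u = x" using assms by (auto simp: reps_def)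
  then show ?thesis using cmp_assoc[OF assms(2) u(1) typing(3)] cmp_assoc[OF assms(2) u(1) typing(4)]
      cmp_Hom[OF assms(2) u(1)] by (auto simp: reps_def)
qed

lemma reps_diff:
  assumes "reps z h t c x" "reps z h t c' x'" shows "reps z h t (c \<boxminus> c') (x \<boxminus> x')"
proof -
  obtain u where u: "u \<in> Hom C t (src C z)" "z \<cdot> u = c" "h \<cdot> u = x" using assms by (auto simp: reps_def)
  obtain v where v: "v \<in> Hom C t (src C z)" "z \<cdot> v = c'" "h \<cdot> v = x'" using assms by (auto simp: reps_def)
  show ?thesis using u v cmp_psub_right[OF u(1) v(1) typing(3)] cmp_psub_right[OF u(1) v(1) typing(4)]
      psub_Hom[OF u(1) v(1)] unfolding reps_def by metis
qed

lemma reps_boundary: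
  assumes "w \<in> Hom C t X1" shows "reps z h t (d1 \<cdot> w) (zro t H)"
proof -
  obtain b where b: "b \<in> Hom C X1 (src C z)" "z \<cdot> b = d1" "is_cokernel C b h"
    using P by (auto simp: presents_def)
  have "h \<cdot> b = zro X1 H" using cokernel_Hom[OF b(3,1)] typing(4) by (simp add: Hom_def)
  then have "h \<cdot> (b \<cdot> w) = zro t H"
    using cmp_assoc[OF assms b(1) typing(4)] cmp_zro(2)[OF assms] Hom_ob(2)[OF typing(4)] by simp
  then show ?thesis using cmp_assoc[OF assms b(1) typing(3)] b cmp_Hom[OF assms b(1)] unfolding reps_def by auto
qed

lemma reps_unique:
  assumes "reps z h t c x" "reps z h t c x'" shows "x = x'"
  using assms monicD[OF typing(7,3)] by (auto simp: reps_def)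

lemma reps_mod_boundary:
  assumes "reps z h t c x" "w \<in> Hom C t X1" shows "reps z h t (c \<boxminus> d1 \<cdot> w) x"
  using reps_diff[OF assms(1) reps_boundary[OF assms(2)]] psub_zro[OF reps_Hom(2)[OF assms(1)]] by simp

lemma reps_zro_boundary:
  assumes "reps z h t c (zro t H)"
  obtains t' e w where "cover e t' t" "w \<in> Hom C t' X1" "d1 \<cdot> w = c \<cdot> e"
proof -
  obtain b where b: "b \<in> Hom C X1 (src C z)" "z \<cdot> b = d1" "is_cokernel C b h"
    using P by (auto simp: presents_def)
  obtain u where u: "u \<in> Hom C t (src C z)" "z \<cdot> u = c" "h \<cdot> u = zro t H" using assms by (auto simp: reps_def)
  have "tgt C h = H" using typing(4) by (simp add: Hom_def)
  then obtain t' e w where w: "cover e t' t" "w \<in> Hom C t' X1" "b \<cdot> w = u \<cdot> e"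
    using cokernel_lift[OF b(1,3) u(1)] u(3) by metis
  have "d1 \<cdot> w = c \<cdot> e"
    using cmp_assoc[OF w(2) b(1) typing(3)] cmp_assoc[OF cover_Hom[OF w(1)] u(1) typing(3)] b u w by simp
  then show ?thesis using that w by blast
qed

lemma reps_zroI:
  assumes "reps z h t c x" "cover e t' t" "w \<in> Hom C t' X1" "d1 \<cdot> w = c \<cdot> e"
  shows "x = zro t H"
proof -
  have "reps z h t' (d1 \<cdot> w) (x \<cdot> e)" using reps_stable[OF assms(1) cover_Hom[OF assms(2)]] assms by simp
  then have "x \<cdot> e = zro t' H" using reps_unique reps_boundary[OF assms(3)] by blast
  then show ?thesis using cover_zro[OF assms(2) reps_Hom(2)[OF assms(1)]] by simp
qed

end

lemma biproduct_pair:
  assumes "is_biproduct C x y s i j p q" "u \<in> Hom C t x" "v \<in> Hom C t y"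
  obtains w where "w \<in> Hom C t s" "p \<cdot> w = u" "q \<cdot> w = v"
proof -
  have b: "i \<in> Hom C x s" "j \<in> Hom C y s" "p \<in> Hom C s x" "q \<in> Hom C s y"
      "p \<cdot> i = idt C x" "q \<cdot> j = idt C y" "p \<cdot> j = zro y x" "q \<cdot> i = zro x y"
    using assms(1) by (auto simp: is_biproduct_def)
  have ob: "x \<in> ob C" "y \<in> ob C" "t \<in> ob C" using Hom_ob assms by blast+
  have iu: "i \<cdot> u \<in> Hom C t s" "j \<cdot> v \<in> Hom C t s" using cmp_Hom b assms by blast+
  have "p \<cdot> (i \<cdot> u \<boxplus> j \<cdot> v) = (p \<cdot> i) \<cdot> u \<boxplus> (p \<cdot> j) \<cdot> v"
    using cmp_padd_right[OF iu b(3)] cmp_assoc[OF assms(2) b(1,3)] cmp_assoc[OF assms(3) b(2,3)] by simp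
  then have 1: "p \<cdot> (i \<cdot> u \<boxplus> j \<cdot> v) = u"
    using b(5,7) idt_left[OF assms(2)] cmp_zro(2)[OF assms(3) ob(1)] padd_zro(1)[OF assms(2)] by simp
  have "q \<cdot> (i \<cdot> u \<boxplus> j \<cdot> v) = (q \<cdot> i) \<cdot> u \<boxplus> (q \<cdot> j) \<cdot> v"
    using cmp_padd_right[OF iu b(4)] cmp_assoc[OF assms(2) b(1,4)] cmp_assoc[OF assms(3) b(2,4)] by simp
  then have 2: "q \<cdot> (i \<cdot> u \<boxplus> j \<cdot> v) = v"
    using b(6,8) idt_left[OF assms(3)] cmp_zro(2)[OF assms(2) ob(2)] padd_zro(2)[OF assms(3)] by simp
  show ?thesis using that[OF padd_Hom[OF iu] 1 2] .
qed

lemma biproduct_zro: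
  assumes "is_biproduct C x y s i j p q" "w \<in> Hom C t s" "p \<cdot> w = zro t x" "q \<cdot> w = zro t y"
  shows "w = zro t s"
proof -
  have b: "i \<in> Hom C x s" "j \<in> Hom C y s" "p \<in> Hom C s x" "q \<in> Hom C s y"
      "i \<cdot> p \<boxplus> j \<cdot> q = idt C s"
    using assms(1) by (auto simp: is_biproduct_def)
  have ob: "s \<in> ob C" "t \<in> ob C" using Hom_ob assms(2) by blast+
  have "w = (i \<cdot> p \<boxplus> j \<cdot> q) \<cdot> w" using b(5) idt_left[OF assms(2)] by simp
  also have "\<dots> = i \<cdot> (p \<cdot> w) \<boxplus> j \<cdot> (q \<cdot> w)"
    using cmp_padd_left[OF assms(2) cmp_Hom[OF b(3,1)] cmp_Hom[OF b(4,2)]]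
      cmp_assoc[OF assms(2) b(3,1)] cmp_assoc[OF assms(2) b(4,2)] by simp
  also have "\<dots> = zro t s"
    using assms(3,4) cmp_zro(1)[OF b(1) ob(2)] cmp_zro(1)[OF b(2) ob(2)] padd_zro(1)[OF zro_Hom[OF ob(2,1)]]
    by simp
  finally show ?thesis .
qed

lemma biproduct_eqI:
  assumes b: "is_biproduct C x y s i j p q" and w: "w \<in> Hom C t s" "w' \<in> Hom C t s"
    and eq: "p \<cdot> w = p \<cdot> w'" "q \<cdot> w = q \<cdot> w'"
  shows "w = w'"
proof -
  have pq: "p \<in> Hom C s x" "q \<in> Hom C s y" using b by (auto simp: is_biproduct_def)
  have "p \<cdot> (w \<boxminus> w') = zro t x" "q \<cdot> (w \<boxminus> w') = zro t y"
    using cmp_psub_right[OF w pq(1)] cmp_psub_right[OF w pq(2)] eq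
      psub_self[OF cmp_Hom[OF w(2) pq(1)]] psub_self[OF cmp_Hom[OF w(2) pq(2)]] by simp_all
  then show ?thesis using biproduct_zro[OF b psub_Hom[OF w]] psub_zro_iff[OF w] by simp
qed

end


context abelian_category
begin

text \<open>The arrow \<open>g\<close> induced on homology by a chain map. The arrow \<open>u\<close> on cycles is provided as well,
  since \<open>induced_on_homology\<close> is defined in terms of it.\<close>

lemma induced_arrow:
  assumes P: "presents X1 X X0 H d1 d0 z h" and P': "presents Y1 Y Y0 K e1 e0 z' h'"
    and f: "f1 \<in> Hom C X1 Y1" "f \<in> Hom C X Y" "f0 \<in> Hom C X0 Y0"
    and comm: "e1 \<cdot> f1 = f \<cdot> d1" "e0 \<cdot> f = f0 \<cdot> d0"
  obtains u g where "u \<in> Hom C (src C z) (src C z')" "z' \<cdot> u = f \<cdot> z" "g \<in> Hom C H K" "g \<cdot> h = h' \<cdot> u"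
    "\<And>t c x. reps z h t c x \<Longrightarrow> reps z' h' t (f \<cdot> c) (g \<cdot> x)"
proof -
  obtain b where b: "d1 \<in> Hom C X1 X" "d0 \<in> Hom C X X0" "is_kernel C d0 z" "h \<in> Hom C (src C z) H"
      "b \<in> Hom C X1 (src C z)" "z \<cdot> b = d1" "is_cokernel C b h"
    using P by (auto simp: presents_def)
  obtain b' where b': "e1 \<in> Hom C Y1 Y" "e0 \<in> Hom C Y Y0" "is_kernel C e0 z'" "h' \<in> Hom C (src C z') K"
      "b' \<in> Hom C Y1 (src C z')" "z' \<cdot> b' = e1" "is_cokernel C b' h'"
    using P' by (auto simp: presents_def)
  have z: "z \<in> Hom C (src C z) X" "d0 \<cdot> z = zro (src C z) X0" using kernel_Hom[OF b(3,2)] by auto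
  have z': "z' \<in> Hom C (src C z') Y" "e0 \<cdot> z' = zro (src C z') Y0" using kernel_Hom[OF b'(3,2)] by auto
  have h'b': "h' \<cdot> b' = zro Y1 K" using cokernel_Hom[OF b'(7,5)] b'(4) by (simp add: Hom_def)
  have zob: "src C z \<in> ob C" using Hom_ob z by blast
  have "e0 \<cdot> (f \<cdot> z) = f0 \<cdot> (d0 \<cdot> z)"
    using cmp_assoc[OF z(1) f(2) b'(2)] cmp_assoc[OF z(1) b(2) f(3)] comm by simp
  then have "e0 \<cdot> (f \<cdot> z) = zro (src C z) Y0" using z cmp_zro(1)[OF f(3) zob] by simp
  then obtain u where u: "u \<in> Hom C (src C z) (src C z')" "z' \<cdot> u = f \<cdot> z"
    using kernel_lift[OF b'(3,2) cmp_Hom[OF z(1) f(2)]] by blast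
  have "z' \<cdot> (u \<cdot> b) = z' \<cdot> (b' \<cdot> f1)"
    using cmp_assoc[OF b(5) u(1) z'(1)] cmp_assoc[OF b(5) z(1) f(2)] cmp_assoc[OF f(1) b'(5) z'(1)] u b b' comm
    by simp
  then have "u \<cdot> b = b' \<cdot> f1"
    using monicD[OF kernel_monic[OF b'(3)] z'(1) cmp_Hom[OF b(5) u(1)] cmp_Hom[OF f(1) b'(5)]] by blast
  then have "(h' \<cdot> u) \<cdot> b = (h' \<cdot> b') \<cdot> f1"
    using cmp_assoc[OF b(5) u(1) b'(4)] cmp_assoc[OF f(1) b'(5,4)] by simp
  then have "(h' \<cdot> u) \<cdot> b = zro X1 K" using h'b' cmp_zro(2)[OF f(1)] Hom_ob[OF b'(4)] by simp
  then obtain g where "g \<in> Hom C (tgt C h) K" and gh: "g \<cdot> h = h' \<cdot> u"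
    using cokernel_desc[OF b(7,5) cmp_Hom[OF u(1) b'(4)]] by blast
  then have g: "g \<in> Hom C H K" using b(4) by (simp add: Hom_def)
  have "reps z' h' t (f \<cdot> c) (g \<cdot> x)" if r: "reps z h t c x" for t c x
  proof -
    obtain v where v: "v \<in> Hom C t (src C z)" "z \<cdot> v = c" "h \<cdot> v = x" using r by (auto simp: reps_def)
    have "z' \<cdot> (u \<cdot> v) = f \<cdot> c" using cmp_assoc[OF v(1) u(1) z'(1)] cmp_assoc[OF v(1) z(1) f(2)] u v by simp
    moreover have "h' \<cdot> (u \<cdot> v) = g \<cdot> x"
      using cmp_assoc[OF v(1) u(1) b'(4)] cmp_assoc[OF v(1) b(4) g] gh v by simp
    ultimately show ?thesis using cmp_Hom[OF v(1) u(1)] by (auto simp: reps_def)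
  qed
  then show ?thesis using that u g gh by blast
qed

end

section \<open>The Mayer-Vietoris sequence of a square of complexes\<close>

text \<open>A commutative square of chain maps. Position \<open>Suc i\<close> of a sequence is degree \<open>i\<close> of the complex and
  position \<open>0\<close> lies below the lowest degree. Homology is thus only taken at positions which have a
  differential on both sides.\<close>

locale chain_square = abelian_category C
  for C :: "('o, 'a, 'z) abcat_scheme" (structure) +
  fixes P12 P1 P2 N H12 H1 H2 HN :: "nat \<Rightarrow> 'o"
    and d12 d1 d2 dN z12 h12 z1 h1 z2 h2 zN hN a1 a2 b1 b2 :: "nat \<Rightarrow> 'a"
  assumes pres12: "presents (P12 (Suc (Suc i))) (P12 (Suc i)) (P12 i) (H12 i) (d12 (Suc i)) (d12 i) (z12 i) (h12 i)"
    and pres1: "presents (P1 (Suc (Suc i))) (P1 (Suc i)) (P1 i) (H1 i) (d1 (Suc i)) (d1 i) (z1 i) (h1 i)"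
    and pres2: "presents (P2 (Suc (Suc i))) (P2 (Suc i)) (P2 i) (H2 i) (d2 (Suc i)) (d2 i) (z2 i) (h2 i)"
    and presN: "presents (N (Suc (Suc i))) (N (Suc i)) (N i) (HN i) (dN (Suc i)) (dN i) (zN i) (hN i)"
    and a1: "a1 i \<in> Hom C (P12 i) (P1 i)" "d1 i \<cdot> a1 (Suc i) = a1 i \<cdot> d12 i"
    and a2: "a2 i \<in> Hom C (P12 i) (P2 i)" "d2 i \<cdot> a2 (Suc i) = a2 i \<cdot> d12 i"
    and b1: "b1 i \<in> Hom C (P1 i) (N i)" "dN i \<cdot> b1 (Suc i) = b1 i \<cdot> d1 i"
    and b2: "b2 i \<in> Hom C (P2 i) (N i)" "dN i \<cdot> b2 (Suc i) = b2 i \<cdot> d2 i"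
    and square: "b1 i \<cdot> a1 i = b2 i \<cdot> a2 i"
    and a1_monic: "monic C (a1 i)" and b2_monic: "monic C (b2 i)"
begin

abbreviation "rep12 i \<equiv> reps (z12 i) (h12 i)"
abbreviation "rep1 i \<equiv> reps (z1 i) (h1 i)"
abbreviation "rep2 i \<equiv> reps (z2 i) (h2 i)"
abbreviation "repN i \<equiv> reps (zN i) (hN i)"

lemma obs: "P12 i \<in> ob C" "P1 i \<in> ob C" "P2 i \<in> ob C" "N i \<in> ob C"
    "H12 i \<in> ob C" "H1 i \<in> ob C" "H2 i \<in> ob C" "HN i \<in> ob C"
  using Hom_ob a1 a2 b1 b2 pres12[of i] pres1[of i] pres2[of i] presN[of i]
  by (auto simp: presents_def)

lemma d_Hom: "d12 i \<in> Hom C (P12 (Suc i)) (P12 i)" "d1 i \<in> Hom C (P1 (Suc i)) (P1 i)"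
    "d2 i \<in> Hom C (P2 (Suc i)) (P2 i)" "dN i \<in> Hom C (N (Suc i)) (N i)"
  using presents_bd(2) pres12[of i] pres1[of i] pres2[of i] presN[of i] by blast+

lemmas arrow_typing = a1(1)[simplified Hom_def mem_Collect_eq] a2(1)[simplified Hom_def mem_Collect_eq]
  b1(1)[simplified Hom_def mem_Collect_eq] b2(1)[simplified Hom_def mem_Collect_eq]
  d_Hom[simplified Hom_def mem_Collect_eq]

text \<open>The equations of the square as they act on an element, for use by the simplifier.\<close>

lemma chain_simps:
  assumes "u \<in> ar C"
  shows "tgt C u = P12 (Suc i) \<Longrightarrow> d1 i \<cdot> (a1 (Suc i) \<cdot> u) = a1 i \<cdot> (d12 i \<cdot> u)"
    "tgt C u = P12 (Suc i) \<Longrightarrow> d2 i \<cdot> (a2 (Suc i) \<cdot> u) = a2 i \<cdot> (d12 i \<cdot> u)"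
    "tgt C u = P1 (Suc i) \<Longrightarrow> dN i \<cdot> (b1 (Suc i) \<cdot> u) = b1 i \<cdot> (d1 i \<cdot> u)"
    "tgt C u = P2 (Suc i) \<Longrightarrow> dN i \<cdot> (b2 (Suc i) \<cdot> u) = b2 i \<cdot> (d2 i \<cdot> u)"
    "tgt C u = P12 i \<Longrightarrow> b1 i \<cdot> (a1 i \<cdot> u) = b2 i \<cdot> (a2 i \<cdot> u)"
    "tgt C u = P12 (Suc (Suc i)) \<Longrightarrow> d12 i \<cdot> (d12 (Suc i) \<cdot> u) = zro (src C u) (P12 i)"
    "tgt C u = P1 (Suc (Suc i)) \<Longrightarrow> d1 i \<cdot> (d1 (Suc i) \<cdot> u) = zro (src C u) (P1 i)"
    "tgt C u = P2 (Suc (Suc i)) \<Longrightarrow> d2 i \<cdot> (d2 (Suc i) \<cdot> u) = zro (src C u) (P2 i)"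
    "tgt C u = N (Suc (Suc i)) \<Longrightarrow> dN i \<cdot> (dN (Suc i) \<cdot> u) = zro (src C u) (N i)"
  using assms cmp_eq_Hom[OF a1(1) d_Hom(2) a1(2) assms] cmp_eq_Hom[OF a2(1) d_Hom(3) a2(2) assms]
    cmp_eq_Hom[OF b1(1) d_Hom(4) b1(2) assms] cmp_eq_Hom[OF b2(1) d_Hom(4) b2(2) assms]
    cmp_eq_Hom[OF a1(1) b1(1) square assms]
    cmp_eq_Hom[OF d_Hom(1) d_Hom(1) presents_bd(3)[OF pres12] assms]
    cmp_eq_Hom[OF d_Hom(2) d_Hom(2) presents_bd(3)[OF pres1] assms]
    cmp_eq_Hom[OF d_Hom(3) d_Hom(3) presents_bd(3)[OF pres2] assms]
    cmp_eq_Hom[OF d_Hom(4) d_Hom(4) presents_bd(3)[OF presN] assms]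
  by (simp_all add: arrow_typing obs add_simps)

lemmas mv_simps = Hom_def arrow_typing chain_simps obs sum_simps

lemma a1_cancel: "u \<in> Hom C t (P12 i) \<Longrightarrow> v \<in> Hom C t (P12 i) \<Longrightarrow> a1 i \<cdot> u = a1 i \<cdot> v \<Longrightarrow> u = v"
  using monicD[OF a1_monic a1(1)] by blast

lemma b2_cancel: "u \<in> Hom C t (P2 i) \<Longrightarrow> v \<in> Hom C t (P2 i) \<Longrightarrow> b2 i \<cdot> u = b2 i \<cdot> v \<Longrightarrow> u = v"
  using monicD[OF b2_monic b2(1)] by blast

end

text \<open>Excision on chains: surjectivity and injectivity in homology of \<open>P1 / P12 \<rightarrow> N / P2\<close>, stated without
  the quotients. Both speak about relative cycles, that is, chains whose boundary lies in the
  subcomplex.\<close>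

locale mayer_vietoris_data = chain_square +
  assumes excision_surj: "n \<in> Hom C t (N (Suc i)) \<Longrightarrow> p \<in> Hom C t (P2 i) \<Longrightarrow> dN i \<cdot> n = b2 i \<cdot> p \<Longrightarrow>
      \<exists>t' e p1 p12 p2 n'. cover e t' t \<and> p1 \<in> Hom C t' (P1 (Suc i)) \<and> p12 \<in> Hom C t' (P12 i) \<and>
        p2 \<in> Hom C t' (P2 (Suc i)) \<and> n' \<in> Hom C t' (N (Suc (Suc i))) \<and> d1 i \<cdot> p1 = a1 i \<cdot> p12 \<and>
        n \<cdot> e = b1 (Suc i) \<cdot> p1 \<boxplus> (b2 (Suc i) \<cdot> p2 \<boxplus> dN (Suc i) \<cdot> n')"
    and excision_inj: "p1 \<in> Hom C t (P1 (Suc i)) \<Longrightarrow> p12 \<in> Hom C t (P12 i) \<Longrightarrow>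
      p2 \<in> Hom C t (P2 (Suc i)) \<Longrightarrow> n \<in> Hom C t (N (Suc (Suc i))) \<Longrightarrow> d1 i \<cdot> p1 = a1 i \<cdot> p12 \<Longrightarrow>
      b1 (Suc i) \<cdot> p1 = b2 (Suc i) \<cdot> p2 \<boxplus> dN (Suc i) \<cdot> n \<Longrightarrow>
      \<exists>t' e q12 q1. cover e t' t \<and> q12 \<in> Hom C t' (P12 (Suc i)) \<and> q1 \<in> Hom C t' (P1 (Suc (Suc i))) \<and>
        p1 \<cdot> e = a1 (Suc i) \<cdot> q12 \<boxplus> d1 (Suc i) \<cdot> q1"
begin

text \<open>The graph of the connecting arrow: \<open>x\<close> is the class of \<open>b1 p1 - b2 p2\<close> and \<open>y\<close> the class of the
  common boundary \<open>p12\<close> of \<open>p1\<close> and \<open>p2\<close>.\<close>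

definition connects where
  "connects i t x y \<longleftrightarrow> (\<exists>p1 p2 p12. p1 \<in> Hom C t (P1 (Suc (Suc i))) \<and> p2 \<in> Hom C t (P2 (Suc (Suc i))) \<and>
     d1 (Suc i) \<cdot> p1 = a1 (Suc i) \<cdot> p12 \<and> d2 (Suc i) \<cdot> p2 = a2 (Suc i) \<cdot> p12 \<and>
     repN (Suc i) t (b1 (Suc (Suc i)) \<cdot> p1 \<boxminus> b2 (Suc (Suc i)) \<cdot> p2) x \<and> rep12 i t p12 y)"

text \<open>The relation \<open>connects\<close> is total up to covers by surjectivity in the excision property, and
  single-valued by injectivity, so it is the graph of an arrow.\<close>

lemma connecting_arrow:
  obtains d where "d \<in> Hom C (HN (Suc i)) (H12 i)" "\<And>t x y. connects i t x y \<Longrightarrow> y = d \<cdot> x"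
    "\<And>t x. x \<in> Hom C t (HN (Suc i)) \<Longrightarrow> \<exists>t' e y. cover e t' t \<and> connects i t' (x \<cdot> e) y"
proof -
  let ?k = "Suc i" and ?l = "Suc (Suc i)"
  note P = pres12[of i] and PN = presN[of ?k]
  have hom: "x \<in> Hom C t (HN ?k) \<and> y \<in> Hom C t (H12 i)" if "connects i t x y" for t x y
    using that reps_Hom(2)[OF P] reps_Hom(2)[OF PN] by (auto simp: connects_def)
  have stable: "connects i t' (x \<cdot> e) (y \<cdot> e)" if Q: "connects i t x y" and e: "e \<in> Hom C t' t" for t t' x y e
  proof -
    obtain p1 p2 p12 where p: "p1 \<in> Hom C t (P1 ?l)" "p2 \<in> Hom C t (P2 ?l)"
      "d1 ?k \<cdot> p1 = a1 ?k \<cdot> p12" "d2 ?k \<cdot> p2 = a2 ?k \<cdot> p12"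
      and r: "repN ?k t (b1 ?l \<cdot> p1 \<boxminus> b2 ?l \<cdot> p2) x" "rep12 i t p12 y"
      using Q by (auto simp: connects_def)
    have p12: "p12 \<in> Hom C t (P12 ?k)" using reps_Hom[OF P r(2)] by simp
    have "d1 ?k \<cdot> (p1 \<cdot> e) = a1 ?k \<cdot> (p12 \<cdot> e)" "d2 ?k \<cdot> (p2 \<cdot> e) = a2 ?k \<cdot> (p12 \<cdot> e)"
      using cmp_assoc[OF e p(1) d_Hom(2)] cmp_assoc[OF e p(2) d_Hom(3)]
        cmp_assoc[OF e p12 a1(1)] cmp_assoc[OF e p12 a2(1)] p by simp_all
    moreover have "(b1 ?l \<cdot> p1 \<boxminus> b2 ?l \<cdot> p2) \<cdot> e = b1 ?l \<cdot> (p1 \<cdot> e) \<boxminus> b2 ?l \<cdot> (p2 \<cdot> e)"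
      using p(1,2) e by (simp add: mv_simps)
    ultimately show ?thesis using reps_stable[OF PN r(1) e] reps_stable[OF P r(2) e]
        cmp_Hom[OF e p(1)] cmp_Hom[OF e p(2)] unfolding connects_def by metis
  qed
  have diff: "connects i t (x \<boxminus> x') (y \<boxminus> y')" if Q: "connects i t x y" "connects i t x' y'" for t x y x' y'
  proof -
    obtain p1 p2 p12 where p: "p1 \<in> Hom C t (P1 ?l)" "p2 \<in> Hom C t (P2 ?l)"
      "d1 ?k \<cdot> p1 = a1 ?k \<cdot> p12" "d2 ?k \<cdot> p2 = a2 ?k \<cdot> p12"
      and r: "repN ?k t (b1 ?l \<cdot> p1 \<boxminus> b2 ?l \<cdot> p2) x" "rep12 i t p12 y"
      using Q(1) by (auto simp: connects_def)
    obtain q1 q2 q12 where q: "q1 \<in> Hom C t (P1 ?l)" "q2 \<in> Hom C t (P2 ?l)"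
      "d1 ?k \<cdot> q1 = a1 ?k \<cdot> q12" "d2 ?k \<cdot> q2 = a2 ?k \<cdot> q12"
      and s: "repN ?k t (b1 ?l \<cdot> q1 \<boxminus> b2 ?l \<cdot> q2) x'" "rep12 i t q12 y'"
      using Q(2) by (auto simp: connects_def)
    have pq: "p12 \<in> Hom C t (P12 ?k)" "q12 \<in> Hom C t (P12 ?k)"
      using reps_Hom[OF P r(2)] reps_Hom[OF P s(2)] by auto
    have "d1 ?k \<cdot> (p1 \<boxminus> q1) = a1 ?k \<cdot> (p12 \<boxminus> q12)" "d2 ?k \<cdot> (p2 \<boxminus> q2) = a2 ?k \<cdot> (p12 \<boxminus> q12)"
      using cmp_psub_right[OF p(1) q(1) d_Hom(2)] cmp_psub_right[OF p(2) q(2) d_Hom(3)]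
        cmp_psub_right[OF pq a1(1)] cmp_psub_right[OF pq a2(1)] p q by simp_all
    moreover have "(b1 ?l \<cdot> p1 \<boxminus> b2 ?l \<cdot> p2) \<boxminus> (b1 ?l \<cdot> q1 \<boxminus> b2 ?l \<cdot> q2)
        = b1 ?l \<cdot> (p1 \<boxminus> q1) \<boxminus> b2 ?l \<cdot> (p2 \<boxminus> q2)"
      using p(1,2) q(1,2) by (simp add: mv_simps)
    ultimately show ?thesis using reps_diff[OF PN r(1) s(1)] reps_diff[OF P r(2) s(2)]
        psub_Hom[OF p(1) q(1)] psub_Hom[OF p(2) q(2)] unfolding connects_def by metis
  qed
  have single: "y = zro t (H12 i)" if Q: "connects i t (zro t (HN ?k)) y" for t y
  proof -
    obtain p1 p2 p12 where p: "p1 \<in> Hom C t (P1 ?l)" "p2 \<in> Hom C t (P2 ?l)"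
      "d1 ?k \<cdot> p1 = a1 ?k \<cdot> p12" "d2 ?k \<cdot> p2 = a2 ?k \<cdot> p12"
      and r: "repN ?k t (b1 ?l \<cdot> p1 \<boxminus> b2 ?l \<cdot> p2) (zro t (HN ?k))" "rep12 i t p12 y"
      using Q by (auto simp: connects_def)
    have p12: "p12 \<in> Hom C t (P12 ?k)" using reps_Hom[OF P r(2)] by simp
    obtain t' e n where n: "cover e t' t" "n \<in> Hom C t' (N (Suc ?l))"
        "dN ?l \<cdot> n = (b1 ?l \<cdot> p1 \<boxminus> b2 ?l \<cdot> p2) \<cdot> e"
      using reps_zro_boundary[OF PN r(1)] .
    have e: "e \<in> Hom C t' t" using n cover_Hom by blast
    have pe: "p1 \<cdot> e \<in> Hom C t' (P1 ?l)" "p12 \<cdot> e \<in> Hom C t' (P12 ?k)" "p2 \<cdot> e \<in> Hom C t' (P2 ?l)"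
      using cmp_Hom e p p12 by blast+
    have de: "d1 ?k \<cdot> (p1 \<cdot> e) = a1 ?k \<cdot> (p12 \<cdot> e)"
      using cmp_assoc[OF e p(1) d_Hom(2)] cmp_assoc[OF e p12 a1(1)] p by simp
    have "b1 ?l \<cdot> (p1 \<cdot> e) = b2 ?l \<cdot> (p2 \<cdot> e) \<boxplus> dN ?l \<cdot> n"
      unfolding n(3) using p(1,2) e by (simp add: mv_simps)
    then obtain t'' e' q12 q1 where q: "cover e' t'' t'" "q12 \<in> Hom C t'' (P12 ?l)" "q1 \<in> Hom C t'' (P1 (Suc ?l))"
        "(p1 \<cdot> e) \<cdot> e' = a1 ?l \<cdot> q12 \<boxplus> d1 ?l \<cdot> q1"
      using excision_inj[OF pe n(2) de] by blast
    have e': "e' \<in> Hom C t'' t'" using q cover_Hom by blast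
    have "a1 ?k \<cdot> (d12 ?k \<cdot> q12) = d1 ?k \<cdot> ((p1 \<cdot> e) \<cdot> e')"
      unfolding q(4) using q(2,3) by (simp add: mv_simps)
    also have "\<dots> = a1 ?k \<cdot> ((p12 \<cdot> e) \<cdot> e')"
      using cmp_assoc[OF e' pe(1) d_Hom(2)] cmp_assoc[OF e' pe(2) a1(1)] de by simp
    finally have "d12 ?k \<cdot> q12 = p12 \<cdot> (e \<cdot> e')"
      using a1_cancel[OF cmp_Hom[OF q(2) d_Hom(1)] cmp_Hom[OF e' pe(2)]] cmp_assoc[OF e' e p12] by simp
    then show ?thesis using reps_zroI[OF P r(2) cover_cmp[OF n(1) q(1)] q(2)] by simp
  qed
  have total: "\<exists>t' e y. cover e t' t \<and> connects i t' (x \<cdot> e) y" if x: "x \<in> Hom C t (HN ?k)" for t x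
  proof -
    obtain t1 e1 n where n: "cover e1 t1 t" "repN ?k t1 n (x \<cdot> e1)" using reps_lift[OF PN x] .
    have nH: "n \<in> Hom C t1 (N ?l)" "dN ?k \<cdot> n = zro t1 (N ?k)" using reps_Hom[OF PN n(2)] by auto
    have t1: "t1 \<in> ob C" using Hom_ob nH by blast
    have "dN ?k \<cdot> n = b2 ?k \<cdot> zro t1 (P2 ?k)" using nH cmp_zro(1)[OF b2(1) t1] by simp
    then obtain t2 e2 p1 p12 p2 n' where s: "cover e2 t2 t1" "p1 \<in> Hom C t2 (P1 ?l)" "p12 \<in> Hom C t2 (P12 ?k)"
        "p2 \<in> Hom C t2 (P2 ?l)" "n' \<in> Hom C t2 (N (Suc ?l))" "d1 ?k \<cdot> p1 = a1 ?k \<cdot> p12"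
        "n \<cdot> e2 = b1 ?l \<cdot> p1 \<boxplus> (b2 ?l \<cdot> p2 \<boxplus> dN ?l \<cdot> n')"
      using excision_surj[OF nH(1) zro_Hom[OF t1 obs(3)]] by blast
    have e2: "e2 \<in> Hom C t2 t1" using s cover_Hom by blast
    have t2: "t2 \<in> ob C" using Hom_ob e2 by blast
    \<comment> \<open>The boundary of \<open>n\<close> vanishes, so the boundaries of \<open>p1\<close> and \<open>p2\<close> cancel in \<open>N\<close>; as \<open>b2\<close> is
      monic, they already cancel in \<open>P2\<close>.\<close>
    have "zro t2 (N ?k) = dN ?k \<cdot> (n \<cdot> e2)"
      using cmp_assoc[OF e2 nH(1) d_Hom(4)] nH(2) cmp_zro(2)[OF e2 obs(4)] by simp
    also have "\<dots> = b1 ?k \<cdot> (d1 ?k \<cdot> p1) \<boxplus> b2 ?k \<cdot> (d2 ?k \<cdot> p2)"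
      unfolding s(7) using s(2-5) by (simp add: mv_simps)
    also have "\<dots> = b2 ?k \<cdot> (a2 ?k \<cdot> p12 \<boxplus> d2 ?k \<cdot> p2)"
      unfolding s(6) using s(2-5) by (simp add: mv_simps)
    finally have "a2 ?k \<cdot> p12 \<boxplus> d2 ?k \<cdot> p2 = zro t2 (P2 ?k)"
      using b2_cancel[of "a2 ?k \<cdot> p12 \<boxplus> d2 ?k \<cdot> p2" t2 ?k "zro t2 (P2 ?k)"] cmp_zro(1)[OF b2(1) t2]
        padd_Hom[OF cmp_Hom[OF s(3) a2(1)] cmp_Hom[OF s(4) d_Hom(3)]] zro_Hom[OF t2 obs(3)] by simp
    \<comment> \<open>The sign of \<open>p2\<close> changes because the classes are represented by differences \<open>b1 p1 - b2 p2\<close>.\<close>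
    then have d2: "d2 ?k \<cdot> (zro t2 (P2 ?l) \<boxminus> p2) = a2 ?k \<cdot> p12"
      using s(2-5) t2 by (simp add: mv_simps)
    have nd: "n \<cdot> e2 \<boxminus> dN ?l \<cdot> n' = b1 ?l \<cdot> p1 \<boxminus> b2 ?l \<cdot> (zro t2 (P2 ?l) \<boxminus> p2)"
      unfolding s(7) using s(2-5) t2 by (simp add: mv_simps)
    have "a1 i \<cdot> (d12 i \<cdot> p12) = d1 i \<cdot> (d1 ?k \<cdot> p1)" unfolding s(6) using s(2-5) by (simp add: mv_simps)
    also have "\<dots> = a1 i \<cdot> zro t2 (P12 i)" using s(2-5) t2 by (simp add: mv_simps)
    finally have "d12 i \<cdot> p12 = zro t2 (P12 i)"
      using a1_cancel[OF cmp_Hom[OF s(3) d_Hom(1)] zro_Hom[OF t2 obs(1)]] by blast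
    then obtain y where y: "rep12 i t2 p12 y" using reps_cycle[OF P s(3)] by blast
    have "repN ?k t2 (n \<cdot> e2 \<boxminus> dN ?l \<cdot> n') (x \<cdot> (e1 \<cdot> e2))"
      using reps_mod_boundary[OF PN reps_stable[OF PN n(2) e2] s(5)]
        cmp_assoc[OF e2 cover_Hom[OF n(1)] x] by simp
    then have "connects i t2 (x \<cdot> (e1 \<cdot> e2)) y"
      using nd d2 y s(2,6) psub_Hom[OF zro_Hom[OF t2 obs(3)] s(4)] unfolding connects_def by metis
    then show ?thesis using cover_cmp[OF n(1) s(1)] by blast
  qed
  obtain d where "d \<in> Hom C (HN ?k) (H12 i)" "\<And>t x y. connects i t x y \<Longrightarrow> y = d \<cdot> x"
    by (rule functional_relation[of "HN ?k" "H12 i" "connects i"], rule obs, rule obs, erule hom,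
        erule (1) stable, erule (1) diff, erule single, erule total) blast
  then show ?thesis using that total by blast
qed

end

text \<open>The three families of arrows of the sequence, given by their effect on representatives of
  homology classes.\<close>

locale mayer_vietoris_arrows = mayer_vietoris_data +
  fixes S \<iota>1 \<iota>2 \<pi>1 \<pi>2 \<delta> \<alpha> \<beta>
  assumes bip: "is_biproduct C (H1 i) (H2 i) (S i) (\<iota>1 i) (\<iota>2 i) (\<pi>1 i) (\<pi>2 i)"
    and \<delta>: "\<delta> i \<in> Hom C (HN (Suc i)) (H12 i)" "connects i t x y \<Longrightarrow> y = \<delta> i \<cdot> x"
      "x \<in> Hom C t (HN (Suc i)) \<Longrightarrow> \<exists>t' e y. cover e t' t \<and> connects i t' (x \<cdot> e) y"
    and \<alpha>: "\<alpha> i \<in> Hom C (H12 i) (S i)"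
      "rep12 i t c y \<Longrightarrow> rep1 i t (a1 (Suc i) \<cdot> c) (\<pi>1 i \<cdot> (\<alpha> i \<cdot> y))"
      "rep12 i t c y \<Longrightarrow> rep2 i t (a2 (Suc i) \<cdot> c) (\<pi>2 i \<cdot> (\<alpha> i \<cdot> y))"
    and \<beta>: "\<beta> i \<in> Hom C (S i) (HN i)"
      "s \<in> Hom C t (S i) \<Longrightarrow> rep1 i t c (\<pi>1 i \<cdot> s) \<Longrightarrow> rep2 i t c' (\<pi>2 i \<cdot> s) \<Longrightarrow>
        repN i t (b1 (Suc i) \<cdot> c \<boxminus> b2 (Suc i) \<cdot> c') (\<beta> i \<cdot> s)"
begin

lemma projection_Hom: "\<pi>1 i \<in> Hom C (S i) (H1 i)" "\<pi>2 i \<in> Hom C (S i) (H2 i)" "S i \<in> ob C"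
  using bip[of i] by (auto simp: is_biproduct_def)

lemma lift_sum:
  assumes s: "s \<in> Hom C t (S i)"
  shows "\<exists>t' e c c'. cover e t' t \<and> rep1 i t' c (\<pi>1 i \<cdot> (s \<cdot> e)) \<and> rep2 i t' c' (\<pi>2 i \<cdot> (s \<cdot> e))"
proof -
  obtain t1 e1 c where 1: "cover e1 t1 t" "rep1 i t1 c ((\<pi>1 i \<cdot> s) \<cdot> e1)"
    using reps_lift[OF pres1 cmp_Hom[OF s projection_Hom(1)]] .
  note e1 = cover_Hom[OF 1(1)]
  have se: "s \<cdot> e1 \<in> Hom C t1 (S i)" using cmp_Hom e1 s by blast
  obtain t2 e2 c' where 2: "cover e2 t2 t1" "rep2 i t2 c' ((\<pi>2 i \<cdot> (s \<cdot> e1)) \<cdot> e2)"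
    using reps_lift[OF pres2 cmp_Hom[OF se projection_Hom(2)]] .
  note e2 = cover_Hom[OF 2(1)]
  have "rep1 i t2 (c \<cdot> e2) (\<pi>1 i \<cdot> (s \<cdot> (e1 \<cdot> e2)))" "rep2 i t2 c' (\<pi>2 i \<cdot> (s \<cdot> (e1 \<cdot> e2)))"
    using reps_stable[OF pres1 1(2) e2] 2(2) cmp_assoc[OF e2 se projection_Hom(2)] cmp_assoc[OF e2 e1 s]
      cmp_assoc[OF e1 s projection_Hom(1)] cmp_assoc[OF e2 se projection_Hom(1)] by simp_all
  then show ?thesis using cover_cmp[OF 1(1) 2(1)] by blast
qed

text \<open>For cycles \<open>c1\<close>, \<open>c2\<close> with \<open>b1 c1 - b2 c2\<close> a boundary, injectivity gives a chain \<open>q12\<close> of \<open>P12\<close> with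
  \<open>a1 q12\<close> homologous to \<open>c1\<close>. Then \<open>a2 q12 - c2\<close> bounds in \<open>N\<close>, but possibly not in \<open>P2\<close>; surjectivity
  provides the correction \<open>r12\<close>, and \<open>q12 - r12\<close> has the classes of \<open>c1\<close> and \<open>c2\<close> as images.\<close>

lemma exact_at_sum: "exact_at C (\<alpha> i) (\<beta> i)"
proof (rule exact_atI[OF \<alpha>(1) \<beta>(1)])
  let ?k = "Suc i"
  have id: "idt C (H12 i) \<in> Hom C (H12 i) (H12 i)" using idt_Hom obs by blast
  obtain t e c where c: "cover e t (H12 i)" "rep12 i t c (idt C (H12 i) \<cdot> e)"
    using reps_lift[OF pres12 id] .
  note e = cover_Hom[OF c(1)]
  have r: "rep12 i t c e" using c(2) idt_left[OF e] by simp
  have "repN i t (b1 ?k \<cdot> (a1 ?k \<cdot> c) \<boxminus> b2 ?k \<cdot> (a2 ?k \<cdot> c)) (\<beta> i \<cdot> (\<alpha> i \<cdot> e))"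
    using \<beta>(2)[OF cmp_Hom[OF e \<alpha>(1)] \<alpha>(2,3)[OF r]] .
  moreover have "b1 ?k \<cdot> (a1 ?k \<cdot> c) \<boxminus> b2 ?k \<cdot> (a2 ?k \<cdot> c) = dN ?k \<cdot> zro t (N (Suc ?k))"
    using reps_Hom(1)[OF pres12 r] Hom_ob[OF e] by (simp add: mv_simps)
  ultimately have "\<beta> i \<cdot> (\<alpha> i \<cdot> e) = zro t (HN i)"
    using reps_unique[OF presN] reps_boundary[OF presN zro_Hom[OF Hom_ob(1)[OF e] obs(4)]] by metis
  then show "\<beta> i \<cdot> \<alpha> i = zro (H12 i) (HN i)"
    using cover_zro[OF c(1) cmp_Hom[OF \<alpha>(1) \<beta>(1)]] cmp_assoc[OF e \<alpha>(1) \<beta>(1)] by simp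
next
  let ?k = "Suc i" and ?l = "Suc (Suc i)"
  fix t s assume s: "s \<in> Hom C t (S i)" "\<beta> i \<cdot> s = zro t (HN i)"
  obtain t1 e1 c1 c2 where c: "cover e1 t1 t" "rep1 i t1 c1 (\<pi>1 i \<cdot> (s \<cdot> e1))" "rep2 i t1 c2 (\<pi>2 i \<cdot> (s \<cdot> e1))"
    using lift_sum[OF s(1)] by blast
  note e1 = cover_Hom[OF c(1)]
  have se: "s \<cdot> e1 \<in> Hom C t1 (S i)" using cmp_Hom e1 s by blast
  have "\<beta> i \<cdot> (s \<cdot> e1) = zro t1 (HN i)"
    using cmp_assoc[OF e1 s(1) \<beta>(1)] s(2) cmp_zro(2)[OF e1 obs(8)] by simp
  then have rN: "repN i t1 (b1 ?k \<cdot> c1 \<boxminus> b2 ?k \<cdot> c2) (zro t1 (HN i))"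
    using \<beta>(2)[OF se c(2,3)] by simp
  obtain t2 e2 n where n: "cover e2 t2 t1" "n \<in> Hom C t2 (N ?l)"
      "dN ?k \<cdot> n = (b1 ?k \<cdot> c1 \<boxminus> b2 ?k \<cdot> c2) \<cdot> e2"
    using reps_zro_boundary[OF presN rN] .
  note e2 = cover_Hom[OF n(1)]
  have t2: "t2 \<in> ob C" using Hom_ob e2 by blast
  define x1 where "x1 = c1 \<cdot> e2"
  define x2 where "x2 = c2 \<cdot> e2"
  define s2 where "s2 = s \<cdot> (e1 \<cdot> e2)"
  have cH: "c1 \<in> Hom C t1 (P1 ?k)" "c2 \<in> Hom C t1 (P2 ?k)"
    using reps_Hom[OF pres1 c(2)] reps_Hom[OF pres2 c(3)] by auto
  have rx: "rep1 i t2 x1 (\<pi>1 i \<cdot> s2)" "rep2 i t2 x2 (\<pi>2 i \<cdot> s2)"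
    using reps_stable[OF pres1 c(2) e2] reps_stable[OF pres2 c(3) e2] cmp_assoc[OF e2 se projection_Hom(1)]
      cmp_assoc[OF e2 se projection_Hom(2)] cmp_assoc[OF e2 e1 s(1)] by (simp_all add: x1_def x2_def s2_def)
  have xH: "x1 \<in> Hom C t2 (P1 ?k)" "x2 \<in> Hom C t2 (P2 ?k)" "d1 i \<cdot> x1 = zro t2 (P1 i)" "d2 i \<cdot> x2 = zro t2 (P2 i)"
    using reps_Hom[OF pres1 rx(1)] reps_Hom[OF pres2 rx(2)] by auto
  have nx: "b1 ?k \<cdot> x1 = b2 ?k \<cdot> x2 \<boxplus> dN ?k \<cdot> n"
    unfolding n(3) x1_def x2_def using cH e2 by (simp add: mv_simps)
  have dx: "d1 i \<cdot> x1 = a1 i \<cdot> zro t2 (P12 i)" using xH(3) cmp_zro(1)[OF a1(1) t2] by simp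
  obtain t3 e3 q12 q1 where q: "cover e3 t3 t2" "q12 \<in> Hom C t3 (P12 ?k)" "q1 \<in> Hom C t3 (P1 ?l)"
      "x1 \<cdot> e3 = a1 ?k \<cdot> q12 \<boxplus> d1 ?k \<cdot> q1"
    using excision_inj[OF xH(1) zro_Hom[OF t2 obs(1)] xH(2) n(2) dx nx] by blast
  note e3 = cover_Hom[OF q(1)]
  have ne: "n \<cdot> e3 \<in> Hom C t3 (N ?l)" "x2 \<cdot> e3 \<in> Hom C t3 (P2 ?k)"
    using cmp_Hom n(2) xH e3 by blast+
  define m where "m = n \<cdot> e3 \<boxminus> b1 ?l \<cdot> q1"
  have mH: "m \<in> Hom C t3 (N ?l)" using psub_Hom[OF ne(1) cmp_Hom[OF q(3) b1(1)]] m_def by simp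
  have "(b1 ?k \<cdot> x1) \<cdot> e3 = (b2 ?k \<cdot> x2 \<boxplus> dN ?k \<cdot> n) \<cdot> e3" using nx by simp
  then have "b1 ?k \<cdot> (x1 \<cdot> e3) = b2 ?k \<cdot> (x2 \<cdot> e3) \<boxplus> dN ?k \<cdot> (n \<cdot> e3)"
    using xH(1,2) n(2) e3 by (simp add: mv_simps)
  then have "b2 ?k \<cdot> (a2 ?k \<cdot> q12) \<boxplus> b1 ?k \<cdot> (d1 ?k \<cdot> q1) = b2 ?k \<cdot> (x2 \<cdot> e3) \<boxplus> dN ?k \<cdot> (n \<cdot> e3)"
    unfolding q(4) using q(2,3) by (simp add: mv_simps)
  then have dm: "dN ?k \<cdot> m = b2 ?k \<cdot> (a2 ?k \<cdot> q12 \<boxminus> x2 \<cdot> e3)"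
    unfolding m_def using q(2,3) ne by (simp add: mv_simps)
  have pH: "a2 ?k \<cdot> q12 \<boxminus> x2 \<cdot> e3 \<in> Hom C t3 (P2 ?k)"
    using psub_Hom[OF cmp_Hom[OF q(2) a2(1)] ne(2)] .
  obtain t4 e4 r1 r12 r2 n' where r: "cover e4 t4 t3" "r1 \<in> Hom C t4 (P1 ?l)" "r12 \<in> Hom C t4 (P12 ?k)"
      "r2 \<in> Hom C t4 (P2 ?l)" "n' \<in> Hom C t4 (N (Suc ?l))" "d1 ?k \<cdot> r1 = a1 ?k \<cdot> r12"
      "m \<cdot> e4 = b1 ?l \<cdot> r1 \<boxplus> (b2 ?l \<cdot> r2 \<boxplus> dN ?l \<cdot> n')"
    using excision_surj[OF mH pH dm] by blast
  note e4 = cover_Hom[OF r(1)]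
  have t4: "t4 \<in> ob C" using Hom_ob e4 by blast
  have "b2 ?k \<cdot> ((a2 ?k \<cdot> q12 \<boxminus> x2 \<cdot> e3) \<cdot> e4) = dN ?k \<cdot> (m \<cdot> e4)"
    using cmp_assoc[OF e4 mH d_Hom(4)] cmp_assoc[OF e4 pH b2(1)] dm by simp
  also have "\<dots> = b1 ?k \<cdot> (d1 ?k \<cdot> r1) \<boxplus> b2 ?k \<cdot> (d2 ?k \<cdot> r2)"
    unfolding r(7) using r(2-5) by (simp add: mv_simps)
  also have "\<dots> = b2 ?k \<cdot> (a2 ?k \<cdot> r12 \<boxplus> d2 ?k \<cdot> r2)"
    unfolding r(6) using r(2-5) by (simp add: mv_simps)
  finally have pe: "(a2 ?k \<cdot> q12 \<boxminus> x2 \<cdot> e3) \<cdot> e4 = a2 ?k \<cdot> r12 \<boxplus> d2 ?k \<cdot> r2"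
    using b2_cancel[OF cmp_Hom[OF e4 pH] padd_Hom[OF cmp_Hom[OF r(3) a2(1)] cmp_Hom[OF r(4) d_Hom(3)]]]
    by blast
  define c where "c = q12 \<cdot> e4 \<boxminus> r12"
  have cc: "c \<in> Hom C t4 (P12 ?k)" using psub_Hom[OF cmp_Hom[OF e4 q(2)] r(3)] c_def by simp
  have a2c: "a2 ?k \<cdot> c = x2 \<cdot> (e3 \<cdot> e4) \<boxplus> d2 ?k \<cdot> r2"
    using pe q(2) r(3,4) xH(2) e3 e4 unfolding c_def by (simp add: mv_simps)
  have "(x1 \<cdot> e3) \<cdot> e4 = (a1 ?k \<cdot> q12 \<boxplus> d1 ?k \<cdot> q1) \<cdot> e4" using q(4) by simp
  then have "x1 \<cdot> (e3 \<cdot> e4) = a1 ?k \<cdot> (q12 \<cdot> e4) \<boxplus> d1 ?k \<cdot> (q1 \<cdot> e4)"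
    using q(2,3) xH(1) e3 e4 by (simp add: mv_simps)
  then have a1c: "a1 ?k \<cdot> c = x1 \<cdot> (e3 \<cdot> e4) \<boxminus> d1 ?k \<cdot> (q1 \<cdot> e4 \<boxplus> r1)"
    using q(2,3) r(2,3,6) xH(1) e3 e4 unfolding c_def by (simp add: mv_simps)
  define s4 where "s4 = s2 \<cdot> (e3 \<cdot> e4)"
  have s2: "s2 \<in> Hom C t2 (S i)" unfolding s2_def using cmp_Hom e2 e1 s by blast
  have e34: "e3 \<cdot> e4 \<in> Hom C t4 t2" using cmp_Hom e4 e3 by blast
  have s4: "s4 \<in> Hom C t4 (S i)" unfolding s4_def using cmp_Hom e34 s2 by blast
  have rx4: "rep1 i t4 (x1 \<cdot> (e3 \<cdot> e4)) (\<pi>1 i \<cdot> s4)" "rep2 i t4 (x2 \<cdot> (e3 \<cdot> e4)) (\<pi>2 i \<cdot> s4)"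
    using reps_stable[OF pres1 rx(1) e34] reps_stable[OF pres2 rx(2) e34]
      cmp_assoc[OF e34 s2 projection_Hom(1)] cmp_assoc[OF e34 s2 projection_Hom(2)] by (simp_all add: s4_def)
  have R1: "rep1 i t4 (a1 ?k \<cdot> c) (\<pi>1 i \<cdot> s4)"
    unfolding a1c by (rule reps_mod_boundary[OF pres1 rx4(1)]) (rule padd_Hom[OF cmp_Hom[OF e4 q(3)] r(2)])
  have "rep2 i t4 (x2 \<cdot> (e3 \<cdot> e4) \<boxminus> d2 ?k \<cdot> (zro t4 (P2 ?l) \<boxminus> r2)) (\<pi>2 i \<cdot> s4)"
    by (rule reps_mod_boundary[OF pres2 rx4(2)]) (rule psub_Hom[OF zro_Hom[OF t4 obs(3)] r(4)])
  moreover have "x2 \<cdot> (e3 \<cdot> e4) \<boxminus> d2 ?k \<cdot> (zro t4 (P2 ?l) \<boxminus> r2) = a2 ?k \<cdot> c"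
    unfolding a2c using r(4) t4 xH(2) e3 e4 by (simp add: mv_simps)
  ultimately have R2: "rep2 i t4 (a2 ?k \<cdot> c) (\<pi>2 i \<cdot> s4)" by simp
  have "a1 i \<cdot> (d12 i \<cdot> c) = d1 i \<cdot> (a1 ?k \<cdot> c)" using cc by (simp add: mv_simps)
  also have "\<dots> = a1 i \<cdot> zro t4 (P12 i)" using reps_Hom(3)[OF pres1 R1] cmp_zro(1)[OF a1(1) t4] by simp
  finally have "d12 i \<cdot> c = zro t4 (P12 i)"
    using a1_cancel[OF cmp_Hom[OF cc d_Hom(1)] zro_Hom[OF t4 obs(1)]] by blast
  then obtain y where y: "rep12 i t4 c y" using reps_cycle[OF pres12 cc] by blast
  have yH: "y \<in> Hom C t4 (H12 i)" using reps_Hom[OF pres12 y] by simp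
  have "\<pi>1 i \<cdot> (\<alpha> i \<cdot> y) = \<pi>1 i \<cdot> s4" using reps_unique[OF pres1 \<alpha>(2)[OF y] R1] .
  moreover have "\<pi>2 i \<cdot> (\<alpha> i \<cdot> y) = \<pi>2 i \<cdot> s4" using reps_unique[OF pres2 \<alpha>(3)[OF y] R2] .
  ultimately have "\<alpha> i \<cdot> y = s4" using biproduct_eqI[OF bip cmp_Hom[OF yH \<alpha>(1)] s4] by blast
  also have "s4 = s \<cdot> ((e1 \<cdot> e2) \<cdot> (e3 \<cdot> e4))"
    unfolding s4_def s2_def using s(1) e1 e2 e3 e4 by (simp add: Hom_def cat_simps)
  finally show "\<exists>t' e u. cover e t' t \<and> u \<in> Hom C t' (H12 i) \<and> \<alpha> i \<cdot> u = s \<cdot> e"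
    using yH cover_cmp[OF cover_cmp[OF c(1) n(1)] cover_cmp[OF q(1) r(1)]] by blast
qed

text \<open>If \<open>a1 c = \<partial>p1\<close> and \<open>a2 c = \<partial>p2\<close>, then \<open>b1 p1 - b2 p2\<close> is a cycle whose class is mapped to that of \<open>c\<close>.\<close>

lemma exact_at_intersection: "exact_at C (\<delta> i) (\<alpha> i)"
proof (rule exact_atI[OF \<delta>(1) \<alpha>(1)])
  let ?k = "Suc i" and ?l = "Suc (Suc i)"
  have id: "idt C (HN ?k) \<in> Hom C (HN ?k) (HN ?k)" using idt_Hom obs by blast
  obtain t e y where Q: "cover e t (HN ?k)" "connects i t (idt C (HN ?k) \<cdot> e) y"
    using \<delta>(3)[OF id] by blast
  note e = cover_Hom[OF Q(1)]
  have y: "y = \<delta> i \<cdot> e" using \<delta>(2)[OF Q(2)] idt_left[OF e] by simp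
  obtain p1 p2 p12 where p: "p1 \<in> Hom C t (P1 ?l)" "p2 \<in> Hom C t (P2 ?l)"
    "d1 ?k \<cdot> p1 = a1 ?k \<cdot> p12" "d2 ?k \<cdot> p2 = a2 ?k \<cdot> p12" "rep12 i t p12 y"
    using Q(2) by (auto simp: connects_def)
  have "\<pi>1 i \<cdot> (\<alpha> i \<cdot> y) = zro t (H1 i)"
    using reps_unique[OF pres1 \<alpha>(2)[OF p(5)]] reps_boundary[OF pres1 p(1)] p(3) by simp
  moreover have "\<pi>2 i \<cdot> (\<alpha> i \<cdot> y) = zro t (H2 i)"
    using reps_unique[OF pres2 \<alpha>(3)[OF p(5)]] reps_boundary[OF pres2 p(2)] p(4) by simp
  moreover have "\<alpha> i \<cdot> y \<in> Hom C t (S i)" unfolding y using cmp_Hom e \<delta>(1) \<alpha>(1) by blast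
  ultimately have "\<alpha> i \<cdot> y = zro t (S i)" using biproduct_zro[OF bip] by blast
  then show "\<alpha> i \<cdot> \<delta> i = zro (HN ?k) (S i)"
    using cover_zro[OF Q(1) cmp_Hom[OF \<delta>(1) \<alpha>(1)]] cmp_assoc[OF e \<delta>(1) \<alpha>(1)] y by simp
next
  let ?k = "Suc i" and ?l = "Suc (Suc i)"
  fix t y assume y: "y \<in> Hom C t (H12 i)" "\<alpha> i \<cdot> y = zro t (S i)"
  obtain t1 e1 c where c: "cover e1 t1 t" "rep12 i t1 c (y \<cdot> e1)" using reps_lift[OF pres12 y(1)] .
  note e1 = cover_Hom[OF c(1)]
  have t1: "t1 \<in> ob C" using Hom_ob e1 by blast
  have cH: "c \<in> Hom C t1 (P12 ?k)" using reps_Hom[OF pres12 c(2)] by simp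
  have "\<alpha> i \<cdot> (y \<cdot> e1) = zro t1 (S i)"
    using cmp_assoc[OF e1 y(1) \<alpha>(1)] y(2) cmp_zro(2)[OF e1 projection_Hom(3)] by simp
  then have r1: "rep1 i t1 (a1 ?k \<cdot> c) (zro t1 (H1 i))" and r2: "rep2 i t1 (a2 ?k \<cdot> c) (zro t1 (H2 i))"
    using \<alpha>(2,3)[OF c(2)] cmp_zro(1)[OF projection_Hom(1) t1] cmp_zro(1)[OF projection_Hom(2) t1] by simp_all
  obtain t2 e2 p1 where p1: "cover e2 t2 t1" "p1 \<in> Hom C t2 (P1 ?l)" "d1 ?k \<cdot> p1 = (a1 ?k \<cdot> c) \<cdot> e2"
    using reps_zro_boundary[OF pres1 r1] .
  note e2 = cover_Hom[OF p1(1)]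
  obtain t3 e3 p2 where p2: "cover e3 t3 t2" "p2 \<in> Hom C t3 (P2 ?l)" "d2 ?k \<cdot> p2 = ((a2 ?k \<cdot> c) \<cdot> e2) \<cdot> e3"
    using reps_zro_boundary[OF pres2, of i t2 "(a2 ?k \<cdot> c) \<cdot> e2"] reps_stable[OF pres2 r2 e2]
      cmp_zro(2)[OF e2 obs(7)] by metis
  note e3 = cover_Hom[OF p2(1)]
  define b where "b = c \<cdot> (e2 \<cdot> e3)"
  have e23: "e2 \<cdot> e3 \<in> Hom C t3 t1" using cmp_Hom e2 e3 by blast
  have rb: "rep12 i t3 b (y \<cdot> (e1 \<cdot> (e2 \<cdot> e3)))"
    using reps_stable[OF pres12 c(2) e23] cmp_assoc[OF e23 e1 y(1)] by (simp add: b_def)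
  have q1: "p1 \<cdot> e3 \<in> Hom C t3 (P1 ?l)" using cmp_Hom e3 p1 by blast
  have "d1 ?k \<cdot> (p1 \<cdot> e3) = ((a1 ?k \<cdot> c) \<cdot> e2) \<cdot> e3" using cmp_assoc[OF e3 p1(2) d_Hom(2)] p1(3) by simp
  then have d1b: "d1 ?k \<cdot> (p1 \<cdot> e3) = a1 ?k \<cdot> b" unfolding b_def using cH e2 e3 by (simp add: mv_simps)
  have d2b: "d2 ?k \<cdot> p2 = a2 ?k \<cdot> b" unfolding p2(3) b_def using cH e2 e3 by (simp add: mv_simps)
  have bb: "b \<in> Hom C t3 (P12 ?k)" using reps_Hom[OF pres12 rb] by simp
  define n where "n = b1 ?l \<cdot> (p1 \<cdot> e3) \<boxminus> b2 ?l \<cdot> p2"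
  have nH: "n \<in> Hom C t3 (N ?l)"
    unfolding n_def using psub_Hom[OF cmp_Hom[OF q1 b1(1)] cmp_Hom[OF p2(2) b2(1)]] .
  have "dN ?k \<cdot> n = b1 ?k \<cdot> (d1 ?k \<cdot> (p1 \<cdot> e3)) \<boxminus> b2 ?k \<cdot> (d2 ?k \<cdot> p2)"
    unfolding n_def using q1 p2(2) by (simp add: mv_simps)
  also have "\<dots> = zro t3 (N ?k)" unfolding d1b d2b using bb by (simp add: mv_simps)
  finally obtain x where x: "repN ?k t3 n x" using reps_cycle[OF presN nH] by blast
  have "connects i t3 x (y \<cdot> (e1 \<cdot> (e2 \<cdot> e3)))"
    unfolding connects_def using q1 p2(2) d1b d2b x rb n_def by blast
  then have "\<delta> i \<cdot> x = y \<cdot> (e1 \<cdot> (e2 \<cdot> e3))" using \<delta>(2) by simp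
  then show "\<exists>t' e u. cover e t' t \<and> u \<in> Hom C t' (HN ?k) \<and> \<delta> i \<cdot> u = y \<cdot> e"
    using cover_cmp[OF c(1) cover_cmp[OF p1(1) p2(1)]] reps_Hom(2)[OF presN x] by blast
qed

text \<open>If \<open>b1 p1 - b2 p2\<close> has the common boundary \<open>p12 = \<partial>q\<close>, then \<open>p1 - a1 q\<close> and \<open>p2 - a2 q\<close> are cycles
  with the same difference in \<open>N\<close>.\<close>

lemma exact_at_total: "exact_at C (\<beta> (Suc i)) (\<delta> i)"
proof (rule exact_atI[OF \<beta>(1) \<delta>(1)])
  let ?k = "Suc i" and ?l = "Suc (Suc i)"
  have id: "idt C (S ?k) \<in> Hom C (S ?k) (S ?k)" using idt_Hom projection_Hom by blast
  obtain t e c1 c2 where c: "cover e t (S ?k)" "rep1 ?k t c1 (\<pi>1 ?k \<cdot> (idt C (S ?k) \<cdot> e))"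
      "rep2 ?k t c2 (\<pi>2 ?k \<cdot> (idt C (S ?k) \<cdot> e))"
    using lift_sum[OF id] by blast
  note e = cover_Hom[OF c(1)]
  have t: "t \<in> ob C" using Hom_ob e by blast
  have r: "rep1 ?k t c1 (\<pi>1 ?k \<cdot> e)" "rep2 ?k t c2 (\<pi>2 ?k \<cdot> e)" using c idt_left[OF e] by simp_all
  have "rep12 i t (d12 ?k \<cdot> zro t (P12 ?l)) (zro t (H12 i))"
    using reps_boundary[OF pres12 zro_Hom[OF t obs(1)]] .
  then have r12: "rep12 i t (zro t (P12 ?k)) (zro t (H12 i))" using cmp_zro(1)[OF d_Hom(1) t] by simp
  have "connects i t (\<beta> ?k \<cdot> e) (zro t (H12 i))"
    unfolding connects_def using \<beta>(2)[OF e r] r12 reps_Hom[OF pres1 r(1)] reps_Hom[OF pres2 r(2)]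
      cmp_zro(1)[OF a1(1) t] cmp_zro(1)[OF a2(1) t] by metis
  then have "\<delta> i \<cdot> (\<beta> ?k \<cdot> e) = zro t (H12 i)" using \<delta>(2) by metis
  then show "\<delta> i \<cdot> \<beta> ?k = zro (S ?k) (H12 i)"
    using cover_zro[OF c(1) cmp_Hom[OF \<beta>(1) \<delta>(1)]] cmp_assoc[OF e \<beta>(1) \<delta>(1)] by simp
next
  let ?k = "Suc i" and ?l = "Suc (Suc i)"
  fix t x assume x: "x \<in> Hom C t (HN ?k)" "\<delta> i \<cdot> x = zro t (H12 i)"
  obtain t1 e1 y where Q: "cover e1 t1 t" "connects i t1 (x \<cdot> e1) y" using \<delta>(3)[OF x(1)] by blast
  note e1 = cover_Hom[OF Q(1)]
  have "y = zro t1 (H12 i)"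
    using \<delta>(2)[OF Q(2)] cmp_assoc[OF e1 x(1) \<delta>(1)] x(2) cmp_zro(2)[OF e1 obs(5)] by simp
  then obtain p1 p2 p12 where p: "p1 \<in> Hom C t1 (P1 ?l)" "p2 \<in> Hom C t1 (P2 ?l)"
    "d1 ?k \<cdot> p1 = a1 ?k \<cdot> p12" "d2 ?k \<cdot> p2 = a2 ?k \<cdot> p12"
    and r: "repN ?k t1 (b1 ?l \<cdot> p1 \<boxminus> b2 ?l \<cdot> p2) (x \<cdot> e1)" "rep12 i t1 p12 (zro t1 (H12 i))"
    using Q(2) by (auto simp: connects_def)
  obtain t2 e2 q where q: "cover e2 t2 t1" "q \<in> Hom C t2 (P12 ?l)" "d12 ?k \<cdot> q = p12 \<cdot> e2"
    using reps_zro_boundary[OF pres12 r(2)] .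
  note e2 = cover_Hom[OF q(1)]
  have p12: "p12 \<in> Hom C t1 (P12 ?k)" using reps_Hom[OF pres12 r(2)] by simp
  define c1 where "c1 = p1 \<cdot> e2 \<boxminus> a1 ?l \<cdot> q"
  define c2 where "c2 = p2 \<cdot> e2 \<boxminus> a2 ?l \<cdot> q"
  have cH: "c1 \<in> Hom C t2 (P1 ?l)" "c2 \<in> Hom C t2 (P2 ?l)"
    unfolding c1_def c2_def
    using psub_Hom cmp_Hom[OF e2 p(1)] cmp_Hom[OF e2 p(2)] cmp_Hom[OF q(2) a1(1)] cmp_Hom[OF q(2) a2(1)]
    by blast+
  have dp: "d1 ?k \<cdot> (p1 \<cdot> e2) = a1 ?k \<cdot> (p12 \<cdot> e2)" "d2 ?k \<cdot> (p2 \<cdot> e2) = a2 ?k \<cdot> (p12 \<cdot> e2)"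
    using cmp_assoc[OF e2 p(1) d_Hom(2)] cmp_assoc[OF e2 p(2) d_Hom(3)]
      cmp_assoc[OF e2 p12 a1(1)] cmp_assoc[OF e2 p12 a2(1)] p by simp_all
  have "d1 ?k \<cdot> c1 = d1 ?k \<cdot> (p1 \<cdot> e2) \<boxminus> a1 ?k \<cdot> (d12 ?k \<cdot> q)"
    unfolding c1_def using p(1) e2 q(2) by (simp add: mv_simps)
  also have "\<dots> = zro t2 (P1 ?k)" unfolding q(3) dp using p12 e2 by (simp add: mv_simps)
  finally obtain x1 where x1: "rep1 ?k t2 c1 x1" using reps_cycle[OF pres1 cH(1)] by blast
  have "d2 ?k \<cdot> c2 = d2 ?k \<cdot> (p2 \<cdot> e2) \<boxminus> a2 ?k \<cdot> (d12 ?k \<cdot> q)"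
    unfolding c2_def using p(2) e2 q(2) by (simp add: mv_simps)
  also have "\<dots> = zro t2 (P2 ?k)" unfolding q(3) dp using p12 e2 by (simp add: mv_simps)
  finally obtain x2 where x2: "rep2 ?k t2 c2 x2" using reps_cycle[OF pres2 cH(2)] by blast
  obtain s where s: "s \<in> Hom C t2 (S ?k)" "\<pi>1 ?k \<cdot> s = x1" "\<pi>2 ?k \<cdot> s = x2"
    using biproduct_pair[OF bip reps_Hom(2)[OF pres1 x1] reps_Hom(2)[OF pres2 x2]] .
  have "repN ?k t2 (b1 ?l \<cdot> c1 \<boxminus> b2 ?l \<cdot> c2) (\<beta> ?k \<cdot> s)" using \<beta>(2)[OF s(1)] s x1 x2 by simp
  moreover have "b1 ?l \<cdot> c1 \<boxminus> b2 ?l \<cdot> c2 = (b1 ?l \<cdot> p1 \<boxminus> b2 ?l \<cdot> p2) \<cdot> e2"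
    unfolding c1_def c2_def using p(1,2) e2 q(2) by (simp add: mv_simps)
  ultimately have "\<beta> ?k \<cdot> s = (x \<cdot> e1) \<cdot> e2"
    using reps_unique[OF presN] reps_stable[OF presN r(1) e2] by metis
  then have "\<beta> ?k \<cdot> s = x \<cdot> (e1 \<cdot> e2)" using cmp_assoc[OF e2 e1 x(1)] by simp
  then show "\<exists>t' e u. cover e t' t \<and> u \<in> Hom C t' (S ?k) \<and> \<beta> ?k \<cdot> u = x \<cdot> e"
    using s(1) cover_cmp[OF Q(1) q(1)] by blast
qed

text \<open>In degree zero all chains are cycles, so surjectivity decomposes every class of \<open>N\<close>.\<close>

lemma exact_at_degree_zero:
  assumes z: "is_zero_ob C z" "is_zero_ob C (P1 0)" "is_zero_ob C (P2 0)" "is_zero_ob C (N 0)"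
  shows "exact_at C (\<beta> 0) (zro (HN 0) z)"
proof (rule exact_atI[OF \<beta>(1) zro_Hom[OF obs(8)]])
  show zob: "z \<in> ob C" using z by (simp add: is_zero_ob_def)
  show "zro (HN 0) z \<cdot> \<beta> 0 = zro (S 0) z" using cmp_zro(2)[OF \<beta>(1) zob] .
  have null: "f = zro t w" if "is_zero_ob C w" "f \<in> Hom C t w" for f t w
    using that zro_Hom[of t w] Hom_ob[OF that(2)] unfolding is_zero_ob_def by metis
  fix t x assume x: "x \<in> Hom C t (HN 0)"
  obtain t1 e1 n where n: "cover e1 t1 t" "repN 0 t1 n (x \<cdot> e1)" using reps_lift[OF presN x] .
  note e1 = cover_Hom[OF n(1)]
  have t1: "t1 \<in> ob C" using Hom_ob e1 by blast
  have nH: "n \<in> Hom C t1 (N (Suc 0))" using reps_Hom[OF presN n(2)] by auto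
  have "dN 0 \<cdot> n = b2 0 \<cdot> zro t1 (P2 0)"
    using null[OF z(4) cmp_Hom[OF nH d_Hom(4)]] cmp_zro(1)[OF b2(1) t1] by simp
  then obtain t2 e2 p1 p12 p2 n' where s: "cover e2 t2 t1" "p1 \<in> Hom C t2 (P1 (Suc 0))" "p12 \<in> Hom C t2 (P12 0)"
      "p2 \<in> Hom C t2 (P2 (Suc 0))" "n' \<in> Hom C t2 (N (Suc (Suc 0)))"
      "n \<cdot> e2 = b1 (Suc 0) \<cdot> p1 \<boxplus> (b2 (Suc 0) \<cdot> p2 \<boxplus> dN (Suc 0) \<cdot> n')"
    using excision_surj[OF nH zro_Hom[OF t1 obs(3)]] by blast
  note e2 = cover_Hom[OF s(1)]
  have t2: "t2 \<in> ob C" using Hom_ob e2 by blast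
  define m2 where "m2 = zro t2 (P2 (Suc 0)) \<boxminus> p2"
  have m2: "m2 \<in> Hom C t2 (P2 (Suc 0))" unfolding m2_def using psub_Hom[OF zro_Hom[OF t2 obs(3)] s(4)] .
  obtain x1 where x1: "rep1 0 t2 p1 x1"
    using reps_cycle[OF pres1 s(2) null[OF z(2) cmp_Hom[OF s(2) d_Hom(2)]]] .
  obtain x2 where x2: "rep2 0 t2 m2 x2"
    using reps_cycle[OF pres2 m2 null[OF z(3) cmp_Hom[OF m2 d_Hom(3)]]] .
  obtain u where u: "u \<in> Hom C t2 (S 0)" "\<pi>1 0 \<cdot> u = x1" "\<pi>2 0 \<cdot> u = x2"
    using biproduct_pair[OF bip reps_Hom(2)[OF pres1 x1] reps_Hom(2)[OF pres2 x2]] .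
  have "repN 0 t2 (b1 (Suc 0) \<cdot> p1 \<boxminus> b2 (Suc 0) \<cdot> m2) (\<beta> 0 \<cdot> u)" using \<beta>(2)[OF u(1)] u x1 x2 by simp
  moreover have "n \<cdot> e2 \<boxminus> dN (Suc 0) \<cdot> n' = b1 (Suc 0) \<cdot> p1 \<boxminus> b2 (Suc 0) \<cdot> m2"
    unfolding s(6) m2_def using s(2-5) t2 by (simp add: mv_simps)
  ultimately have "\<beta> 0 \<cdot> u = (x \<cdot> e1) \<cdot> e2"
    using reps_unique[OF presN] reps_mod_boundary[OF presN reps_stable[OF presN n(2) e2] s(5)] by metis
  then have "\<beta> 0 \<cdot> u = x \<cdot> (e1 \<cdot> e2)" using cmp_assoc[OF e2 e1 x] by simp
  then show "\<exists>t' e u. cover e t' t \<and> u \<in> Hom C t' (S 0) \<and> \<beta> 0 \<cdot> u = x \<cdot> e"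
    using u(1) cover_cmp[OF n(1) s(1)] by blast
qed

end

context mayer_vietoris_data
begin

theorem long_exact_sequence:
  assumes bip: "\<And>i. is_biproduct C (H1 i) (H2 i) (S i) (\<iota>1 i) (\<iota>2 i) (\<pi>1 i) (\<pi>2 i)"
  obtains \<delta> \<alpha> \<beta> where
    "\<And>i. \<delta> i \<in> Hom C (HN (Suc i)) (H12 i)" "\<And>i. \<alpha> i \<in> Hom C (H12 i) (S i)"
    "\<And>i. \<beta> i \<in> Hom C (S i) (HN i)"
    "\<And>i. exact_at C (\<beta> (Suc i)) (\<delta> i)" "\<And>i. exact_at C (\<delta> i) (\<alpha> i)"
    "\<And>i. exact_at C (\<alpha> i) (\<beta> i)"
    "\<And>z. is_zero_ob C z \<Longrightarrow> is_zero_ob C (P1 0) \<Longrightarrow> is_zero_ob C (P2 0) \<Longrightarrow> is_zero_ob C (N 0)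
      \<Longrightarrow> exact_at C (\<beta> 0) (zro (HN 0) z)"
proof -
  have "\<exists>d. d \<in> Hom C (HN (Suc i)) (H12 i) \<and> (\<forall>t x y. connects i t x y \<longrightarrow> y = d \<cdot> x) \<and>
      (\<forall>t x. x \<in> Hom C t (HN (Suc i)) \<longrightarrow> (\<exists>t' e y. cover e t' t \<and> connects i t' (x \<cdot> e) y))" for i
    using connecting_arrow[of i] by metis
  then obtain \<delta> where \<delta>: "\<delta> i \<in> Hom C (HN (Suc i)) (H12 i)" "connects i t x y \<Longrightarrow> y = \<delta> i \<cdot> x"
      "x \<in> Hom C t (HN (Suc i)) \<Longrightarrow> \<exists>t' e y. cover e t' t \<and> connects i t' (x \<cdot> e) y" for i t x y
    by metis
  have projection_Hom: "\<pi>1 i \<in> Hom C (S i) (H1 i)" "\<pi>2 i \<in> Hom C (S i) (H2 i)" "S i \<in> ob C" for i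
    using bip[of i] by (auto simp: is_biproduct_def)
  have "\<exists>f. f \<in> Hom C (H12 i) (S i) \<and> (\<forall>t c y. rep12 i t c y \<longrightarrow>
      rep1 i t (a1 (Suc i) \<cdot> c) (\<pi>1 i \<cdot> (f \<cdot> y)) \<and> rep2 i t (a2 (Suc i) \<cdot> c) (\<pi>2 i \<cdot> (f \<cdot> y)))" for i
  proof -
    obtain u1 g1 where g1: "g1 \<in> Hom C (H12 i) (H1 i)"
        "\<And>t c x. rep12 i t c x \<Longrightarrow> rep1 i t (a1 (Suc i) \<cdot> c) (g1 \<cdot> x)"
      using induced_arrow[OF pres12 pres1 a1(1) a1(1) a1(1) a1(2) a1(2)] by metis
    obtain u2 g2 where g2: "g2 \<in> Hom C (H12 i) (H2 i)"
        "\<And>t c x. rep12 i t c x \<Longrightarrow> rep2 i t (a2 (Suc i) \<cdot> c) (g2 \<cdot> x)"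
      using induced_arrow[OF pres12 pres2 a2(1) a2(1) a2(1) a2(2) a2(2)] by metis
    obtain f where f: "f \<in> Hom C (H12 i) (S i)" "\<pi>1 i \<cdot> f = g1" "\<pi>2 i \<cdot> f = g2"
      using biproduct_pair[OF bip g1(1) g2(1)] .
    have "rep1 i t (a1 (Suc i) \<cdot> c) (\<pi>1 i \<cdot> (f \<cdot> y)) \<and> rep2 i t (a2 (Suc i) \<cdot> c) (\<pi>2 i \<cdot> (f \<cdot> y))"
      if r: "rep12 i t c y" for t c y
      using g1(2)[OF r] g2(2)[OF r] f cmp_assoc[OF reps_Hom(2)[OF pres12 r] f(1) projection_Hom(1)]
        cmp_assoc[OF reps_Hom(2)[OF pres12 r] f(1) projection_Hom(2)] by simp
    then show ?thesis using f by blast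
  qed
  then obtain \<alpha> where \<alpha>: "\<alpha> i \<in> Hom C (H12 i) (S i)"
      "rep12 i t c y \<Longrightarrow> rep1 i t (a1 (Suc i) \<cdot> c) (\<pi>1 i \<cdot> (\<alpha> i \<cdot> y))"
      "rep12 i t c y \<Longrightarrow> rep2 i t (a2 (Suc i) \<cdot> c) (\<pi>2 i \<cdot> (\<alpha> i \<cdot> y))" for i t c y
    by metis
  have "\<exists>f. f \<in> Hom C (S i) (HN i) \<and> (\<forall>t s c c'. s \<in> Hom C t (S i) \<longrightarrow> rep1 i t c (\<pi>1 i \<cdot> s) \<longrightarrow>
      rep2 i t c' (\<pi>2 i \<cdot> s) \<longrightarrow> repN i t (b1 (Suc i) \<cdot> c \<boxminus> b2 (Suc i) \<cdot> c') (f \<cdot> s))" for i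
  proof -
    obtain u1 g1 where g1: "g1 \<in> Hom C (H1 i) (HN i)"
        "\<And>t c x. rep1 i t c x \<Longrightarrow> repN i t (b1 (Suc i) \<cdot> c) (g1 \<cdot> x)"
      using induced_arrow[OF pres1 presN b1(1) b1(1) b1(1) b1(2) b1(2)] by metis
    obtain u2 g2 where g2: "g2 \<in> Hom C (H2 i) (HN i)"
        "\<And>t c x. rep2 i t c x \<Longrightarrow> repN i t (b2 (Suc i) \<cdot> c) (g2 \<cdot> x)"
      using induced_arrow[OF pres2 presN b2(1) b2(1) b2(1) b2(2) b2(2)] by metis
    have gp: "g1 \<cdot> \<pi>1 i \<in> Hom C (S i) (HN i)" "g2 \<cdot> \<pi>2 i \<in> Hom C (S i) (HN i)"
      using cmp_Hom projection_Hom g1 g2 by blast+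
    have "repN i t (b1 (Suc i) \<cdot> c \<boxminus> b2 (Suc i) \<cdot> c') ((g1 \<cdot> \<pi>1 i \<boxminus> g2 \<cdot> \<pi>2 i) \<cdot> s)"
      if s: "s \<in> Hom C t (S i)" and r: "rep1 i t c (\<pi>1 i \<cdot> s)" "rep2 i t c' (\<pi>2 i \<cdot> s)" for t s c c'
      using reps_diff[OF presN g1(2)[OF r(1)] g2(2)[OF r(2)]] cmp_psub_left[OF s gp]
        cmp_assoc[OF s projection_Hom(1) g1(1)] cmp_assoc[OF s projection_Hom(2) g2(1)] by simp
    then show ?thesis using psub_Hom[OF gp] by blast
  qed
  then obtain \<beta> where \<beta>: "\<beta> i \<in> Hom C (S i) (HN i)"
      "s \<in> Hom C t (S i) \<Longrightarrow> rep1 i t c (\<pi>1 i \<cdot> s) \<Longrightarrow> rep2 i t c' (\<pi>2 i \<cdot> s) \<Longrightarrow>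
        repN i t (b1 (Suc i) \<cdot> c \<boxminus> b2 (Suc i) \<cdot> c') (\<beta> i \<cdot> s)" for i t s c c'
    by metis
  interpret mayer_vietoris_arrows C P12 P1 P2 N H12 H1 H2 HN d12 d1 d2 dN z12 h12 z1 h1 z2 h2 zN hN
      a1 a2 b1 b2 S \<iota>1 \<iota>2 \<pi>1 \<pi>2 \<delta> \<alpha> \<beta>
    by unfold_locales (fact bip, (fact \<delta> \<alpha> \<beta> | erule (1) \<delta> \<alpha> | erule \<delta> \<alpha> | erule (2) \<beta>)+)
  show ?thesis using that[of \<delta> \<alpha> \<beta>] \<delta>(1) \<alpha>(1) \<beta>(1) exact_at_sum exact_at_intersection
      exact_at_total exact_at_degree_zero by blast
qed

end


section \<open>Excision for quotient complexes\<close>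

text \<open>Here \<open>R1\<close> is the quotient of \<open>P1\<close> by \<open>P12\<close> and \<open>R2\<close> the quotient of \<open>N\<close> by \<open>P2\<close>. The chain map \<open>\<epsilon>\<close>
  between them induces \<open>u\<close> on cycles and the isomorphism \<open>g\<close> on homology.\<close>

locale excision_square = chain_square +
  fixes R1 R2 K1 K2 e1 e2 y1 k1 y2 k2 q1 q2 \<epsilon> u g
  assumes presR1: "presents (R1 (Suc (Suc i))) (R1 (Suc i)) (R1 i) (K1 i) (e1 (Suc i)) (e1 i) (y1 i) (k1 i)"
    and presR2: "presents (R2 (Suc (Suc i))) (R2 (Suc i)) (R2 i) (K2 i) (e2 (Suc i)) (e2 i) (y2 i) (k2 i)"
    and q1: "q1 i \<in> Hom C (P1 i) (R1 i)" "e1 i \<cdot> q1 (Suc i) = q1 i \<cdot> d1 i"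
    and q2: "q2 i \<in> Hom C (N i) (R2 i)" "e2 i \<cdot> q2 (Suc i) = q2 i \<cdot> dN i"
    and \<epsilon>: "\<epsilon> i \<in> Hom C (R1 i) (R2 i)" "e2 i \<cdot> \<epsilon> (Suc i) = \<epsilon> i \<cdot> e1 i"
    and \<epsilon>_square: "\<epsilon> i \<cdot> q1 i = q2 i \<cdot> b1 i"
    and q1_epic: "epic C (q1 i)" and q1_kernel: "is_kernel C (q1 i) (a1 i)"
    and q2_epic: "epic C (q2 i)" and q2_kernel: "is_kernel C (q2 i) (b2 i)"
    and u: "u i \<in> Hom C (src C (y1 i)) (src C (y2 i))" "y2 i \<cdot> u i = \<epsilon> (Suc i) \<cdot> y1 i"
    and g: "g i \<in> Hom C (K1 i) (K2 i)" "g i \<cdot> k1 i = k2 i \<cdot> u i" "isom C (g i)"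
begin

lemma e_Hom: "e1 i \<in> Hom C (R1 (Suc i)) (R1 i)" "e2 i \<in> Hom C (R2 (Suc i)) (R2 i)"
    "dN i \<in> Hom C (N (Suc i)) (N i)" "d1 i \<in> Hom C (P1 (Suc i)) (P1 i)"
  using presents_bd(2) presR1[of i] presR2[of i] presN[of i] pres1[of i] by blast+

lemma ob: "R1 i \<in> ob C" "R2 i \<in> ob C" "N i \<in> ob C" "P1 i \<in> ob C" "P2 i \<in> ob C" "P12 i \<in> ob C"
  using Hom_ob q1 q2 b2 a1 by blast+

lemma reps_g:
  assumes r: "reps (y1 i) (k1 i) t c x" shows "reps (y2 i) (k2 i) t (\<epsilon> (Suc i) \<cdot> c) (g i \<cdot> x)"
proof -
  have P: "is_kernel C (e1 i) (y1 i)" "k1 i \<in> Hom C (src C (y1 i)) (K1 i)" using presR1[of i] by (auto simp: presents_def)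
  have P': "is_kernel C (e2 i) (y2 i)" "k2 i \<in> Hom C (src C (y2 i)) (K2 i)" using presR2[of i] by (auto simp: presents_def)
  have y: "y1 i \<in> Hom C (src C (y1 i)) (R1 (Suc i))" "y2 i \<in> Hom C (src C (y2 i)) (R2 (Suc i))"
    using kernel_Hom[OF P(1) e_Hom(1)] kernel_Hom[OF P'(1) e_Hom(2)] by auto
  obtain v where v: "v \<in> Hom C t (src C (y1 i))" "y1 i \<cdot> v = c" "k1 i \<cdot> v = x" using r by (auto simp: reps_def)
  have "y2 i \<cdot> (u i \<cdot> v) = \<epsilon> (Suc i) \<cdot> c"
    using cmp_assoc[OF v(1) u(1) y(2)] cmp_assoc[OF v(1) y(1) \<epsilon>(1)] u v by simp
  moreover have "k2 i \<cdot> (u i \<cdot> v) = g i \<cdot> x"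
    using cmp_assoc[OF v(1) u(1) P'(2)] cmp_assoc[OF v(1) P(2) g(1)] g v by simp
  ultimately show ?thesis using cmp_Hom[OF v(1) u(1)] by (auto simp: reps_def)
qed

lemmas typing = q1(1)[simplified Hom_def mem_Collect_eq] q2(1)[simplified Hom_def mem_Collect_eq]
  b1(1)[simplified Hom_def mem_Collect_eq] \<epsilon>(1)[simplified Hom_def mem_Collect_eq]
  e_Hom[simplified Hom_def mem_Collect_eq]

lemma quotient_simps:
  assumes "w \<in> ar C"
  shows "tgt C w = P1 (Suc i) \<Longrightarrow> e1 i \<cdot> (q1 (Suc i) \<cdot> w) = q1 i \<cdot> (d1 i \<cdot> w)"
    "tgt C w = N (Suc i) \<Longrightarrow> e2 i \<cdot> (q2 (Suc i) \<cdot> w) = q2 i \<cdot> (dN i \<cdot> w)"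
    "tgt C w = P1 i \<Longrightarrow> \<epsilon> i \<cdot> (q1 i \<cdot> w) = q2 i \<cdot> (b1 i \<cdot> w)"
  using assms cmp_eq_Hom[OF q1(1) e_Hom(1) q1(2) assms] cmp_eq_Hom[OF q2(1) e_Hom(2) q2(2) assms]
    cmp_eq_Hom[OF q1(1) \<epsilon>(1) \<epsilon>_square assms]
  by (simp_all add: typing ob add_simps)

lemmas square_simps = Hom_def typing quotient_simps ob sum_simps

text \<open>Chains of the quotients lift along the epic arrows \<open>q1\<close>, \<open>q2\<close>, and what the quotient maps kill comes
  from the subcomplexes. Surjectivity on chains then follows since \<open>g\<close> is epic, and injectivity since
  \<open>g\<close> is monic.\<close>

sublocale mayer_vietoris_data
proof
  fix n t p i assume *: "n \<in> Hom C t (N (Suc i))" "p \<in> Hom C t (P2 i)" "dN i \<cdot> n = b2 i \<cdot> p"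
  let ?k = "Suc i"
  have "e2 i \<cdot> (q2 ?k \<cdot> n) = (q2 i \<cdot> b2 i) \<cdot> p"
    using cmp_assoc[OF *(1) q2(1) e_Hom(2)] q2(2) cmp_assoc[OF *(1) e_Hom(3) q2(1)] *(3)
      cmp_assoc[OF *(2) b2(1) q2(1)] by simp
  also have "\<dots> = zro t (R2 i)"
    using kernel_Hom(2)[OF q2_kernel q2(1)] cmp_zro(2)[OF *(2) ob(2)] b2(1)[of i] by (simp add: Hom_def)
  finally obtain x where x: "reps (y2 i) (k2 i) t (q2 ?k \<cdot> n) x"
    using reps_cycle[OF presR2 cmp_Hom[OF *(1) q2(1)]] by blast
  have xH: "x \<in> Hom C t (K2 i)" using reps_Hom[OF presR2 x] by simp
  obtain t1 f1 y where 1: "cover f1 t1 t" "y \<in> Hom C t1 (K1 i)" "g i \<cdot> y = x \<cdot> f1"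
    using epic_lift[OF isom_epic[OF g(3)] g(1) xH] .
  obtain t2 f2 r where 2: "cover f2 t2 t1" "reps (y1 i) (k1 i) t2 r (y \<cdot> f2)"
    using reps_lift[OF presR1 1(2)] .
  note f1 = cover_Hom[OF 1(1)] and f2 = cover_Hom[OF 2(1)]
  have f12: "f1 \<cdot> f2 \<in> Hom C t2 t" using cmp_Hom f1 f2 by blast
  have rH: "r \<in> Hom C t2 (R1 ?k)" "e1 i \<cdot> r = zro t2 (R1 i)" using reps_Hom[OF presR1 2(2)] by auto
  have "g i \<cdot> (y \<cdot> f2) = x \<cdot> (f1 \<cdot> f2)"
    using cmp_assoc[OF f2 1(2) g(1)] 1(3) cmp_assoc[OF f2 f1 xH] by simp
  then have "reps (y2 i) (k2 i) t2 ((q2 ?k \<cdot> n) \<cdot> (f1 \<cdot> f2) \<boxminus> \<epsilon> ?k \<cdot> r) (zro t2 (K2 i))"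
    using reps_diff[OF presR2 reps_stable[OF presR2 x f12] reps_g[OF 2(2)]]
      psub_self[OF cmp_Hom[OF f12 xH]] by simp
  then obtain t3 f3 s where 3: "cover f3 t3 t2" "s \<in> Hom C t3 (R2 (Suc ?k))"
      "e2 ?k \<cdot> s = ((q2 ?k \<cdot> n) \<cdot> (f1 \<cdot> f2) \<boxminus> \<epsilon> ?k \<cdot> r) \<cdot> f3"
    using reps_zro_boundary[OF presR2] by metis
  note f3 = cover_Hom[OF 3(1)]
  obtain t4 f4 p1 where 4: "cover f4 t4 t3" "p1 \<in> Hom C t4 (P1 ?k)" "q1 ?k \<cdot> p1 = (r \<cdot> f3) \<cdot> f4"
    using epic_lift[OF q1_epic q1(1) cmp_Hom[OF f3 rH(1)]] .
  note f4 = cover_Hom[OF 4(1)]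
  obtain t5 f5 n' where 5: "cover f5 t5 t4" "n' \<in> Hom C t5 (N (Suc ?k))" "q2 (Suc ?k) \<cdot> n' = (s \<cdot> f4) \<cdot> f5"
    using epic_lift[OF q2_epic q2(1) cmp_Hom[OF f4 3(2)]] .
  note f5 = cover_Hom[OF 5(1)]
  define e where "e = (f1 \<cdot> f2) \<cdot> (f3 \<cdot> (f4 \<cdot> f5))"
  have ce: "cover e t5 t" unfolding e_def
    using cover_cmp[OF cover_cmp[OF 1(1) 2(1)] cover_cmp[OF 3(1) cover_cmp[OF 4(1) 5(1)]]] .
  note eH = cover_Hom[OF ce]
  define w where "w = p1 \<cdot> f5"
  have wH: "w \<in> Hom C t5 (P1 ?k)" unfolding w_def using cmp_Hom f5 4 by blast
  have t5: "t5 \<in> ob C" using Hom_ob f5 by blast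
  have f: "f3 \<cdot> (f4 \<cdot> f5) \<in> Hom C t5 t2" using cmp_Hom f3 f4 f5 by blast
  have qw: "q1 ?k \<cdot> w = r \<cdot> (f3 \<cdot> (f4 \<cdot> f5))"
    using cmp_assoc[OF f5 4(2) q1(1)] 4(3) rH(1) f3 f4 f5 by (simp add: w_def Hom_def cat_simps)
  have "q1 i \<cdot> (d1 i \<cdot> w) = e1 i \<cdot> (q1 ?k \<cdot> w)" using wH by (simp add: square_simps)
  also have "\<dots> = zro t5 (R1 i)" unfolding qw using cmp_assoc[OF f rH(1) e_Hom(1)] rH(2) cmp_zro(2)[OF f ob(1)] by simp
  finally obtain p12 where p12: "p12 \<in> Hom C t5 (P12 i)" "a1 i \<cdot> p12 = d1 i \<cdot> w"
    using kernel_lift[OF q1_kernel q1(1) cmp_Hom[OF wH e_Hom(4)]] a1(1)[of i] by (auto simp: Hom_def)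
  define m where "m = n \<cdot> e \<boxminus> (b1 ?k \<cdot> w \<boxplus> dN ?k \<cdot> n')"
  have mH: "m \<in> Hom C t5 (N ?k)" unfolding m_def
    using psub_Hom[OF cmp_Hom[OF eH *(1)] padd_Hom[OF cmp_Hom[OF wH b1(1)] cmp_Hom[OF 5(2) e_Hom(3)]]] .
  have qn: "q2 ?k \<cdot> (dN ?k \<cdot> n') = (e2 ?k \<cdot> s) \<cdot> (f4 \<cdot> f5)"
  proof -
    have "q2 ?k \<cdot> (dN ?k \<cdot> n') = e2 ?k \<cdot> (q2 (Suc ?k) \<cdot> n')" using 5(2) by (simp add: square_simps)
    then show ?thesis unfolding 5(3) using 3(2) f4 f5 by (simp add: square_simps)
  qed
  have "(e2 ?k \<cdot> s) \<cdot> (f4 \<cdot> f5) = q2 ?k \<cdot> (n \<cdot> e) \<boxminus> \<epsilon> ?k \<cdot> (r \<cdot> (f3 \<cdot> (f4 \<cdot> f5)))"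
    unfolding 3(3) e_def using *(1) rH(1) f1 f2 f3 f4 f5 by (simp add: Hom_def typing ob add_simps)
  also have "\<dots> = q2 ?k \<cdot> (n \<cdot> e) \<boxminus> q2 ?k \<cdot> (b1 ?k \<cdot> w)" unfolding qw[symmetric] using wH by (simp add: square_simps)
  finally have "q2 ?k \<cdot> m = zro t5 (R2 ?k)"
    using qn unfolding m_def using *(1) eH wH 5(2) by (simp add: Hom_def typing ob sum_simps)
  then obtain p2 where p2: "p2 \<in> Hom C t5 (P2 ?k)" "b2 ?k \<cdot> p2 = m"
    using kernel_lift[OF q2_kernel q2(1) mH] b2(1)[of ?k] by (auto simp: Hom_def)
  have "n \<cdot> e = b1 ?k \<cdot> w \<boxplus> (b2 ?k \<cdot> p2 \<boxplus> dN ?k \<cdot> n')"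
    unfolding p2(2) m_def using *(1) eH wH 5(2) by (simp add: Hom_def typing ob sum_simps)
  then show "\<exists>t' e p1 p12 p2 n'. cover e t' t \<and> p1 \<in> Hom C t' (P1 ?k) \<and> p12 \<in> Hom C t' (P12 i) \<and>
        p2 \<in> Hom C t' (P2 ?k) \<and> n' \<in> Hom C t' (N (Suc ?k)) \<and> d1 i \<cdot> p1 = a1 i \<cdot> p12 \<and>
        n \<cdot> e = b1 ?k \<cdot> p1 \<boxplus> (b2 ?k \<cdot> p2 \<boxplus> dN ?k \<cdot> n')"
    using ce wH p12 p2(1) 5(2) by metis
next
  fix p1 t i p12 p2 n
  assume *: "p1 \<in> Hom C t (P1 (Suc i))" "p12 \<in> Hom C t (P12 i)" "p2 \<in> Hom C t (P2 (Suc i))"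
    "n \<in> Hom C t (N (Suc (Suc i)))" "d1 i \<cdot> p1 = a1 i \<cdot> p12"
    "b1 (Suc i) \<cdot> p1 = b2 (Suc i) \<cdot> p2 \<boxplus> dN (Suc i) \<cdot> n"
  let ?k = "Suc i"
  have t: "t \<in> ob C" using Hom_ob * by blast
  have qb: "q2 ?k \<cdot> (b2 ?k \<cdot> p2) = zro t (R2 ?k)"
    using kernel_Hom(2)[OF q2_kernel q2(1), of ?k] cmp_assoc[OF *(3) b2(1) q2(1)] cmp_zro(2)[OF *(3) ob(2)]
      b2(1)[of ?k] by (simp add: Hom_def)
  have qa: "q1 i \<cdot> (a1 i \<cdot> p12) = zro t (R1 i)"
    using kernel_Hom(2)[OF q1_kernel q1(1), of i] cmp_assoc[OF *(2) a1(1) q1(1)] cmp_zro(2)[OF *(2) ob(1)]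
      a1(1)[of i] by (simp add: Hom_def)
  have "e1 i \<cdot> (q1 ?k \<cdot> p1) = q1 i \<cdot> (d1 i \<cdot> p1)" using *(1) by (simp add: square_simps)
  then obtain x where x: "reps (y1 i) (k1 i) t (q1 ?k \<cdot> p1) x"
    using reps_cycle[OF presR1 cmp_Hom[OF *(1) q1(1)]] qa *(5) by metis
  have xH: "x \<in> Hom C t (K1 i)" using reps_Hom[OF presR1 x] by simp
  have "\<epsilon> ?k \<cdot> (q1 ?k \<cdot> p1) = q2 ?k \<cdot> (b1 ?k \<cdot> p1)" using *(1) by (simp add: square_simps)
  also have "\<dots> = q2 ?k \<cdot> (b2 ?k \<cdot> p2) \<boxplus> q2 ?k \<cdot> (dN ?k \<cdot> n)"
    unfolding *(6) using cmp_padd_right[OF cmp_Hom[OF *(3) b2(1)] cmp_Hom[OF *(4) e_Hom(3)] q2(1)] by simp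
  also have "\<dots> = e2 ?k \<cdot> (q2 (Suc ?k) \<cdot> n)" unfolding qb using *(4) by (simp add: square_simps)
  finally have "reps (y2 i) (k2 i) t (e2 ?k \<cdot> (q2 (Suc ?k) \<cdot> n)) (g i \<cdot> x)" using reps_g[OF x] by simp
  then have "g i \<cdot> x = zro t (K2 i)"
    using reps_unique[OF presR2] reps_boundary[OF presR2 cmp_Hom[OF *(4) q2(1)]] by blast
  then have "x = zro t (K1 i)" using monic_zroD[OF isom_monic[OF g(3)] g(1) xH] by simp
  then obtain t1 f1 s where 1: "cover f1 t1 t" "s \<in> Hom C t1 (R1 (Suc ?k))" "e1 ?k \<cdot> s = (q1 ?k \<cdot> p1) \<cdot> f1"
    using reps_zro_boundary[OF presR1] x by metis
  obtain t2 f2 w where 2: "cover f2 t2 t1" "w \<in> Hom C t2 (P1 (Suc ?k))" "q1 (Suc ?k) \<cdot> w = s \<cdot> f2"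
    using epic_lift[OF q1_epic q1(1) 1(2)] .
  note f1 = cover_Hom[OF 1(1)] and f2 = cover_Hom[OF 2(1)]
  have f12: "f1 \<cdot> f2 \<in> Hom C t2 t" using cmp_Hom f1 f2 by blast
  define m where "m = p1 \<cdot> (f1 \<cdot> f2) \<boxminus> d1 ?k \<cdot> w"
  have mH: "m \<in> Hom C t2 (P1 ?k)" unfolding m_def
    using psub_Hom[OF cmp_Hom[OF f12 *(1)] cmp_Hom[OF 2(2) e_Hom(4)]] .
  have "q1 ?k \<cdot> (d1 ?k \<cdot> w) = e1 ?k \<cdot> (q1 (Suc ?k) \<cdot> w)" using 2(2) by (simp add: square_simps)
  also have "\<dots> = ((q1 ?k \<cdot> p1) \<cdot> f1) \<cdot> f2" unfolding 2(3) using cmp_assoc[OF f2 1(2) e_Hom(1)] 1(3) by simp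
  finally have "q1 ?k \<cdot> m = zro t2 (R1 ?k)"
    unfolding m_def using *(1) 2(2) f1 f2 by (simp add: Hom_def typing ob add_simps)
  then obtain v where v: "v \<in> Hom C t2 (P12 ?k)" "a1 ?k \<cdot> v = m"
    using kernel_lift[OF q1_kernel q1(1) mH] a1(1)[of ?k] by (auto simp: Hom_def)
  have "p1 \<cdot> (f1 \<cdot> f2) = a1 ?k \<cdot> v \<boxplus> d1 ?k \<cdot> w"
    unfolding v(2) m_def using psub_padd[OF cmp_Hom[OF f12 *(1)] cmp_Hom[OF 2(2) e_Hom(4)]] by simp
  then show "\<exists>t' e q12 q1. cover e t' t \<and> q12 \<in> Hom C t' (P12 ?k) \<and> q1 \<in> Hom C t' (P1 (Suc ?k)) \<and>
        p1 \<cdot> e = a1 ?k \<cdot> q12 \<boxplus> d1 ?k \<cdot> q1"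
    using cover_cmp[OF 1(1) 2(1)] v(1) 2(2) by metis
qed

end


section \<open>Chain complexes\<close>

lemma complexes_Hom_iff:
  "\<phi> \<in> Hom (complexes C) X Y \<longleftrightarrow> csrc \<phi> = X \<and> ctgt \<phi> = Y \<and> is_complex C X \<and> is_complex C Y \<and>
     (\<forall>i. component \<phi> i \<in> Hom C (cell X i) (cell Y i) \<and>
          bd Y i \<cdot>\<^bsub>C\<^esub> component \<phi> (Suc i) = component \<phi> i \<cdot>\<^bsub>C\<^esub> bd X i)"
  by (auto simp: Hom_def complexes_def)

lemma complexes_cmp [simp]:
  "csrc (\<psi> \<cdot>\<^bsub>complexes C\<^esub> \<phi>) = csrc \<phi>" "ctgt (\<psi> \<cdot>\<^bsub>complexes C\<^esub> \<phi>) = ctgt \<psi>"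
  "component (\<psi> \<cdot>\<^bsub>complexes C\<^esub> \<phi>) i = component \<psi> i \<cdot>\<^bsub>C\<^esub> component \<phi> i"
  by (simp_all add: complexes_def)

lemma complexes_simps [simp]:
  "ob (complexes C) = {X. is_complex C X}" "src (complexes C) = csrc" "tgt (complexes C) = ctgt"
  "pzero (complexes C) X Y = CMap X Y (\<lambda>i. pzero C (cell X i) (cell Y i))"
  by (simp_all add: complexes_def)

lemma cmap_eqI: "csrc \<phi> = csrc \<psi> \<Longrightarrow> ctgt \<phi> = ctgt \<psi> \<Longrightarrow> (\<And>i. component \<phi> i = component \<psi> i) \<Longrightarrow> \<phi> = \<psi>"
  by (cases \<phi>; cases \<psi>) auto

lemma ar_complexes_Hom: "\<phi> \<in> ar (complexes C) \<Longrightarrow> \<phi> \<in> Hom (complexes C) (csrc \<phi>) (ctgt \<phi>)"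
  by (auto simp: Hom_def)

context abelian_category
begin

lemma complex_Hom:
  assumes "is_complex C X"
  shows "bd X i \<in> Hom C (cell X (Suc i)) (cell X i)" "cell X i \<in> ob C"
    "bd X i \<cdot> bd X (Suc i) = zro (cell X (Suc (Suc i))) (cell X i)"
  using assms by (auto simp: is_complex_def)

text \<open>The kernels of the components form a complex. A monic chain map cannot distinguish its inclusion
  from the zero map, so all these kernels vanish.\<close>

lemma monic_component:
  assumes \<phi>: "\<phi> \<in> Hom (complexes C) X Y" and mono: "monic (complexes C) \<phi>"
  shows "monic C (component \<phi> i)"
proof -
  have X: "is_complex C X" and Y: "is_complex C Y"
    and f: "component \<phi> j \<in> Hom C (cell X j) (cell Y j)"
      "bd Y j \<cdot> component \<phi> (Suc j) = component \<phi> j \<cdot> bd X j" and st: "csrc \<phi> = X" "ctgt \<phi> = Y" for j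
    using \<phi> by (auto simp: complexes_Hom_iff)
  note XH = complex_Hom[OF X] and YH = complex_Hom[OF Y]
  have "\<forall>j. \<exists>k. is_kernel C (component \<phi> j) k" using ex_kernel f(1) by (auto simp: Hom_def)
  then obtain k where k: "\<And>j. is_kernel C (component \<phi> j) (k j)" by metis
  define K where "K j = src C (k j)" for j
  have kH: "k j \<in> Hom C (K j) (cell X j)" "component \<phi> j \<cdot> k j = zro (K j) (cell Y j)" for j
    using kernel_Hom[OF k f(1)] K_def by auto
  have Kob: "K j \<in> ob C" for j using Hom_ob kH by blast
  have "\<exists>d \<in> Hom C (K (Suc j)) (K j). k j \<cdot> d = bd X j \<cdot> k (Suc j)" for j
  proof -
    have "component \<phi> j \<cdot> (bd X j \<cdot> k (Suc j)) = bd Y j \<cdot> (component \<phi> (Suc j) \<cdot> k (Suc j))"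
      using cmp_assoc[OF kH(1) XH(1) f(1)] cmp_assoc[OF kH(1) f(1) YH(1)] f(2) by simp
    also have "\<dots> = zro (K (Suc j)) (cell Y j)" using kH(2) cmp_zro(1)[OF YH(1) Kob] by simp
    finally show ?thesis using kernel_lift[OF k f(1) cmp_Hom[OF kH(1) XH(1)]] K_def by metis
  qed
  then obtain d where d: "\<And>j. d j \<in> Hom C (K (Suc j)) (K j)" "\<And>j. k j \<cdot> d j = bd X j \<cdot> k (Suc j)" by metis
  have dd: "d j \<cdot> d (Suc j) = zro (K (Suc (Suc j))) (K j)" for j
  proof (rule monic_zroD[OF kernel_monic[OF k] kH(1) cmp_Hom[OF d(1) d(1)]])
    have "k j \<cdot> (d j \<cdot> d (Suc j)) = (bd X j \<cdot> k (Suc j)) \<cdot> d (Suc j)"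
      using cmp_assoc[OF d(1) d(1) kH(1)] d(2) by simp
    also have "\<dots> = (bd X j \<cdot> bd X (Suc j)) \<cdot> k (Suc (Suc j))"
      using cmp_assoc[OF d(1) kH(1) XH(1)] d(2) cmp_assoc[OF kH(1) XH(1) XH(1)] by simp
    finally show "k j \<cdot> (d j \<cdot> d (Suc j)) = zro (K (Suc (Suc j))) (cell X j)"
      using XH(3) cmp_zro(2)[OF kH(1) XH(2)] by simp
  qed
  define W where "W = Cplx K d"
  have W: "is_complex C W" using d dd Kob by (simp add: is_complex_def W_def)
  have \<iota>: "CMap W X k \<in> Hom (complexes C) W X"
    using W X kH d by (simp add: complexes_Hom_iff W_def)
  have o: "CMap W X (\<lambda>j. zro (K j) (cell X j)) \<in> Hom (complexes C) W X"
    using W X zro_Hom Kob XH(2) cmp_zro(1)[OF XH(1) Kob] cmp_zro(2)[OF d(1) XH(2)]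
    by (simp add: complexes_Hom_iff W_def)
  have "\<phi> \<cdot>\<^bsub>complexes C\<^esub> CMap W X k = \<phi> \<cdot>\<^bsub>complexes C\<^esub> CMap W X (\<lambda>j. zro (K j) (cell X j))"
    by (rule cmap_eqI) (use kH cmp_zro(1)[OF f(1) Kob] in \<open>simp_all\<close>)
  moreover have "\<forall>g \<in> Hom (complexes C) W X. \<forall>h \<in> Hom (complexes C) W X.
      \<phi> \<cdot>\<^bsub>complexes C\<^esub> g = \<phi> \<cdot>\<^bsub>complexes C\<^esub> h \<longrightarrow> g = h"
    using mono W st unfolding monic_def by simp
  ultimately have "CMap W X k = CMap W X (\<lambda>j. zro (K j) (cell X j))" using \<iota> o by blast
  then have k0: "k j = zro (K j) (cell X j)" for j by (simp add: fun_eq_iff)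
  show ?thesis
  proof (rule monic_zroI[OF f(1)])
    fix t g assume g: "g \<in> Hom C t (cell X i)" "component \<phi> i \<cdot> g = zro t (cell Y i)"
    obtain h where h: "h \<in> Hom C t (K i)" "k i \<cdot> h = g" using kernel_lift[OF k f(1) g] K_def by metis
    then show "g = zro t (cell X i)" using k0 cmp_zro(2)[OF h(1) XH(2)] by simp
  qed
qed

text \<open>The cokernels of the components form a complex. A chain map that kills \<open>\<phi>\<close> descends in each
  degree, and the descended arrows commute with the differentials because the quotient arrows are
  epic.\<close>

lemma ex_degreewise_cokernel:
  assumes \<phi>: "\<phi> \<in> Hom (complexes C) X Y"
  obtains q where "is_cokernel (complexes C) \<phi> q" "\<And>i. is_cokernel C (component \<phi> i) (component q i)"
proof -
  have X: "is_complex C X" and Y: "is_complex C Y"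
    and f: "component \<phi> j \<in> Hom C (cell X j) (cell Y j)"
      "bd Y j \<cdot> component \<phi> (Suc j) = component \<phi> j \<cdot> bd X j" and st: "csrc \<phi> = X" "ctgt \<phi> = Y" for j
    using \<phi> by (auto simp: complexes_Hom_iff)
  note XH = complex_Hom[OF X] and YH = complex_Hom[OF Y]
  have "\<forall>j. \<exists>k. is_cokernel C (component \<phi> j) k" using ex_cokernel f(1) by (auto simp: Hom_def)
  then obtain c where c: "\<And>j. is_cokernel C (component \<phi> j) (c j)" by metis
  define Q where "Q j = tgt C (c j)" for j
  have cH: "c j \<in> Hom C (cell Y j) (Q j)" "c j \<cdot> component \<phi> j = zro (cell X j) (Q j)" for j
    using cokernel_Hom[OF c f(1)] Q_def by auto
  have Qob: "Q j \<in> ob C" for j using Hom_ob cH by blast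
  have "\<exists>d \<in> Hom C (Q (Suc j)) (Q j). d \<cdot> c (Suc j) = c j \<cdot> bd Y j" for j
  proof -
    have "(c j \<cdot> bd Y j) \<cdot> component \<phi> (Suc j) = (c j \<cdot> component \<phi> j) \<cdot> bd X j"
      using cmp_assoc[OF f(1) YH(1) cH(1)] cmp_assoc[OF XH(1) f(1) cH(1)] f(2) by simp
    also have "\<dots> = zro (cell X (Suc j)) (Q j)" using cH(2) cmp_zro(2)[OF XH(1) Qob] by simp
    finally show ?thesis using cokernel_desc[OF c f(1) cmp_Hom[OF YH(1) cH(1)]] Q_def by metis
  qed
  then obtain d where d: "\<And>j. d j \<in> Hom C (Q (Suc j)) (Q j)" "\<And>j. d j \<cdot> c (Suc j) = c j \<cdot> bd Y j" by metis
  have dd: "d j \<cdot> d (Suc j) = zro (Q (Suc (Suc j))) (Q j)" for j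
  proof (rule epic_zroD[OF cokernel_epic[OF c] cH(1) cmp_Hom[OF d(1) d(1)]])
    have "(d j \<cdot> d (Suc j)) \<cdot> c (Suc (Suc j)) = d j \<cdot> (c (Suc j) \<cdot> bd Y (Suc j))"
      using cmp_assoc[OF cH(1) d(1) d(1)] d(2) by simp
    also have "\<dots> = c j \<cdot> (bd Y j \<cdot> bd Y (Suc j))"
      using cmp_assoc[OF YH(1) cH(1) d(1)] d(2) cmp_assoc[OF YH(1) YH(1) cH(1)] by simp
    finally show "(d j \<cdot> d (Suc j)) \<cdot> c (Suc (Suc j)) = zro (cell Y (Suc (Suc j))) (Q j)"
      using YH(3) cmp_zro(1)[OF cH(1) YH(2)] by simp
  qed
  define W where "W = Cplx Q d"
  have W: "is_complex C W" using d dd Qob by (simp add: is_complex_def W_def)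
  define q where "q = CMap Y W c"
  have qH: "q \<in> Hom (complexes C) Y W"
    using W Y cH d by (simp add: complexes_Hom_iff W_def q_def)
  have "is_cokernel (complexes C) \<phi> q"
    unfolding is_cokernel_def
  proof (intro conjI ballI impI)
    show "\<phi> \<in> ar (complexes C)" "q \<in> ar (complexes C)" "src (complexes C) q = tgt (complexes C) \<phi>"
      using \<phi> qH by (auto simp: Hom_def)
    show "q \<cdot>\<^bsub>complexes C\<^esub> \<phi> = pzero (complexes C) (src (complexes C) \<phi>) (tgt (complexes C) q)"
      by (rule cmap_eqI) (use st cH in \<open>simp_all add: q_def W_def\<close>)
  next
    fix T g assume T: "T \<in> ob (complexes C)" and gH: "g \<in> Hom (complexes C) (tgt (complexes C) \<phi>) T"
      and g\<phi>: "g \<cdot>\<^bsub>complexes C\<^esub> \<phi> = pzero (complexes C) (src (complexes C) \<phi>) T"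
    have g: "component g j \<in> Hom C (cell Y j) (cell T j)" "bd T j \<cdot> component g (Suc j) = component g j \<cdot> bd Y j"
       "csrc g = Y" "ctgt g = T" for j
      using gH st by (auto simp: complexes_Hom_iff)
    have TC: "is_complex C T" using T by simp
    note TH = complex_Hom[OF TC]
    have "component g j \<cdot> component \<phi> j = zro (cell X j) (cell T j)" for j
      using arg_cong[OF g\<phi>, of "\<lambda>\<psi>. component \<psi> j"] st by simp
    then have "\<exists>h \<in> Hom C (Q j) (cell T j). h \<cdot> c j = component g j" for j
      using cokernel_desc[OF c f(1) g(1)] Q_def by metis
    then obtain h where h: "\<And>j. h j \<in> Hom C (Q j) (cell T j)" "\<And>j. h j \<cdot> c j = component g j" by metis
    have "bd T j \<cdot> h (Suc j) = h j \<cdot> d j" for j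
    proof (rule epicD[OF cokernel_epic[OF c] cH(1) cmp_Hom[OF h(1) TH(1)] cmp_Hom[OF d(1) h(1)]])
      show "(bd T j \<cdot> h (Suc j)) \<cdot> c (Suc j) = (h j \<cdot> d j) \<cdot> c (Suc j)"
        using cmp_assoc[OF cH(1) h(1) TH(1)] cmp_assoc[OF cH(1) d(1) h(1)] h(2) d(2)
          cmp_assoc[OF YH(1) cH(1) h(1)] g(2) by simp
    qed
    then have hH: "CMap W T h \<in> Hom (complexes C) W T"
      using W TC h by (simp add: complexes_Hom_iff W_def)
    have hq: "CMap W T h \<cdot>\<^bsub>complexes C\<^esub> q = g"
      by (rule cmap_eqI) (use g h in \<open>simp_all add: q_def\<close>)
    show "\<exists>!h. h \<in> Hom (complexes C) (tgt (complexes C) q) T \<and> h \<cdot>\<^bsub>complexes C\<^esub> q = g"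
    proof (rule ex1I[of _ "CMap W T h"])
      show "CMap W T h \<in> Hom (complexes C) (tgt (complexes C) q) T \<and> CMap W T h \<cdot>\<^bsub>complexes C\<^esub> q = g"
        using hH hq by (simp add: q_def)
    next
      fix \<psi> assume \<psi>: "\<psi> \<in> Hom (complexes C) (tgt (complexes C) q) T \<and> \<psi> \<cdot>\<^bsub>complexes C\<^esub> q = g"
      have p: "component \<psi> j \<in> Hom C (Q j) (cell T j)" "csrc \<psi> = W" "ctgt \<psi> = T" for j
        using \<psi> by (auto simp: complexes_Hom_iff q_def W_def)
      have "component \<psi> j \<cdot> c j = component g j" for j
        using \<psi> by (auto simp: q_def)
      then have "component \<psi> j = h j" for j
        using epicD[OF cokernel_epic[OF c] cH(1) p(1) h(1)] h(2) by simp
      then show "\<psi> = CMap W T h" by (intro cmap_eqI) (simp_all add: p)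
    qed
  qed
  then show ?thesis using that c by (simp add: q_def)
qed

lemma cokernel_complex_desc:
  assumes "\<phi> \<in> Hom (complexes C) X Y" "is_cokernel (complexes C) \<phi> q" "g \<in> Hom (complexes C) Y T"
    "\<And>i. component g i \<cdot> component \<phi> i = zro (cell X i) (cell T i)"
  shows "\<exists>!h. h \<in> Hom (complexes C) (ctgt q) T \<and> h \<cdot>\<^bsub>complexes C\<^esub> q = g"
proof -
  have st: "csrc \<phi> = X" "ctgt \<phi> = Y" "csrc g = Y" "ctgt g = T" "is_complex C T"
    using assms by (auto simp: complexes_Hom_iff)
  have "g \<cdot>\<^bsub>complexes C\<^esub> \<phi> = pzero (complexes C) X T"
    by (rule cmap_eqI) (use st assms in simp_all)
  moreover have "\<forall>x \<in> ob (complexes C). \<forall>g \<in> Hom (complexes C) (tgt (complexes C) \<phi>) x.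
      g \<cdot>\<^bsub>complexes C\<^esub> \<phi> = pzero (complexes C) (src (complexes C) \<phi>) x \<longrightarrow>
        (\<exists>!h. h \<in> Hom (complexes C) (tgt (complexes C) q) x \<and> h \<cdot>\<^bsub>complexes C\<^esub> q = g)"
    using assms(2) unfolding is_cokernel_def by blast
  moreover have "T \<in> ob (complexes C)" "g \<in> Hom (complexes C) (tgt (complexes C) \<phi>) T" using st assms by simp_all
  ultimately show ?thesis using st by simp
qed

lemma cokernel_complex_zro:
  assumes "\<phi> \<in> Hom (complexes C) X Y" "is_cokernel (complexes C) \<phi> q"
  shows "q \<in> Hom (complexes C) Y (ctgt q)" "component q i \<cdot> component \<phi> i = zro (cell X i) (cell (ctgt q) i)"
proof -
  have st: "csrc \<phi> = X" "ctgt \<phi> = Y" using assms by (auto simp: complexes_Hom_iff)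
  then show "q \<in> Hom (complexes C) Y (ctgt q)"
    using assms(2) ar_complexes_Hom[of q C] by (simp add: is_cokernel_def)
  have "q \<cdot>\<^bsub>complexes C\<^esub> \<phi> = pzero (complexes C) (csrc \<phi>) (ctgt q)"
    using assms(2) by (simp add: is_cokernel_def)
  from arg_cong[OF this, of "\<lambda>\<psi>. component \<psi> i"]
  show "component q i \<cdot> component \<phi> i = zro (cell X i) (cell (ctgt q) i)" using st by simp
qed

text \<open>Any cokernel of a chain map is isomorphic to the degreewise one, hence is itself a cokernel in each
  degree.\<close>

lemma cokernel_component:
  assumes \<phi>: "\<phi> \<in> Hom (complexes C) X Y" and q: "is_cokernel (complexes C) \<phi> q"
  shows "is_cokernel C (component \<phi> i) (component q i)"
proof -
  obtain p where p: "is_cokernel (complexes C) \<phi> p" "is_cokernel C (component \<phi> i) (component p i)"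
    using ex_degreewise_cokernel[OF \<phi>] by metis
  note qz = cokernel_complex_zro[OF \<phi> q] and pz = cokernel_complex_zro[OF \<phi> p(1)]
  let ?Q = "ctgt q" and ?P = "ctgt p"
  have h: "component \<psi> j \<in> Hom C (cell U j) (cell V j)" "csrc \<psi> = U" "ctgt \<psi> = V" "is_complex C V"
      "bd V j \<cdot> component \<psi> (Suc j) = component \<psi> j \<cdot> bd U j"
    if "\<psi> \<in> Hom (complexes C) U V" for \<psi> U V j
    using that by (auto simp: complexes_Hom_iff)
  obtain u where u: "u \<in> Hom (complexes C) ?Q ?P" "u \<cdot>\<^bsub>complexes C\<^esub> q = p"
    using cokernel_complex_desc[OF \<phi> q pz] by blast
  obtain v where v: "v \<in> Hom (complexes C) ?P ?Q" "v \<cdot>\<^bsub>complexes C\<^esub> p = q"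
    using cokernel_complex_desc[OF \<phi> p(1) qz] by blast
  have uq: "component u j \<cdot> component q j = component p j" for j using complexes_cmp(3)[of C u q j] u(2) by simp
  have vp: "component v j \<cdot> component p j = component q j" for j using complexes_cmp(3)[of C v p j] v(2) by simp
  note qH = h[OF qz(1)] and pH = h[OF pz(1)] and uH = h[OF u(1)] and vH = h[OF v(1)]
  note Q = complex_Hom[OF qH(4)]
  have vu: "v \<cdot>\<^bsub>complexes C\<^esub> u \<in> Hom (complexes C) ?Q ?Q"
    using cmp_Hom[OF uH(1) vH(1)] qH(4) uH(2,3,5) vH(2,3,5) cmp_assoc[OF uH(1) vH(1) Q(1)]
      cmp_assoc[OF uH(1) complex_Hom(1)[OF pH(4)] vH(1)] cmp_assoc[OF Q(1) uH(1) vH(1)]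
    by (simp add: complexes_Hom_iff)
  define I where "I = CMap ?Q ?Q (\<lambda>j. idt C (cell ?Q j))"
  have I: "I \<in> Hom (complexes C) ?Q ?Q"
    using qH(4) idt_Hom Q idt_left[OF Q(1)] idt_right[OF Q(1)] by (simp add: complexes_Hom_iff I_def)
  have "(v \<cdot>\<^bsub>complexes C\<^esub> u) \<cdot>\<^bsub>complexes C\<^esub> q = q" "I \<cdot>\<^bsub>complexes C\<^esub> q = q"
    using cmp_assoc[OF qH(1) uH(1) vH(1)] uq vp idt_left[OF qH(1)] vH(3)
    by (auto intro!: cmap_eqI simp: I_def)
  then have "v \<cdot>\<^bsub>complexes C\<^esub> u = I" using vu I cokernel_complex_desc[OF \<phi> q qz] by blast
  then have "component v i \<cdot> component u i = idt C (cell ?Q i)"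
    using complexes_cmp(3)[of C v u i] by (simp add: I_def)
  moreover have "component u i \<cdot> component v i = idt C (cell ?P i)"
    using epicD[OF cokernel_epic[OF p(2)] pH(1) cmp_Hom[OF vH(1) uH(1)] idt_Hom]
      cmp_assoc[OF pH(1) vH(1) uH(1)] uq vp idt_left[OF pH(1)] Hom_ob(2)[OF pH(1)] by simp
  ultimately have "isom C (component v i)" using uH(1)[of i] vH(1)[of i] by (auto simp: isom_def Hom_def)
  then show ?thesis
    using cokernel_isom[OF p(2) _ h(1)[OF \<phi>] pH(1) vH(1)] vp by simp
qed

lemma cokernel_of_complexes:
  assumes "\<phi> \<in> Hom (complexes C) X Y"
  shows "is_cokernel (complexes C) \<phi> (cokernel_of (complexes C) \<phi>)"
  using ex_degreewise_cokernel[OF assms] unfolding cokernel_of_def by (metis someI_ex)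

end


section \<open>Homology of complexes\<close>

text \<open>A non-negatively graded complex is shifted by one and completed by a zero object in position
  zero, so that the homology in every degree sits between two differentials.\<close>

definition shifted :: "('m, 'c, 'z) abcat_scheme \<Rightarrow> ('m, 'c) cplx \<Rightarrow> nat \<Rightarrow> 'm" where
  "shifted C X i = (case i of 0 \<Rightarrow> zero_ob C | Suc j \<Rightarrow> cell X j)"

lemma shifted_simps [simp]: "shifted C X 0 = zero_ob C" "shifted C X (Suc j) = cell X j"
  by (simp_all add: shifted_def)

context abelian_category
begin

lemma zero_ob: "is_zero_ob C (zero_ob C)"
  unfolding zero_ob_def using ex_zero_ob by (rule someI_ex)

lemma zero_obD: "is_zero_ob C w \<Longrightarrow> f \<in> Hom C t w \<Longrightarrow> g \<in> Hom C t w \<Longrightarrow> f = g"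
    "is_zero_ob C w \<Longrightarrow> f \<in> Hom C w t \<Longrightarrow> g \<in> Hom C w t \<Longrightarrow> f = g"
  using Hom_ob unfolding is_zero_ob_def by metis+

lemma zero_ob_iff: "w \<in> ob C \<Longrightarrow> is_zero_ob C w \<longleftrightarrow> idt C w = zro w w"
proof
  assume w: "w \<in> ob C" "idt C w = zro w w"
  have "f = zro t w" if "f \<in> Hom C t w" for f t
    using idt_left[OF that] w cmp_zro(2)[OF that w(1)] by simp
  moreover have "f = zro w t" if "f \<in> Hom C w t" for f t
    using idt_right[OF that] w cmp_zro(1)[OF that w(1)] by simp
  ultimately show "is_zero_ob C w" unfolding is_zero_ob_def using w zro_Hom by metis
qed (use zero_obD idt_Hom zro_Hom in blast)

lemma zero_ob_ob: "zero_ob C \<in> ob C"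
  using zero_ob by (simp add: is_zero_ob_def)

lemma out_bd_Hom:
  assumes "is_complex C X"
  shows "out_bd C X i \<in> Hom C (shifted C X (Suc i)) (shifted C X i)"
  using complex_Hom[OF assms] zro_Hom[OF _ zero_ob_ob] by (cases i) (auto simp: out_bd_def)

text \<open>The chosen kernels and cokernels in the definition of homology form a presentation between
  consecutive differentials of the shifted complex.\<close>

lemma presents_homology:
  assumes X: "is_complex C X"
  shows "presents (shifted C X (Suc (Suc i))) (shifted C X (Suc i)) (shifted C X i) (homology C X i)
    (out_bd C X (Suc i)) (out_bd C X i) (cycle_incl C X i) (homology_proj C X i)"
proof -
  note d = out_bd_Hom[OF X]
  have k: "is_kernel C (out_bd C X i) (cycle_incl C X i)"
    unfolding cycle_incl_def kernel_of_def
    by (rule someI_ex) (use ex_kernel d[of i] in \<open>auto simp: Hom_def\<close>)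
  note z = kernel_Hom[OF k d]
  have dd: "out_bd C X i \<cdot> out_bd C X (Suc i) = zro (shifted C X (Suc (Suc i))) (shifted C X i)"
    using complex_Hom[OF X] cmp_zro(2)[OF complex_Hom(1)[OF X] zero_ob_ob]
    by (cases i) (auto simp: out_bd_def)
  obtain b where b: "b \<in> Hom C (cell X (Suc i)) (src C (cycle_incl C X i))" "cycle_incl C X i \<cdot> b = bd X i"
    using kernel_lift[OF k d d dd] by (auto simp: out_bd_def)
  have "bd_to_cycles C X i = b"
    unfolding bd_to_cycles_def
    by (rule the_equality) (use b monicD[OF kernel_monic[OF k] z(1)] in auto)
  moreover have "is_cokernel C (bd_to_cycles C X i) (homology_proj C X i)"
    unfolding homology_proj_def cokernel_of_def
    by (rule someI_ex) (use ex_cokernel b calculation in \<open>auto simp: Hom_def\<close>)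
  ultimately have c: "is_cokernel C b (homology_proj C X i)" by simp
  show ?thesis
    unfolding presents_def homology_def
    using d[of i] d[of "Suc i"] k b c cokernel_Hom(1)[OF c b(1)] by (auto simp: out_bd_def)
qed

end


section \<open>Exact functors\<close>

locale abelian_exact_functor = exact_functor C D F + source: abelian_category C + target: abelian_category D
  for C :: "('o, 'a, 'y) abcat_scheme" and D :: "('p, 'b, 'z) abcat_scheme" and F
begin

lemma F_Hom: "f \<in> Hom C x y \<Longrightarrow> on_ar F f \<in> Hom D (on_ob F x) (on_ob F y)"
  by (rule on_ar)

lemma F_zro:
  assumes "x \<in> ob C" "y \<in> ob C"
  shows "on_ar F (pzero C x y) = pzero D (on_ob F x) (on_ob F y)"
proof -
  have z: "pzero C x y \<in> Hom C x y" using source.zro_Hom assms .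
  have F: "on_ar F (pzero C x y) \<in> Hom D (on_ob F x) (on_ob F y)" using on_ar z .
  have "on_ar F (pzero C x y) \<boxplus>\<^bsub>D\<^esub> on_ar F (pzero C x y) = on_ar F (pzero C x y)"
    using additive[OF z z] source.padd_zro(1)[OF z] by simp
  then show ?thesis
    using target.padd_left_cancel[OF F F target.zro_Hom] target.padd_zro(1)[OF F] on_ob assms by simp
qed

lemma F_zero_ob:
  assumes "is_zero_ob C w" shows "is_zero_ob D (on_ob F w)"
proof -
  have w: "w \<in> ob C" using assms by (simp add: is_zero_ob_def)
  have "idt C w = pzero C w w" using source.zero_ob_iff[OF w] assms by simp
  then have "idt D (on_ob F w) = pzero D (on_ob F w) (on_ob F w)" using on_idt[OF w] F_zro[OF w w] by simp
  then show ?thesis using target.zero_ob_iff on_ob w by simp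
qed

lemma F_monic:
  assumes "monic C f" shows "monic D (on_ar F f)"
proof -
  obtain c where c: "is_cokernel C f c" using source.ex_cokernel assms unfolding monic_def by blast
  then have "short_exact C f c"
    using source.short_exact_iff source.monic_kernel_of_cokernel assms by blast
  then show ?thesis using short_exact by (auto simp: short_exact_def)
qed

lemma F_epic:
  assumes "epic C f" shows "epic D (on_ar F f)"
proof -
  obtain c where c: "is_kernel C f c" using source.ex_kernel assms unfolding epic_def by blast
  then have "short_exact C c f"
    using source.short_exact_iff source.epic_cokernel_of_kernel assms by blast
  then show ?thesis using short_exact by (auto simp: short_exact_def)
qed

text \<open>Preservation of short exact sequences gives preservation of all kernels: after splitting \<open>f\<close> into
  an epic \<open>e\<close> and a monic \<open>m\<close>, the kernel of \<open>f\<close> and \<open>e\<close> form a short exact sequence, and the image of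
  \<open>m\<close> stays monic.\<close>

lemma F_kernel:
  assumes k: "is_kernel C f k" shows "is_kernel D (on_ar F f) (on_ar F k)"
proof -
  define x y where "x = src C f" and "y = tgt C f"
  have f: "f \<in> Hom C x y" using k by (auto simp: is_kernel_def Hom_def x_def y_def)
  obtain i e m where *: "e \<in> Hom C x i" "epic C e" "m \<in> Hom C i y" "monic C m" "m \<cdot>\<^bsub>C\<^esub> e = f"
    using source.image_factorization[OF f] .
  note kH = source.kernel_Hom[OF k f]
  have ob: "src C k \<in> ob C" "y \<in> ob C" "i \<in> ob C" using source.Hom_ob kH f * by blast+
  have "m \<cdot>\<^bsub>C\<^esub> (e \<cdot>\<^bsub>C\<^esub> k) = pzero C (src C k) y" using source.cmp_assoc[OF kH(1) *(1,3)] *(5) kH(2) by simp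
  then have ek: "e \<cdot>\<^bsub>C\<^esub> k = pzero C (src C k) i"
    using source.monic_zroD[OF *(4,3) source.cmp_Hom[OF kH(1) *(1)]] by blast
  have "is_kernel C e k"
  proof (rule source.kernelI[OF *(1) kH(1) ek source.kernel_monic[OF k]])
    fix t g assume g: "g \<in> Hom C t x" "e \<cdot>\<^bsub>C\<^esub> g = pzero C t i"
    have "f \<cdot>\<^bsub>C\<^esub> g = pzero C t y"
      using source.cmp_assoc[OF g(1) *(1,3)] *(5) g(2) source.cmp_zro(1)[OF *(3)] source.Hom_ob[OF g(1)] by simp
    then show "\<exists>h\<in>Hom C t (src C k). k \<cdot>\<^bsub>C\<^esub> h = g" using source.kernel_lift[OF k f g(1)] by metis
  qed
  then have "short_exact C k e"
    using source.short_exact_iff source.epic_cokernel_of_kernel *(2) by blast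
  then have K: "is_kernel D (on_ar F e) (on_ar F k)" using short_exact target.short_exact_iff by blast
  have Fe: "on_ar F e \<in> Hom D (on_ob F x) (on_ob F i)" and Fm: "on_ar F m \<in> Hom D (on_ob F i) (on_ob F y)"
    and Ff: "on_ar F f \<in> Hom D (on_ob F x) (on_ob F y)" and Fk: "on_ar F k \<in> Hom D (on_ob F (src C k)) (on_ob F x)"
    using on_ar * f kH by blast+
  have Fme: "on_ar F m \<cdot>\<^bsub>D\<^esub> on_ar F e = on_ar F f" using on_cmp[OF *(1,3)] *(5) by simp
  show ?thesis
  proof (rule target.kernelI[OF Ff Fk _ target.kernel_monic[OF K]])
    show "on_ar F f \<cdot>\<^bsub>D\<^esub> on_ar F k = pzero D (on_ob F (src C k)) (on_ob F y)"
      using on_cmp[OF kH(1) f] kH(2) F_zro ob by simp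
    fix t g assume g: "g \<in> Hom D t (on_ob F x)" "on_ar F f \<cdot>\<^bsub>D\<^esub> g = pzero D t (on_ob F y)"
    have "on_ar F m \<cdot>\<^bsub>D\<^esub> (on_ar F e \<cdot>\<^bsub>D\<^esub> g) = pzero D t (on_ob F y)"
      using target.cmp_assoc[OF g(1) Fe Fm] Fme g(2) by simp
    then have "on_ar F e \<cdot>\<^bsub>D\<^esub> g = pzero D t (on_ob F i)"
      using target.monic_zroD[OF F_monic[OF *(4)] Fm target.cmp_Hom[OF g(1) Fe]] by simp
    then obtain h where "h \<in> Hom D t (src D (on_ar F k))" "on_ar F k \<cdot>\<^bsub>D\<^esub> h = g"
      using target.kernel_lift[OF K Fe g(1)] by blast
    then show "\<exists>h\<in>Hom D t (on_ob F (src C k)). on_ar F k \<cdot>\<^bsub>D\<^esub> h = g" using Fk by (auto simp: Hom_def)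
  qed
qed

lemma F_cokernel:
  assumes c: "is_cokernel C f c" shows "is_cokernel D (on_ar F f) (on_ar F c)"
proof -
  define x y where "x = src C f" and "y = tgt C f"
  have f: "f \<in> Hom C x y" using c by (auto simp: is_cokernel_def Hom_def x_def y_def)
  obtain i e m where *: "e \<in> Hom C x i" "epic C e" "m \<in> Hom C i y" "monic C m" "m \<cdot>\<^bsub>C\<^esub> e = f"
    using source.image_factorization[OF f] .
  note cH = source.cokernel_Hom[OF c f]
  have ob: "tgt C c \<in> ob C" "x \<in> ob C" "i \<in> ob C" using source.Hom_ob cH f * by blast+
  have "(c \<cdot>\<^bsub>C\<^esub> m) \<cdot>\<^bsub>C\<^esub> e = pzero C x (tgt C c)" using source.cmp_assoc[OF *(1,3) cH(1)] *(5) cH(2) by simp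
  then have cm: "c \<cdot>\<^bsub>C\<^esub> m = pzero C i (tgt C c)"
    using source.epic_zroD[OF *(2,1) source.cmp_Hom[OF *(3) cH(1)]] by blast
  have "is_cokernel C m c"
  proof (rule source.cokernelI[OF *(3) cH(1) cm source.cokernel_epic[OF c]])
    fix t g assume g: "g \<in> Hom C y t" "g \<cdot>\<^bsub>C\<^esub> m = pzero C i t"
    have "g \<cdot>\<^bsub>C\<^esub> f = pzero C x t"
      using source.cmp_assoc[OF *(1,3) g(1)] *(5) g(2) source.cmp_zro(2)[OF *(1)] source.Hom_ob[OF g(1)] by simp
    then show "\<exists>h\<in>Hom C (tgt C c) t. h \<cdot>\<^bsub>C\<^esub> c = g" using source.cokernel_desc[OF c f g(1)] by metis
  qed
  then have "short_exact C m c"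
    using source.short_exact_iff source.monic_kernel_of_cokernel *(4) by blast
  then have K: "is_cokernel D (on_ar F m) (on_ar F c)" using short_exact target.short_exact_iff by blast
  have Fe: "on_ar F e \<in> Hom D (on_ob F x) (on_ob F i)" and Fm: "on_ar F m \<in> Hom D (on_ob F i) (on_ob F y)"
    and Ff: "on_ar F f \<in> Hom D (on_ob F x) (on_ob F y)" and Fc: "on_ar F c \<in> Hom D (on_ob F y) (on_ob F (tgt C c))"
    using on_ar * f cH by blast+
  have Fme: "on_ar F m \<cdot>\<^bsub>D\<^esub> on_ar F e = on_ar F f" using on_cmp[OF *(1,3)] *(5) by simp
  show ?thesis
  proof (rule target.cokernelI[OF Ff Fc _ target.cokernel_epic[OF K]])
    show "on_ar F c \<cdot>\<^bsub>D\<^esub> on_ar F f = pzero D (on_ob F x) (on_ob F (tgt C c))"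
      using on_cmp[OF f cH(1)] cH(2) F_zro ob by simp
    fix t g assume g: "g \<in> Hom D (on_ob F y) t" "g \<cdot>\<^bsub>D\<^esub> on_ar F f = pzero D (on_ob F x) t"
    have "(g \<cdot>\<^bsub>D\<^esub> on_ar F m) \<cdot>\<^bsub>D\<^esub> on_ar F e = pzero D (on_ob F x) t"
      using target.cmp_assoc[OF Fe Fm g(1)] Fme g(2) by simp
    then have "g \<cdot>\<^bsub>D\<^esub> on_ar F m = pzero D (on_ob F i) t"
      using target.epic_zroD[OF F_epic[OF *(2)] Fe target.cmp_Hom[OF Fm g(1)]] by simp
    then obtain h where "h \<in> Hom D (tgt D (on_ar F c)) t" "h \<cdot>\<^bsub>D\<^esub> on_ar F c = g"
      using target.cokernel_desc[OF K Fm g(1)] by blast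
    then show "\<exists>h\<in>Hom D (on_ob F (tgt C c)) t. h \<cdot>\<^bsub>D\<^esub> on_ar F c = g" using Fc by (auto simp: Hom_def)
  qed
qed

text \<open>A presentation of homology consists of a kernel, a factorization through it, and a cokernel, and
  exact functors preserve all three.\<close>

lemma F_presents:
  assumes "source.presents X1 X X0 H d1 d0 z h"
  shows "target.presents (on_ob F X1) (on_ob F X) (on_ob F X0) (on_ob F H)
    (on_ar F d1) (on_ar F d0) (on_ar F z) (on_ar F h)"
proof -
  obtain b where b: "d1 \<in> Hom C X1 X" "d0 \<in> Hom C X X0" "is_kernel C d0 z" "h \<in> Hom C (src C z) H"
      "b \<in> Hom C X1 (src C z)" "z \<cdot>\<^bsub>C\<^esub> b = d1" "is_cokernel C b h"
    using assms by (auto simp: source.presents_def)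
  have z: "z \<in> Hom C (src C z) X" using source.kernel_Hom[OF b(3,2)] by simp
  have sz: "src D (on_ar F z) = on_ob F (src C z)" using on_ar[OF z] by (simp add: Hom_def)
  show ?thesis
    unfolding target.presents_def sz
    using on_ar b F_kernel[OF b(3)] F_cokernel[OF b(7)] on_cmp[OF b(5) z] by metis
qed

lemma F_complex:
  assumes "is_complex C X" shows "is_complex D (on_ob (degreewise F) X)"
  using source.complex_Hom[OF assms] on_ar on_ob on_cmp F_zro
  by (simp add: is_complex_def degreewise_def Let_def) (metis)

end


section \<open>Squares of complexes under exact functors\<close>

lemma degreewise_simps [simp]:
  "cell (on_ob (degreewise F) X) i = on_ob F (cell X i)"
  "bd (on_ob (degreewise F) X) i = on_ar F (bd X i)"
  "csrc (on_ar (degreewise F) \<phi>) = on_ob (degreewise F) (csrc \<phi>)"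
  "ctgt (on_ar (degreewise F) \<phi>) = on_ob (degreewise F) (ctgt \<phi>)"
  "component (on_ar (degreewise F) \<phi>) i = on_ar F (component \<phi> i)"
  by (simp_all add: degreewise_def Let_def)

lemma (in abelian_category) presents_isom:
  assumes P: "presents X1 X X0 H d1 d0 z h" and t: "isom C t" "t \<in> Hom C H K"
  shows "presents X1 X X0 K d1 d0 z (t \<cdot> h)"
proof -
  obtain b where b: "h \<in> Hom C (src C z) H" "b \<in> Hom C X1 (src C z)" "z \<cdot> b = d1" "is_cokernel C b h"
    using P by (auto simp: presents_def)
  have "is_cokernel C b (t \<cdot> h)" using cokernel_isom[OF b(4) t(1) b(2,1) t(2)] .
  then show ?thesis using P b cmp_Hom[OF b(1) t(2)] by (auto simp: presents_def)
qed

text \<open>Zero objects fill position \<open>0\<close> of the shifted complexes, where every sequence has to be exact.\<close>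

lemma (in abelian_category) zero_ob_short_exact:
  assumes "is_zero_ob C x" "is_zero_ob C y" "is_zero_ob C z"
  shows "epic C (zro y z)" "is_kernel C (zro y z) (zro x y)"
proof -
  have ob: "x \<in> ob C" "y \<in> ob C" "z \<in> ob C" using assms by (auto simp: is_zero_ob_def)
  note h = zro_Hom[OF ob(2,3)] and k = zro_Hom[OF ob(1,2)]
  show "epic C (zro y z)"
    by (rule epic_zroI[OF h]) (use zero_obD(2)[OF assms(3)] zro_Hom Hom_ob in blast)
  have "monic C (zro x y)"
    by (rule monic_zroI[OF k]) (use zero_obD(1)[OF assms(1)] zro_Hom Hom_ob in blast)
  then show "is_kernel C (zro y z) (zro x y)"
  proof (rule kernelI[OF h k cmp_zro(1)[OF h ob(1)]])
    fix t g assume g: "g \<in> Hom C t y"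
    have z: "zro t x \<in> Hom C t x" using zro_Hom Hom_ob(1)[OF g] ob by blast
    have "zro x y \<cdot> zro t x = g" using zero_obD(1)[OF assms(2) cmp_Hom[OF z k] g] .
    then show "\<exists>h\<in>Hom C t x. zro x y \<cdot> h = g" using z by blast
  qed
qed

text \<open>The square of complexes belonging to a good cover, in terms of exact functors only:
  \<open>F1\<close>, \<open>F2\<close> push forward from the two pieces, and \<open>G\<close> from the intersection to the first piece. The
  intersection is pushed forward through the first piece, so that \<open>a1\<close> is the image of \<open>f\<close> under \<open>F1\<close>
  and the cokernel of \<open>a1\<close> is the image of the relative complex. The arrow \<open>a2\<close> compares the two ways
  around the square and is only given degreewise.\<close>

locale pushforward_square =
  D: abelian_category D + D1: abelian_category D1 + G: abelian_exact_functor D12 D1 G +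
  F1: abelian_exact_functor D1 D F1 + F2: abelian_exact_functor D2 D F2
  for D12 :: "('m, 'c, 'z) abcat_scheme" and D1 :: "('m1, 'c1, 'z1) abcat_scheme"
    and D2 :: "('m2, 'c2, 'z2) abcat_scheme" and D :: "('n, 'd, 'z3) abcat_scheme" and G F1 F2 +
  fixes M12 M1 M2 M and f b1 b2 and a2 :: "nat \<Rightarrow> 'd"
  assumes M12: "is_complex D12 M12" and M2: "is_complex D2 M2"
    and f: "f \<in> Hom (complexes D1) (on_ob (degreewise G) M12) M1" "monic (complexes D1) f"
    and b1: "b1 \<in> Hom (complexes D) (on_ob (degreewise F1) M1) M"
    and b2: "b2 \<in> Hom (complexes D) (on_ob (degreewise F2) M2) M" "monic (complexes D) b2"
    and a2: "\<And>i. a2 i \<in> Hom D (on_ob F1 (on_ob G (cell M12 i))) (on_ob F2 (cell M2 i))"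
      "\<And>i. on_ar F2 (bd M2 i) \<cdot>\<^bsub>D\<^esub> a2 (Suc i) = a2 i \<cdot>\<^bsub>D\<^esub> on_ar F1 (on_ar G (bd M12 i))"
    and square: "\<And>i. component b1 i \<cdot>\<^bsub>D\<^esub> on_ar F1 (component f i) = component b2 i \<cdot>\<^bsub>D\<^esub> a2 i"
begin

abbreviation cmp_D (infixr "\<bullet>" 70) where "\<beta> \<bullet> \<alpha> \<equiv> \<beta> \<cdot>\<^bsub>D\<^esub> \<alpha>"

abbreviation "q1 \<equiv> cokernel_of (complexes D1) f"
abbreviation "q2 \<equiv> cokernel_of (complexes D) b2"

lemma M1: "is_complex D1 M1" and M: "is_complex D M"
  using f b1 by (auto simp: complexes_Hom_iff)

lemma f_Hom: "component f i \<in> Hom D1 (on_ob G (cell M12 i)) (cell M1 i)"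
    "bd M1 i \<cdot>\<^bsub>D1\<^esub> component f (Suc i) = component f i \<cdot>\<^bsub>D1\<^esub> on_ar G (bd M12 i)"
  using f by (auto simp: complexes_Hom_iff)

lemma b1_Hom: "component b1 i \<in> Hom D (on_ob F1 (cell M1 i)) (cell M i)"
    "bd M i \<bullet> component b1 (Suc i) = component b1 i \<bullet> on_ar F1 (bd M1 i)"
  using b1 by (auto simp: complexes_Hom_iff)

lemma b2_Hom: "component b2 i \<in> Hom D (on_ob F2 (cell M2 i)) (cell M i)"
    "bd M i \<bullet> component b2 (Suc i) = component b2 i \<bullet> on_ar F2 (bd M2 i)"
  using b2 by (auto simp: complexes_Hom_iff)

lemma q1: "is_cokernel (complexes D1) f q1" "is_cokernel D1 (component f i) (component q1 i)"
    "component q1 i \<in> Hom D1 (cell M1 i) (cell (ctgt q1) i)"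
    "bd (ctgt q1) i \<cdot>\<^bsub>D1\<^esub> component q1 (Suc i) = component q1 i \<cdot>\<^bsub>D1\<^esub> bd M1 i"
    "is_complex D1 (ctgt q1)" "csrc q1 = M1"
proof -
  show c: "is_cokernel (complexes D1) f q1" using D1.cokernel_of_complexes[OF f(1)] .
  show "is_cokernel D1 (component f i) (component q1 i)" using D1.cokernel_component[OF f(1) c] .
  show "component q1 i \<in> Hom D1 (cell M1 i) (cell (ctgt q1) i)"
    "bd (ctgt q1) i \<cdot>\<^bsub>D1\<^esub> component q1 (Suc i) = component q1 i \<cdot>\<^bsub>D1\<^esub> bd M1 i"
    "is_complex D1 (ctgt q1)" "csrc q1 = M1"
    using D1.cokernel_complex_zro(1)[OF f(1) c] by (auto simp: complexes_Hom_iff)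
qed

lemma q2: "is_cokernel (complexes D) b2 q2" "is_cokernel D (component b2 i) (component q2 i)"
    "component q2 i \<in> Hom D (cell M i) (cell (ctgt q2) i)"
    "bd (ctgt q2) i \<bullet> component q2 (Suc i) = component q2 i \<bullet> bd M i"
    "is_complex D (ctgt q2)" "csrc q2 = M"
proof -
  show c: "is_cokernel (complexes D) b2 q2" using D.cokernel_of_complexes[OF b2(1)] .
  show "is_cokernel D (component b2 i) (component q2 i)" using D.cokernel_component[OF b2(1) c] .
  show "component q2 i \<in> Hom D (cell M i) (cell (ctgt q2) i)"
    "bd (ctgt q2) i \<bullet> component q2 (Suc i) = component q2 i \<bullet> bd M i"
    "is_complex D (ctgt q2)" "csrc q2 = M"
    using D.cokernel_complex_zro(1)[OF b2(1) c] by (auto simp: complexes_Hom_iff)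
qed

lemma F1q1: "is_cokernel D (on_ar F1 (component f i)) (on_ar F1 (component q1 i))"
    "on_ar F1 (component q1 i) \<in> Hom D (on_ob F1 (cell M1 i)) (on_ob F1 (cell (ctgt q1) i))"
    "on_ar F1 (component f i) \<in> Hom D (on_ob F1 (on_ob G (cell M12 i))) (on_ob F1 (cell M1 i))"
  using F1.F_cokernel[OF q1(2)] F1.F_Hom[OF q1(3)] F1.F_Hom[OF f_Hom(1)] by auto

text \<open>The canonical morphism from the pushforward of the relative complex of the first piece to that of
  the whole, described as in the definition of good covers.\<close>

definition excision :: "('n, 'd) cmap" where
  "excision = (THE \<epsilon>. \<epsilon> \<in> Hom (complexes D) (on_ob (degreewise F1) (ctgt q1)) (ctgt q2) \<and>
     \<epsilon> \<cdot>\<^bsub>complexes D\<^esub> on_ar (degreewise F1) q1 = q2 \<cdot>\<^bsub>complexes D\<^esub> b1)"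

text \<open>The composite of \<open>b1\<close> with the quotient map kills the image of \<open>f\<close>, since it equals \<open>b2\<close> after \<open>a2\<close>
  there. So it descends to the cokernel in each degree, and the descended arrows commute with the
  differentials because the quotient maps are epic.\<close>

lemma excision: "excision \<in> Hom (complexes D) (on_ob (degreewise F1) (ctgt q1)) (ctgt q2)"
    "component excision i \<bullet> on_ar F1 (component q1 i) = component q2 i \<bullet> component b1 i"
proof -
  let ?P = "\<lambda>\<epsilon>. \<epsilon> \<in> Hom (complexes D) (on_ob (degreewise F1) (ctgt q1)) (ctgt q2) \<and>
     \<epsilon> \<cdot>\<^bsub>complexes D\<^esub> on_ar (degreewise F1) q1 = q2 \<cdot>\<^bsub>complexes D\<^esub> b1"
  note qF = F1q1
  have ep: "epic D (on_ar F1 (component q1 j))" for j using D.cokernel_epic[OF qF(1)] .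
  have "\<exists>e \<in> Hom D (on_ob F1 (cell (ctgt q1) j)) (cell (ctgt q2) j).
      e \<bullet> on_ar F1 (component q1 j) = component q2 j \<bullet> component b1 j" for j
  proof -
    have "(component q2 j \<bullet> component b1 j) \<bullet> on_ar F1 (component f j)
        = (component q2 j \<bullet> component b2 j) \<bullet> a2 j"
      using D.cmp_assoc[OF qF(3) b1_Hom(1) q2(3)] D.cmp_assoc[OF a2(1) b2_Hom(1) q2(3)] square by simp
    also have "\<dots> = pzero D (on_ob F1 (on_ob G (cell M12 j))) (cell (ctgt q2) j)"
      using D.cokernel_Hom[OF q2(2) b2_Hom(1)] q2(3)[of j] D.cmp_zro(2)[OF a2(1)]
        D.Hom_ob[OF q2(3)] by (simp add: Hom_def)
    finally obtain e where "e \<in> Hom D (tgt D (on_ar F1 (component q1 j))) (cell (ctgt q2) j)"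
        "e \<bullet> on_ar F1 (component q1 j) = component q2 j \<bullet> component b1 j"
      using D.cokernel_desc[OF qF(1) qF(3) D.cmp_Hom[OF b1_Hom(1) q2(3)]] by blast
    then show ?thesis using qF(2)[of j] by (auto simp: Hom_def)
  qed
  then obtain e where e: "\<And>j. e j \<in> Hom D (on_ob F1 (cell (ctgt q1) j)) (cell (ctgt q2) j)"
      "\<And>j. e j \<bullet> on_ar F1 (component q1 j) = component q2 j \<bullet> component b1 j" by metis
  note R1 = D1.complex_Hom[OF q1(5)] and R2 = D.complex_Hom[OF q2(5)]
  note dR1 = F1.F_Hom[OF R1(1)]
  note dM1 = F1.F_Hom[OF D1.complex_Hom(1)[OF M1]] and dM = D.complex_Hom(1)[OF M]
  have Fq: "on_ar F1 (bd (ctgt q1) j) \<bullet> on_ar F1 (component q1 (Suc j))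
      = on_ar F1 (component q1 j) \<bullet> on_ar F1 (bd M1 j)" for j
    using F1.on_cmp[OF q1(3) R1(1)] F1.on_cmp[OF D1.complex_Hom(1)[OF M1] q1(3)] q1(4) by simp
  have "bd (ctgt q2) j \<bullet> e (Suc j) = e j \<bullet> on_ar F1 (bd (ctgt q1) j)" for j
  proof (rule D.epicD[OF ep qF(2) D.cmp_Hom[OF e(1) R2(1)] D.cmp_Hom[OF dR1 e(1)]])
    have "(bd (ctgt q2) j \<bullet> e (Suc j)) \<bullet> on_ar F1 (component q1 (Suc j))
        = (component q2 j \<bullet> bd M j) \<bullet> component b1 (Suc j)"
      using D.cmp_assoc[OF qF(2) e(1) R2(1)] e(2) D.cmp_assoc[OF b1_Hom(1) q2(3) R2(1)] q2(4) by simp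
    also have "\<dots> = (component q2 j \<bullet> component b1 j) \<bullet> on_ar F1 (bd M1 j)"
      using D.cmp_assoc[OF b1_Hom(1) dM q2(3)] b1_Hom(2) D.cmp_assoc[OF dM1 b1_Hom(1) q2(3)] by simp
    also have "\<dots> = (e j \<bullet> on_ar F1 (bd (ctgt q1) j)) \<bullet> on_ar F1 (component q1 (Suc j))"
      using D.cmp_assoc[OF dM1 qF(2) e(1)] e(2) D.cmp_assoc[OF qF(2) dR1 e(1)] Fq by simp
    finally show "(bd (ctgt q2) j \<bullet> e (Suc j)) \<bullet> on_ar F1 (component q1 (Suc j))
        = (e j \<bullet> on_ar F1 (bd (ctgt q1) j)) \<bullet> on_ar F1 (component q1 (Suc j))" .
  qed
  then have "?P (CMap (on_ob (degreewise F1) (ctgt q1)) (ctgt q2) e)"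
    using e F1.F_complex[OF q1(5)] q2(5) b1
    by (auto simp: complexes_Hom_iff q1(6) intro!: cmap_eqI)
  moreover have "\<epsilon> = CMap (on_ob (degreewise F1) (ctgt q1)) (ctgt q2) e" if \<epsilon>: "?P \<epsilon>" for \<epsilon>
  proof (rule cmap_eqI)
    fix j
    have "component \<epsilon> j \<in> Hom D (on_ob F1 (cell (ctgt q1) j)) (cell (ctgt q2) j)"
      using \<epsilon> by (auto simp: complexes_Hom_iff)
    moreover have "\<epsilon> \<cdot>\<^bsub>complexes D\<^esub> on_ar (degreewise F1) q1 = q2 \<cdot>\<^bsub>complexes D\<^esub> b1" using \<epsilon> by simp
    from arg_cong[OF this, of "\<lambda>\<psi>. component \<psi> j"]
    have "component \<epsilon> j \<bullet> on_ar F1 (component q1 j) = e j \<bullet> on_ar F1 (component q1 j)"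
      using e(2) by simp
    ultimately show "component \<epsilon> j = component (CMap (on_ob (degreewise F1) (ctgt q1)) (ctgt q2) e) j"
      using D.epicD[OF ep qF(2) _ e(1)] by simp
  qed (use \<epsilon> in \<open>auto simp: complexes_Hom_iff\<close>)
  ultimately have "?P excision" unfolding excision_def by (rule theI)
  then have *: "?P excision" .
  then show "excision \<in> Hom (complexes D) (on_ob (degreewise F1) (ctgt q1)) (ctgt q2)" by simp
  have "excision \<cdot>\<^bsub>complexes D\<^esub> on_ar (degreewise F1) q1 = q2 \<cdot>\<^bsub>complexes D\<^esub> b1" using * by simp
  from arg_cong[OF this, of "\<lambda>\<psi>. component \<psi> i"]
  show "component excision i \<bullet> on_ar F1 (component q1 i) = component q2 i \<bullet> component b1 i" by simp
qed

text \<open>The complexes are completed by zero objects in position \<open>0\<close> and the chain maps by zero arrows. The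
  isomorphisms \<open>\<theta>\<close> replace the homology of the intersection by any isomorphic objects \<open>K\<close>.\<close>

theorem mayer_vietoris:
  assumes iso: "\<And>i. isom D (induced_on_homology D1 D F1 (ctgt q1) excision i)"
    and \<theta>: "\<And>i. isom D (\<theta> i)" "\<And>i. \<theta> i \<in> Hom D (on_ob F1 (on_ob G (homology D12 M12 i))) (K i)"
    and bip: "\<And>i. is_biproduct D (on_ob F1 (homology D1 M1 i)) (on_ob F2 (homology D2 M2 i))
      (S i) (\<iota>1 i) (\<iota>2 i) (\<pi>1 i) (\<pi>2 i)"
  obtains \<delta> \<alpha> \<beta> where
    "\<And>i. \<delta> i \<in> Hom D (homology D M (Suc i)) (K i)" "\<And>i. \<alpha> i \<in> Hom D (K i) (S i)"
    "\<And>i. \<beta> i \<in> Hom D (S i) (homology D M i)"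
    "\<And>i. exact_at D (\<beta> (Suc i)) (\<delta> i)" "\<And>i. exact_at D (\<delta> i) (\<alpha> i)"
    "\<And>i. exact_at D (\<alpha> i) (\<beta> i)" "exact_at D (\<beta> 0) (pzero D (homology D M 0) (zero_ob D))"
proof -
  note T = D.presents_homology
  define P12 where "P12 i = on_ob F1 (on_ob G (shifted D12 M12 i))" for i
  define d12 where "d12 i = on_ar F1 (on_ar G (out_bd D12 M12 i))" for i
  define P1 where "P1 i = on_ob F1 (shifted D1 M1 i)" for i
  define d1 where "d1 i = on_ar F1 (out_bd D1 M1 i)" for i
  define P2 where "P2 i = on_ob F2 (shifted D2 M2 i)" for i
  define d2 where "d2 i = on_ar F2 (out_bd D2 M2 i)" for i
  define N where "N i = shifted D M i" for i
  define dN where "dN i = out_bd D M i" for i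
  define R1 where "R1 i = on_ob F1 (shifted D1 (ctgt q1) i)" for i
  define e1 where "e1 i = on_ar F1 (out_bd D1 (ctgt q1) i)" for i
  define R2 where "R2 i = shifted D (ctgt q2) i" for i
  define e2 where "e2 i = out_bd D (ctgt q2) i" for i
  note defs = P12_def d12_def P1_def d1_def P2_def d2_def N_def dN_def R1_def e1_def R2_def e2_def
  \<comment> \<open>The images of the chosen homology objects serve as homology of the pushed forward complexes.\<close>
  have pres1: "D.presents (P1 (Suc (Suc i))) (P1 (Suc i)) (P1 i) (on_ob F1 (homology D1 M1 i)) (d1 (Suc i)) (d1 i)
      (on_ar F1 (cycle_incl D1 M1 i)) (on_ar F1 (homology_proj D1 M1 i))" for i
    unfolding defs using F1.F_presents[OF D1.presents_homology[OF M1]] .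
  have presR1: "D.presents (R1 (Suc (Suc i))) (R1 (Suc i)) (R1 i) (on_ob F1 (homology D1 (ctgt q1) i)) (e1 (Suc i)) (e1 i)
      (on_ar F1 (cycle_incl D1 (ctgt q1) i)) (on_ar F1 (homology_proj D1 (ctgt q1) i))" for i
    unfolding defs using F1.F_presents[OF D1.presents_homology[OF q1(5)]] .
  have pres2: "D.presents (P2 (Suc (Suc i))) (P2 (Suc i)) (P2 i) (on_ob F2 (homology D2 M2 i)) (d2 (Suc i)) (d2 i)
      (on_ar F2 (cycle_incl D2 M2 i)) (on_ar F2 (homology_proj D2 M2 i))" for i
    unfolding defs using F2.F_presents[OF F2.source.presents_homology[OF M2]] .
  have presN: "D.presents (N (Suc (Suc i))) (N (Suc i)) (N i) (homology D M i) (dN (Suc i)) (dN i)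
      (cycle_incl D M i) (homology_proj D M i)" for i
    unfolding defs using T[OF M] .
  have presR2: "D.presents (R2 (Suc (Suc i))) (R2 (Suc i)) (R2 i) (homology D (ctgt q2) i) (e2 (Suc i)) (e2 i)
      (cycle_incl D (ctgt q2) i) (homology_proj D (ctgt q2) i)" for i
    unfolding defs using T[OF q2(5)] .
  have pres12: "D.presents (P12 (Suc (Suc i))) (P12 (Suc i)) (P12 i) (K i) (d12 (Suc i)) (d12 i)
      (on_ar F1 (on_ar G (cycle_incl D12 M12 i))) (\<theta> i \<bullet> on_ar F1 (on_ar G (homology_proj D12 M12 i)))" for i
    unfolding defs
    using D.presents_isom[OF F1.F_presents[OF G.F_presents[OF G.source.presents_homology[OF M12]]] \<theta>] .
  have zero: "is_zero_ob D (P12 0)" "is_zero_ob D (P1 0)" "is_zero_ob D (P2 0)" "is_zero_ob D (N 0)"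
      "is_zero_ob D (R1 0)" "is_zero_ob D (R2 0)"
    unfolding defs
    using F1.F_zero_ob G.F_zero_ob F2.F_zero_ob G.source.zero_ob D1.zero_ob F2.source.zero_ob D.zero_ob
    by auto
  have zob: "P12 0 \<in> ob D" "P1 0 \<in> ob D" "P2 0 \<in> ob D" "N 0 \<in> ob D" "R1 0 \<in> ob D" "R2 0 \<in> ob D"
    using zero by (auto simp: is_zero_ob_def)
  \<comment> \<open>Extension of a chain map to the shifted complexes.\<close>
  define ext where "ext x y \<phi> i = (case i of 0 \<Rightarrow> pzero D x y | Suc j \<Rightarrow> \<phi> j)" for x y \<phi> and i :: nat
  have ext_Hom: "ext (X 0) (Y 0) \<phi> i \<in> Hom D (X i) (Y i)"
    if "X 0 \<in> ob D" "Y 0 \<in> ob D" "\<And>j. \<phi> j \<in> Hom D (X (Suc j)) (Y (Suc j))" for X Y \<phi> i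
    using that D.zro_Hom by (cases i) (auto simp: ext_def)
  have ext_chain: "d' i \<bullet> ext (X 0) (Y 0) \<phi> (Suc i) = ext (X 0) (Y 0) \<phi> i \<bullet> d i"
    if "is_zero_ob D (X 0)" "is_zero_ob D (Y 0)" "\<And>j. \<phi> j \<in> Hom D (X (Suc j)) (Y (Suc j))"
      "\<And>j. d' (Suc j) \<bullet> \<phi> (Suc j) = \<phi> j \<bullet> d (Suc j)"
      "\<And>i. d i \<in> Hom D (X (Suc i)) (X i)" "\<And>i. d' i \<in> Hom D (Y (Suc i)) (Y i)" for X Y \<phi> i d d'
  proof (cases i)
    case 0
    have ob: "X 0 \<in> ob D" "Y 0 \<in> ob D" using that(1,2) by (auto simp: is_zero_ob_def)
    show ?thesis unfolding 0
      using D.zero_obD(1)[OF that(2) D.cmp_Hom[OF ext_Hom[OF ob that(3)] that(6)]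
          D.cmp_Hom[OF that(5) ext_Hom[OF ob that(3)]]] by simp
  qed (use that in \<open>simp add: ext_def\<close>)
  note bdH = D.presents_bd(2)
  note dH = bdH[OF pres12] bdH[OF pres1] bdH[OF pres2] bdH[OF presN] bdH[OF presR1] bdH[OF presR2]
  define A1 where "A1 = ext (P12 0) (P1 0) (\<lambda>j. on_ar F1 (component f j))"
  define A2 where "A2 = ext (P12 0) (P2 0) a2"
  define B1 where "B1 = ext (P1 0) (N 0) (component b1)"
  define B2 where "B2 = ext (P2 0) (N 0) (component b2)"
  define Q1 where "Q1 = ext (P1 0) (R1 0) (\<lambda>j. on_ar F1 (component q1 j))"
  define Q2 where "Q2 = ext (N 0) (R2 0) (component q2)"
  define E where "E = ext (R1 0) (R2 0) (component excision)"
  note arrow_defs = A1_def A2_def B1_def B2_def Q1_def Q2_def E_def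
  have eps: "component excision j \<in> Hom D (on_ob F1 (cell (ctgt q1) j)) (cell (ctgt q2) j)"
      "bd (ctgt q2) j \<bullet> component excision (Suc j) = component excision j \<bullet> on_ar F1 (bd (ctgt q1) j)" for j
    using excision(1) by (auto simp: complexes_Hom_iff)
  have F1f: "on_ar F1 (bd M1 j) \<bullet> on_ar F1 (component f (Suc j))
      = on_ar F1 (component f j) \<bullet> on_ar F1 (on_ar G (bd M12 j))" for j
    using F1.on_cmp[OF f_Hom(1) D1.complex_Hom(1)[OF M1]]
      F1.on_cmp[OF G.F_Hom[OF G.source.complex_Hom(1)[OF M12]] f_Hom(1)] f_Hom(2) by simp
  have F1q: "on_ar F1 (bd (ctgt q1) j) \<bullet> on_ar F1 (component q1 (Suc j))
      = on_ar F1 (component q1 j) \<bullet> on_ar F1 (bd M1 j)" for j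
    using F1.on_cmp[OF q1(3) D1.complex_Hom(1)[OF q1(5)]]
      F1.on_cmp[OF D1.complex_Hom(1)[OF M1] q1(3)] q1(4) by simp
  have bS: "d12 (Suc j) = on_ar F1 (on_ar G (bd M12 j))" "d1 (Suc j) = on_ar F1 (bd M1 j)"
      "d2 (Suc j) = on_ar F2 (bd M2 j)" "dN (Suc j) = bd M j" "e1 (Suc j) = on_ar F1 (bd (ctgt q1) j)"
      "e2 (Suc j) = bd (ctgt q2) j" for j
    unfolding defs by (simp_all add: out_bd_def)
  have oS: "P12 (Suc j) = on_ob F1 (on_ob G (cell M12 j))" "P1 (Suc j) = on_ob F1 (cell M1 j)"
      "P2 (Suc j) = on_ob F2 (cell M2 j)" "N (Suc j) = cell M j" "R1 (Suc j) = on_ob F1 (cell (ctgt q1) j)"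
      "R2 (Suc j) = cell (ctgt q2) j" for j
    unfolding defs by simp_all
  have A1: "A1 i \<in> Hom D (P12 i) (P1 i)" "d1 i \<bullet> A1 (Suc i) = A1 i \<bullet> d12 i" for i
    unfolding arrow_defs
    by (rule ext_Hom; use zob F1q1(3) in \<open>simp add: oS\<close>)
      (rule ext_chain; use zero F1q1(3) F1f dH in \<open>simp add: oS bS\<close>)
  have A2: "A2 i \<in> Hom D (P12 i) (P2 i)" "d2 i \<bullet> A2 (Suc i) = A2 i \<bullet> d12 i" for i
    unfolding arrow_defs
    by (rule ext_Hom; use zob a2 in \<open>simp add: oS\<close>) (rule ext_chain; use zero a2 dH in \<open>simp add: oS bS\<close>)
  have B1: "B1 i \<in> Hom D (P1 i) (N i)" "dN i \<bullet> B1 (Suc i) = B1 i \<bullet> d1 i" for i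
    unfolding arrow_defs
    by (rule ext_Hom; use zob b1_Hom in \<open>simp add: oS\<close>) (rule ext_chain; use zero b1_Hom dH in \<open>simp add: oS bS\<close>)
  have B2: "B2 i \<in> Hom D (P2 i) (N i)" "dN i \<bullet> B2 (Suc i) = B2 i \<bullet> d2 i" for i
    unfolding arrow_defs
    by (rule ext_Hom; use zob b2_Hom in \<open>simp add: oS\<close>) (rule ext_chain; use zero b2_Hom dH in \<open>simp add: oS bS\<close>)
  have Q1: "Q1 i \<in> Hom D (P1 i) (R1 i)" "e1 i \<bullet> Q1 (Suc i) = Q1 i \<bullet> d1 i" for i
    unfolding arrow_defs
    by (rule ext_Hom; use zob F1q1(2) in \<open>simp add: oS\<close>) (rule ext_chain; use zero F1q1(2) F1q dH in \<open>simp add: oS bS\<close>)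
  have Q2: "Q2 i \<in> Hom D (N i) (R2 i)" "e2 i \<bullet> Q2 (Suc i) = Q2 i \<bullet> dN i" for i
    unfolding arrow_defs
    by (rule ext_Hom; use zob q2(3) in \<open>simp add: oS\<close>) (rule ext_chain; use zero q2(3,4) dH in \<open>simp add: oS bS\<close>)
  have E: "E i \<in> Hom D (R1 i) (R2 i)" "e2 i \<bullet> E (Suc i) = E i \<bullet> e1 i" for i
    unfolding arrow_defs
    by (rule ext_Hom; use zob eps in \<open>simp add: oS\<close>) (rule ext_chain; use zero eps dH in \<open>simp add: oS bS\<close>)
  have sq: "B1 i \<bullet> A1 i = B2 i \<bullet> A2 i" for i
  proof (cases i)
    case 0 then show ?thesis
      using D.zero_obD(2)[OF zero(1) D.cmp_Hom[OF A1(1) B1(1)] D.cmp_Hom[OF A2(1) B2(1)]] by simp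
  qed (use square in \<open>simp add: arrow_defs ext_def\<close>)
  have Esq: "E i \<bullet> Q1 i = Q2 i \<bullet> B1 i" for i
  proof (cases i)
    case 0 then show ?thesis
      using D.zero_obD(2)[OF zero(2) D.cmp_Hom[OF Q1(1) E(1)] D.cmp_Hom[OF B1(1) Q2(1)]] by simp
  qed (use excision(2) in \<open>simp add: arrow_defs ext_def\<close>)
  have b2m: "monic D (component b2 j)" for j using D.monic_component[OF b2] .
  have fm: "monic D1 (component f j)" for j using D1.monic_component[OF f] .
  have Q1e: "epic D (Q1 i)" "is_kernel D (Q1 i) (A1 i)" for i
    unfolding arrow_defs ext_def
    using D.zero_ob_short_exact[OF zero(1,2,5)] D.cokernel_epic[OF F1q1(1)]
      D.monic_kernel_of_cokernel[OF F1.F_monic[OF fm] F1q1(1)] by (auto split: nat.split)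
  have Q2e: "epic D (Q2 i)" "is_kernel D (Q2 i) (B2 i)" for i
    unfolding arrow_defs ext_def
    using D.zero_ob_short_exact[OF zero(3,4,6)] D.cokernel_epic[OF q2(2)]
      D.monic_kernel_of_cokernel[OF b2m q2(2)] by (auto split: nat.split)
  \<comment> \<open>The arrow which is an isomorphism by excision is the one induced by \<open>E\<close> on the presentations.\<close>
  have ctE: "ctgt excision = ctgt q2" using excision(1) by (simp add: complexes_Hom_iff)
  have "\<exists>u. u \<in> Hom D (src D (on_ar F1 (cycle_incl D1 (ctgt q1) i))) (src D (cycle_incl D (ctgt q2) i)) \<and>
      cycle_incl D (ctgt q2) i \<bullet> u = E (Suc i) \<bullet> on_ar F1 (cycle_incl D1 (ctgt q1) i) \<and>
      induced_on_homology D1 D F1 (ctgt q1) excision i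
        \<in> Hom D (on_ob F1 (homology D1 (ctgt q1) i)) (homology D (ctgt q2) i) \<and>
      induced_on_homology D1 D F1 (ctgt q1) excision i \<bullet> on_ar F1 (homology_proj D1 (ctgt q1) i)
        = homology_proj D (ctgt q2) i \<bullet> u" for i
  proof -
    obtain u g where u: "u \<in> Hom D (src D (on_ar F1 (cycle_incl D1 (ctgt q1) i))) (src D (cycle_incl D (ctgt q2) i))"
        "cycle_incl D (ctgt q2) i \<bullet> u = E (Suc i) \<bullet> on_ar F1 (cycle_incl D1 (ctgt q1) i)"
      and g: "g \<in> Hom D (on_ob F1 (homology D1 (ctgt q1) i)) (homology D (ctgt q2) i)"
        "g \<bullet> on_ar F1 (homology_proj D1 (ctgt q1) i) = homology_proj D (ctgt q2) i \<bullet> u"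
      using D.induced_arrow[OF presR1 presR2 E(1) E(1) E(1) E(2) E(2)] by metis
    have z1: "cycle_incl D1 (ctgt q1) i \<in> Hom D1 (src D1 (cycle_incl D1 (ctgt q1) i)) (cell (ctgt q1) i)"
      using D1.presents_homology[OF q1(5), of i] D1.kernel_Hom(1)
      by (auto simp: D1.presents_def)
    have sz: "src D (on_ar F1 (cycle_incl D1 (ctgt q1) i)) = on_ob F1 (src D1 (cycle_incl D1 (ctgt q1) i))"
      using F1.F_Hom[OF z1] by (simp add: Hom_def)
    have k2: "is_kernel D (e2 i) (cycle_incl D (ctgt q2) i)" using presR2[of i] by (simp add: D.presents_def)
    have z2: "monic D (cycle_incl D (ctgt q2) i)"
        "cycle_incl D (ctgt q2) i \<in> Hom D (src D (cycle_incl D (ctgt q2) i)) (cell (ctgt q2) i)"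
      using D.kernel_monic[OF k2] D.kernel_Hom(1)[OF k2 dH(6)] by (simp_all add: oS)
    have ES: "E (Suc i) = component excision i" by (simp add: E_def ext_def)
    have "induced_on_cycles D1 D F1 (ctgt q1) excision i = u"
      unfolding induced_on_cycles_def ctE
      by (rule the_equality) (use u sz ES D.monicD[OF z2] in auto)
    moreover have h1: "epic D (on_ar F1 (homology_proj D1 (ctgt q1) i))"
        "on_ar F1 (homology_proj D1 (ctgt q1) i) \<in> Hom D (src D (on_ar F1 (cycle_incl D1 (ctgt q1) i))) (on_ob F1 (homology D1 (ctgt q1) i))"
      using presR1[of i] D.cokernel_epic by (auto simp: D.presents_def)
    moreover have "h = g" if "h \<in> Hom D (on_ob F1 (homology D1 (ctgt q1) i)) (homology D (ctgt q2) i)"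
        "h \<bullet> on_ar F1 (homology_proj D1 (ctgt q1) i) = homology_proj D (ctgt q2) i \<bullet> u" for h
      using D.epicD[OF h1 that(1) g(1)] that(2) g(2) by simp
    ultimately have "induced_on_homology D1 D F1 (ctgt q1) excision i = g"
      unfolding induced_on_homology_def ctE by (intro the_equality) (simp_all add: g)
    then show ?thesis using u g by blast
  qed
  then obtain u where u: "\<And>i. u i \<in> Hom D (src D (on_ar F1 (cycle_incl D1 (ctgt q1) i))) (src D (cycle_incl D (ctgt q2) i))"
      "\<And>i. cycle_incl D (ctgt q2) i \<bullet> u i = E (Suc i) \<bullet> on_ar F1 (cycle_incl D1 (ctgt q1) i)"
      "\<And>i. induced_on_homology D1 D F1 (ctgt q1) excision i
        \<in> Hom D (on_ob F1 (homology D1 (ctgt q1) i)) (homology D (ctgt q2) i)"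
      "\<And>i. induced_on_homology D1 D F1 (ctgt q1) excision i \<bullet> on_ar F1 (homology_proj D1 (ctgt q1) i)
        = homology_proj D (ctgt q2) i \<bullet> u i"
    by metis
  have mono: "monic D (A1 i)" "monic D (B2 i)" for i
    using D.kernel_monic Q1e(2) Q2e(2) by blast+
  interpret excision_square D P12 P1 P2 N K "\<lambda>i. on_ob F1 (homology D1 M1 i)" "\<lambda>i. on_ob F2 (homology D2 M2 i)"
    "homology D M" d12 d1 d2 dN "\<lambda>i. on_ar F1 (on_ar G (cycle_incl D12 M12 i))"
    "\<lambda>i. \<theta> i \<bullet> on_ar F1 (on_ar G (homology_proj D12 M12 i))"
    "\<lambda>i. on_ar F1 (cycle_incl D1 M1 i)" "\<lambda>i. on_ar F1 (homology_proj D1 M1 i)"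
    "\<lambda>i. on_ar F2 (cycle_incl D2 M2 i)" "\<lambda>i. on_ar F2 (homology_proj D2 M2 i)"
    "cycle_incl D M" "homology_proj D M" A1 A2 B1 B2
    R1 R2 "\<lambda>i. on_ob F1 (homology D1 (ctgt q1) i)" "homology D (ctgt q2)" e1 e2
    "\<lambda>i. on_ar F1 (cycle_incl D1 (ctgt q1) i)" "\<lambda>i. on_ar F1 (homology_proj D1 (ctgt q1) i)"
    "cycle_incl D (ctgt q2)" "homology_proj D (ctgt q2)" Q1 Q2 E u "induced_on_homology D1 D F1 (ctgt q1) excision"
    by unfold_locales (fact pres12 pres1 pres2 presN presR1 presR2 A1 A2 B1 B2 mono Q1 Q2 E sq Esq Q1e Q2e u iso)+
  show ?thesis
  proof (rule long_exact_sequence[OF bip], goal_cases)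
    case (1 \<delta> \<alpha> \<beta>)
    show ?case by (rule that[OF 1(1-6) 1(7)[OF D.zero_ob zero(2,3,4)]])
  qed
qed

end


section \<open>Extension along vertical arrows\<close>

lemma local_ab_simps [simp]:
  "ob (local_ab A a b) = {N \<in> ob (horz A). Lo A N = a \<and> Ro A N = b}"
  "ar (local_ab A a b) = {\<alpha> \<in> ar (horz A). La A \<alpha> = idt (vert A) a \<and> Ra A \<alpha> = idt (vert A) b}"
  "src (local_ab A a b) = src (horz A)" "tgt (local_ab A a b) = tgt (horz A)"
  "idt (local_ab A a b) = idt (horz A)" "cmp (local_ab A a b) = cmp (horz A)"
  by (simp_all add: local_ab_def local_cat_def cat.defs abcat.defs)

lemma local_ab_Hom:
  "\<alpha> \<in> Hom (local_ab A a b) M N \<longleftrightarrow>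
     \<alpha> \<in> Hom (horz A) M N \<and> La A \<alpha> = idt (vert A) a \<and> Ra A \<alpha> = idt (vert A) b"
  by (auto simp: Hom_def)

lemma local_cat_Hom: "Hom (local_cat A a b) M N = Hom (local_ab A a b) M N"
  by (auto simp: Hom_def local_cat_def)

locale framed_with_lifts = abelian_framed_bicategory A
  for A :: "('o, 'v, 'm, 'c) ab_dblcat" and \<kappa> :: "'v \<Rightarrow> 'v \<Rightarrow> 'm \<Rightarrow> 'c" +
  assumes choice: "cocartesian_choice A \<kappa>"
begin

sublocale L: cat_functor "horz A" "vert A" "leftf A"
  by (rule left_functor)

sublocale R: cat_functor "horz A" "vert A" "rightf A"
  by (rule right_functor)

abbreviation hcmp (infixr "\<bullet>" 70) where "\<beta> \<bullet> \<alpha> \<equiv> \<beta> \<cdot>\<^bsub>horz A\<^esub> \<alpha>"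

abbreviation loc where "loc f g \<equiv> local_ab A (tgt (vert A) f) (tgt (vert A) g)"

text \<open>The universal property of cocartesian arrows, tested against globular arrows only. It
  determines the arrows out of the target within the local category of the target.\<close>

definition universal :: "'v \<Rightarrow> 'v \<Rightarrow> 'm \<Rightarrow> 'c \<Rightarrow> bool" where
  "universal f g N e \<longleftrightarrow> e \<in> Hom (horz A) N (tgt (horz A) e) \<and> La A e = f \<and> Ra A e = g \<and>
     (\<forall>Q. \<forall>\<psi> \<in> Hom (horz A) N Q. La A \<psi> = f \<longrightarrow> Ra A \<psi> = g \<longrightarrow>
       (\<exists>!\<chi>. \<chi> \<in> Hom (loc f g) (tgt (horz A) e) Q \<and> \<chi> \<bullet> e = \<psi>))"

lemma universal_ex:
  assumes "universal f g N e" "\<psi> \<in> Hom (horz A) N Q" "La A \<psi> = f" "Ra A \<psi> = g"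
  obtains \<chi> where "\<chi> \<in> Hom (loc f g) (tgt (horz A) e) Q" "\<chi> \<bullet> e = \<psi>"
  using assms unfolding universal_def by blast

lemma globular_cmp:
  assumes "e \<in> Hom (horz A) N P" "\<chi> \<in> Hom (loc (La A e) (Ra A e)) P Q"
  shows "\<chi> \<bullet> e \<in> Hom (horz A) N Q" "La A (\<chi> \<bullet> e) = La A e" "Ra A (\<chi> \<bullet> e) = Ra A e"
proof -
  have c: "\<chi> \<in> Hom (horz A) P Q" "La A \<chi> = idt (vert A) (tgt (vert A) (La A e))"
      "Ra A \<chi> = idt (vert A) (tgt (vert A) (Ra A e))"
    using assms(2) by (auto simp: local_ab_Hom)
  show "\<chi> \<bullet> e \<in> Hom (horz A) N Q" using L.source.cmp_Hom assms(1) c by blast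
  show "La A (\<chi> \<bullet> e) = La A e" "Ra A (\<chi> \<bullet> e) = Ra A e"
    using L.on_cmp[OF assms(1) c(1)] R.on_cmp[OF assms(1) c(1)] L.on_ar[OF assms(1)] R.on_ar[OF assms(1)]
      L.target.idt_left[of "La A e"] L.target.idt_left[of "Ra A e"] c by (auto simp: Hom_def)
qed

lemma universal_unique:
  assumes u: "universal f g N e" and c: "\<chi> \<in> Hom (loc f g) (tgt (horz A) e) Q" "\<chi>' \<in> Hom (loc f g) (tgt (horz A) e) Q"
    and eq: "\<chi> \<bullet> e = \<chi>' \<bullet> e"
  shows "\<chi> = \<chi>'"
proof -
  have e: "e \<in> Hom (horz A) N (tgt (horz A) e)" "La A e = f" "Ra A e = g"
    using u by (auto simp: universal_def)
  have "\<chi> \<bullet> e \<in> Hom (horz A) N Q" "La A (\<chi> \<bullet> e) = f" "Ra A (\<chi> \<bullet> e) = g"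
    using globular_cmp[OF e(1)] c(1) e(2,3) by auto
  then have "\<exists>!\<xi>. \<xi> \<in> Hom (loc f g) (tgt (horz A) e) Q \<and> \<xi> \<bullet> e = \<chi> \<bullet> e"
    using u unfolding universal_def by blast
  then show ?thesis using c eq by metis
qed

lemma universal_isom:
  assumes e: "universal f g N e" and e': "universal f g N e'"
  obtains t where "t \<in> Hom (loc f g) (tgt (horz A) e) (tgt (horz A) e')" "isom (loc f g) t"
proof -
  have h: "e \<in> Hom (horz A) N (tgt (horz A) e)" "La A e = f" "Ra A e = g"
     "e' \<in> Hom (horz A) N (tgt (horz A) e')" "La A e' = f" "Ra A e' = g"
    using e e' by (auto simp: universal_def)
  obtain t where t: "t \<in> Hom (loc f g) (tgt (horz A) e) (tgt (horz A) e')" "t \<bullet> e = e'"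
    using universal_ex[OF e h(4-6)] .
  obtain s where s: "s \<in> Hom (loc f g) (tgt (horz A) e') (tgt (horz A) e)" "s \<bullet> e' = e"
    using universal_ex[OF e' h(1-3)] .
  have th: "t \<in> Hom (horz A) (tgt (horz A) e) (tgt (horz A) e')"
    and sh: "s \<in> Hom (horz A) (tgt (horz A) e') (tgt (horz A) e)"
    using t s by (auto simp: local_ab_Hom)
  have fg: "f \<in> ar (vert A)" "g \<in> ar (vert A)" using L.on_ar[OF h(1)] R.on_ar[OF h(1)] h by (auto simp: Hom_def)
  interpret V: abelian_category "loc f g"
    using local_abelian L.target.tgt_ob fg by blast
  have id: "idt (horz A) (tgt (horz A) e) \<in> Hom (loc f g) (tgt (horz A) e) (tgt (horz A) e)"
      "idt (horz A) (tgt (horz A) e') \<in> Hom (loc f g) (tgt (horz A) e') (tgt (horz A) e')"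
    using V.idt_Hom V.Hom_ob[OF t(1)] by auto
  have "s \<bullet> t = idt (horz A) (tgt (horz A) e)"
    by (rule universal_unique[OF e _ id(1)])
      (use V.cmp_Hom[OF t(1) s(1)] L.source.cmp_assoc[OF h(1) th sh] t s L.source.idt_left[OF h(1)] in simp_all)
  moreover have "t \<bullet> s = idt (horz A) (tgt (horz A) e')"
    by (rule universal_unique[OF e' _ id(2)])
      (use V.cmp_Hom[OF s(1) t(1)] L.source.cmp_assoc[OF h(4) sh th] t s L.source.idt_left[OF h(4)] in simp_all)
  ultimately have "isom (loc f g) t"
    unfolding isom_def using t(1) s(1) th by (auto simp: Hom_def)
  then show ?thesis using that t by blast
qed

context
  fixes f g N
  assumes fg: "f \<in> ar (vert A)" "g \<in> ar (vert A)" and N: "N \<in> ob (horz A)" "Lo A N = src (vert A) f" "Ro A N = src (vert A) g"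
begin

lemma lift_Hom: "\<kappa> f g N \<in> Hom (horz A) N (tgt (horz A) (\<kappa> f g N))" "La A (\<kappa> f g N) = f" "Ra A (\<kappa> f g N) = g"
    "tgt (horz A) (\<kappa> f g N) \<in> ob (loc f g)"
proof -
  have "cocartesian (horz A) (prod_cat (vert A) (vert A)) (pairing (leftf A) (rightf A)) (\<kappa> f g N) \<and>
        src (horz A) (\<kappa> f g N) = N \<and> La A (\<kappa> f g N) = f \<and> Ra A (\<kappa> f g N) = g"
    using choice fg N unfolding cocartesian_choice_def by blast
  then show *: "\<kappa> f g N \<in> Hom (horz A) N (tgt (horz A) (\<kappa> f g N))" "La A (\<kappa> f g N) = f" "Ra A (\<kappa> f g N) = g"
    by (auto simp: cocartesian_def Hom_def)
  show "tgt (horz A) (\<kappa> f g N) \<in> ob (loc f g)"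
    using L.on_ar[OF *(1)] R.on_ar[OF *(1)] L.source.Hom_ob[OF *(1)] *(2,3) by (auto simp: Hom_def)
qed

text \<open>The cocartesian property for arrows lying over a composite, with the product category and the
  pairing of \<open>L\<close> and \<open>R\<close> unfolded.\<close>

lemma lift_universal:
  assumes \<psi>: "\<psi> \<in> Hom (horz A) N Q" and u: "u \<in> Hom (vert A) (tgt (vert A) f) (Lo A Q)"
    and v: "v \<in> Hom (vert A) (tgt (vert A) g) (Ro A Q)"
    and over: "La A \<psi> = u \<cdot>\<^bsub>vert A\<^esub> f" "Ra A \<psi> = v \<cdot>\<^bsub>vert A\<^esub> g"
  shows "\<exists>!\<chi>. \<chi> \<in> Hom (horz A) (tgt (horz A) (\<kappa> f g N)) Q \<and> La A \<chi> = u \<and> Ra A \<chi> = v \<and> \<chi> \<bullet> \<kappa> f g N = \<psi>"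
proof -
  have c: "cocartesian (horz A) (prod_cat (vert A) (vert A)) (pairing (leftf A) (rightf A)) (\<kappa> f g N)"
    using choice fg N unfolding cocartesian_choice_def by blast
  have o: "Lo A (tgt (horz A) (\<kappa> f g N)) = tgt (vert A) f" "Ro A (tgt (horz A) (\<kappa> f g N)) = tgt (vert A) g"
    using lift_Hom(4) by auto
  have "\<exists>!\<chi>. \<chi> \<in> Hom (horz A) (tgt (horz A) (\<kappa> f g N)) (tgt (horz A) \<psi>) \<and>
      on_ar (pairing (leftf A) (rightf A)) \<chi> = (u, v) \<and> \<chi> \<bullet> \<kappa> f g N = \<psi>"
  proof -
    let ?B = "prod_cat (vert A) (vert A)" and ?P = "pairing (leftf A) (rightf A)" and ?k = "\<kappa> f g N"
    have "(u, v) \<in> Hom ?B (on_ob ?P (tgt (horz A) ?k)) (on_ob ?P (tgt (horz A) \<psi>))"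
      using u v o \<psi> by (auto simp: Hom_def prod_cat_def pairing_def)
    moreover have "\<psi> \<in> ar (horz A)" "src (horz A) \<psi> = src (horz A) ?k"
      using \<psi> lift_Hom(1) by (auto simp: Hom_def)
    moreover have "(u, v) \<cdot>\<^bsub>?B\<^esub> on_ar ?P ?k = on_ar ?P \<psi>"
      using over lift_Hom(2,3) by (simp add: prod_cat_def pairing_def)
    ultimately show ?thesis using c unfolding cocartesian_def by blast
  qed
  then show ?thesis using \<psi> by (simp add: pairing_def Hom_def)
qed

lemma universal_lift: "universal f g N (\<kappa> f g N)"
  unfolding universal_def
proof (intro conjI allI ballI impI)
  show "\<kappa> f g N \<in> Hom (horz A) N (tgt (horz A) (\<kappa> f g N))" "La A (\<kappa> f g N) = f" "Ra A (\<kappa> f g N) = g"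
    using lift_Hom by auto
  fix Q \<psi> assume \<psi>: "\<psi> \<in> Hom (horz A) N Q" "La A \<psi> = f" "Ra A \<psi> = g"
  have o: "Lo A Q = tgt (vert A) f" "Ro A Q = tgt (vert A) g"
    using L.on_ar[OF \<psi>(1)] R.on_ar[OF \<psi>(1)] \<psi> by (auto simp: Hom_def)
  have "\<exists>!\<chi>. \<chi> \<in> Hom (horz A) (tgt (horz A) (\<kappa> f g N)) Q \<and> La A \<chi> = idt (vert A) (tgt (vert A) f) \<and>
      Ra A \<chi> = idt (vert A) (tgt (vert A) g) \<and> \<chi> \<bullet> \<kappa> f g N = \<psi>"
    by (rule lift_universal[OF \<psi>(1)])
      (use o \<psi>(2,3) fg L.target.idt_Hom L.target.tgt_ob L.target.idt_left in \<open>auto simp: Hom_def\<close>)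
  then show "\<exists>!\<chi>. \<chi> \<in> Hom (loc f g) (tgt (horz A) (\<kappa> f g N)) Q \<and> \<chi> \<bullet> \<kappa> f g N = \<psi>"
    by (simp add: local_ab_Hom conj_ac)
qed

end

text \<open>An arrow over a composite factors first over the outer vertical arrows, and that factor then
  through a globular arrow.\<close>

lemma universal_cmp:
  assumes f: "f \<in> Hom (vert A) a a'" "f' \<in> Hom (vert A) a' a''" and g: "g \<in> Hom (vert A) b b'" "g' \<in> Hom (vert A) b' b''"
    and N: "N \<in> ob (local_ab A a b)"
  shows "universal (f' \<cdot>\<^bsub>vert A\<^esub> f) (g' \<cdot>\<^bsub>vert A\<^esub> g) N (\<kappa> f' g' (tgt (horz A) (\<kappa> f g N)) \<bullet> \<kappa> f g N)"
proof -
  let ?N = "tgt (horz A) (\<kappa> f g N)"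
  have 1: "f \<in> ar (vert A)" "g \<in> ar (vert A)" "N \<in> ob (horz A)" "Lo A N = src (vert A) f" "Ro A N = src (vert A) g"
    and 2: "f' \<in> ar (vert A)" "g' \<in> ar (vert A)"
    using f g N by (auto simp: Hom_def)
  note k = lift_Hom[OF 1]
  have 3: "?N \<in> ob (horz A)" "Lo A ?N = src (vert A) f'" "Ro A ?N = src (vert A) g'"
    using k(4) f g by (auto simp: Hom_def)
  note k' = lift_Hom[OF 2 3]
  let ?e = "\<kappa> f' g' ?N \<bullet> \<kappa> f g N"
  have t: "tgt (horz A) ?e = tgt (horz A) (\<kappa> f' g' ?N)"
    using L.source.cmp_Hom[OF k(1) k'(1)] by (simp add: Hom_def)
  have tt: "tgt (vert A) (f' \<cdot>\<^bsub>vert A\<^esub> f) = tgt (vert A) f'" "tgt (vert A) (g' \<cdot>\<^bsub>vert A\<^esub> g) = tgt (vert A) g'"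
    using L.target.cmp_Hom[OF f] L.target.cmp_Hom[OF g] f g by (auto simp: Hom_def)
  show ?thesis
    unfolding universal_def t tt
  proof (intro conjI allI ballI impI)
    show "?e \<in> Hom (horz A) N (tgt (horz A) (\<kappa> f' g' ?N))" using L.source.cmp_Hom[OF k(1) k'(1)] .
    show "La A ?e = f' \<cdot>\<^bsub>vert A\<^esub> f" "Ra A ?e = g' \<cdot>\<^bsub>vert A\<^esub> g"
      using L.on_cmp[OF k(1) k'(1)] R.on_cmp[OF k(1) k'(1)] k k' by simp_all
    fix Q \<psi> assume \<psi>: "\<psi> \<in> Hom (horz A) N Q" "La A \<psi> = f' \<cdot>\<^bsub>vert A\<^esub> f" "Ra A \<psi> = g' \<cdot>\<^bsub>vert A\<^esub> g"
    have o: "Lo A Q = tgt (vert A) f'" "Ro A Q = tgt (vert A) g'"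
      using L.on_ar[OF \<psi>(1)] R.on_ar[OF \<psi>(1)] \<psi> tt by (auto simp: Hom_def)
    have f'H: "f' \<in> Hom (vert A) (tgt (vert A) f) (Lo A Q)" "g' \<in> Hom (vert A) (tgt (vert A) g) (Ro A Q)"
      using f g o by (auto simp: Hom_def)
    note U = lift_universal[OF 1 \<psi>(1) f'H \<psi>(2,3)]
    obtain \<xi> where \<xi>: "\<xi> \<in> Hom (horz A) ?N Q" "La A \<xi> = f'" "Ra A \<xi> = g'" "\<xi> \<bullet> \<kappa> f g N = \<psi>"
      using U by blast
    note U' = universal_lift[OF 2 3]
    obtain \<chi> where \<chi>: "\<chi> \<in> Hom (loc f' g') (tgt (horz A) (\<kappa> f' g' ?N)) Q" "\<chi> \<bullet> \<kappa> f' g' ?N = \<xi>"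
      using universal_ex[OF U' \<xi>(1-3)] .
    have assoc: "\<zeta> \<bullet> ?e = (\<zeta> \<bullet> \<kappa> f' g' ?N) \<bullet> \<kappa> f g N" if "\<zeta> \<in> Hom (loc f' g') (tgt (horz A) (\<kappa> f' g' ?N)) Q" for \<zeta>
      using L.source.cmp_assoc[OF k(1) k'(1), of \<zeta> Q] that by (simp add: local_ab_Hom)
    show "\<exists>!\<chi>. \<chi> \<in> Hom (loc f' g') (tgt (horz A) (\<kappa> f' g' ?N)) Q \<and> \<chi> \<bullet> ?e = \<psi>"
    proof (rule ex1I[of _ \<chi>])
      show "\<chi> \<in> Hom (loc f' g') (tgt (horz A) (\<kappa> f' g' ?N)) Q \<and> \<chi> \<bullet> ?e = \<psi>"
        using \<chi> \<xi>(4) assoc by simp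
      fix \<zeta> assume "\<zeta> \<in> Hom (loc f' g') (tgt (horz A) (\<kappa> f' g' ?N)) Q \<and> \<zeta> \<bullet> ?e = \<psi>"
      then have \<zeta>: "\<zeta> \<in> Hom (loc f' g') (tgt (horz A) (\<kappa> f' g' ?N)) Q" "\<zeta> \<bullet> ?e = \<psi>" by auto
      have "\<zeta> \<bullet> \<kappa> f' g' ?N \<in> Hom (horz A) ?N Q" "La A (\<zeta> \<bullet> \<kappa> f' g' ?N) = f'" "Ra A (\<zeta> \<bullet> \<kappa> f' g' ?N) = g'"
        using globular_cmp[OF k'(1)] \<zeta> k'(2,3) by auto
      moreover have "(\<zeta> \<bullet> \<kappa> f' g' ?N) \<bullet> \<kappa> f g N = \<psi>" using \<zeta>(2) assoc[OF \<zeta>(1)] by simp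
      ultimately have "\<zeta> \<bullet> \<kappa> f' g' ?N = \<xi>" using U \<xi> by blast
      then show "\<zeta> = \<chi>" using universal_unique[OF U'] \<zeta> \<chi> by blast
    qed
  qed
qed

lemma extension_Hom:
  assumes f: "f \<in> Hom (vert A) a a'" and g: "g \<in> Hom (vert A) b b'" and \<beta>: "\<beta> \<in> Hom (local_ab A a b) N N'"
  shows "on_ar (extension A \<kappa> f g) \<beta> \<in> Hom (local_ab A a' b') (tgt (horz A) (\<kappa> f g N)) (tgt (horz A) (\<kappa> f g N'))"
    "on_ar (extension A \<kappa> f g) \<beta> \<bullet> \<kappa> f g N = \<kappa> f g N' \<bullet> \<beta>"
proof -
  have \<beta>h: "\<beta> \<in> Hom (horz A) N N'" "La A \<beta> = idt (vert A) a" "Ra A \<beta> = idt (vert A) b"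
    using \<beta> by (auto simp: local_ab_Hom)
  have fg: "f \<in> ar (vert A)" "g \<in> ar (vert A)" and st: "src (vert A) f = a" "src (vert A) g = b"
     "tgt (vert A) f = a'" "tgt (vert A) g = b'" using f g by (auto simp: Hom_def)
  have ab: "a \<in> ob (vert A)" "b \<in> ob (vert A)" using L.target.Hom_ob f g by blast+
  interpret V: abelian_category "local_ab A a b" using local_abelian ab .
  have N: "N \<in> ob (horz A)" "Lo A N = src (vert A) f" "Ro A N = src (vert A) g"
    "N' \<in> ob (horz A)" "Lo A N' = src (vert A) f" "Ro A N' = src (vert A) g"
    using V.Hom_ob[OF \<beta>] st by auto
  note k = lift_Hom[OF fg N(1-3)] and k' = lift_Hom[OF fg N(4-6)]
  note U = universal_lift[OF fg N(1-3)]
  have \<psi>: "\<kappa> f g N' \<bullet> \<beta> \<in> Hom (horz A) N (tgt (horz A) (\<kappa> f g N'))"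
    "La A (\<kappa> f g N' \<bullet> \<beta>) = f" "Ra A (\<kappa> f g N' \<bullet> \<beta>) = g"
    using L.source.cmp_Hom[OF \<beta>h(1) k'(1)] L.on_cmp[OF \<beta>h(1) k'(1)] R.on_cmp[OF \<beta>h(1) k'(1)]
      \<beta>h k' L.target.idt_right[OF f] L.target.idt_right[OF g] by simp_all
  have s: "src (horz A) \<beta> = N" "tgt (horz A) \<beta> = N'" using \<beta>h by (auto simp: Hom_def)
  obtain \<chi> where \<chi>: "\<chi> \<in> Hom (loc f g) (tgt (horz A) (\<kappa> f g N)) (tgt (horz A) (\<kappa> f g N'))"
      "\<chi> \<bullet> \<kappa> f g N = \<kappa> f g N' \<bullet> \<beta>"
    using universal_ex[OF U \<psi>] .
  have "on_ar (extension A \<kappa> f g) \<beta> = \<chi>"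
    unfolding extension_def fnctr.simps s local_cat_Hom
    by (rule the_equality) (use \<chi> universal_unique[OF U] in auto)
  then show "on_ar (extension A \<kappa> f g) \<beta> \<in> Hom (local_ab A a' b') (tgt (horz A) (\<kappa> f g N)) (tgt (horz A) (\<kappa> f g N'))"
    "on_ar (extension A \<kappa> f g) \<beta> \<bullet> \<kappa> f g N = \<kappa> f g N' \<bullet> \<beta>"
    using \<chi> st by auto
qed

lemma extension_ob: "on_ob (extension A \<kappa> f g) N = tgt (horz A) (\<kappa> f g N)"
  by (simp add: extension_def)

end


section \<open>Good covers\<close>

locale homology_theory = framed_with_lifts A \<kappa> + C: category C + M: cat_functor C "Ch A" M
  for A :: "('o, 'v, 'm, 'c) ab_dblcat" and \<kappa> and C :: "('x, 'y) cat"
    and M :: "('x, 'y, ('m, 'c) cplx, ('m, 'c) cmap) fnctr"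
begin

abbreviation "lo x \<equiv> Lo A (cell (on_ob M x) 0)"
abbreviation "ro x \<equiv> Ro A (cell (on_ob M x) 0)"
abbreviation "la k \<equiv> La A (component (on_ar M k) 0)"
abbreviation "ra k \<equiv> Ra A (component (on_ar M k) 0)"
abbreviation "amb x \<equiv> ambient A M x"
abbreviation "push k \<equiv> pushforward A \<kappa> M k"
abbreviation "lift k N \<equiv> \<kappa> (la k) (ra k) N"

lemma amb_complex:
  assumes "x \<in> ob C" shows "is_complex (amb x) (on_ob M x)" "abelian_category (amb x)"
proof -
  have "on_ob M x \<in> ob (Ch A)" using M.on_ob assms .
  then obtain a b where ab: "a \<in> ob (vert A)" "b \<in> ob (vert A)" "is_complex (local_ab A a b) (on_ob M x)"
    by (auto simp: Ch_def Let_def)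
  have "cell (on_ob M x) 0 \<in> ob (local_ab A a b)" using ab(3) unfolding is_complex_def by blast
  then have "lo x = a" "ro x = b" by auto
  then show "is_complex (amb x) (on_ob M x)" "abelian_category (amb x)"
    using ab local_abelian by (auto simp: ambient_def)
qed

lemma amb_cell: "x \<in> ob C \<Longrightarrow> cell (on_ob M x) i \<in> ob (amb x)"
  using amb_complex unfolding is_complex_def by blast

lemma M_Hom:
  assumes "k \<in> Hom C y x"
  shows "component (on_ar M k) i \<in> Hom (horz A) (cell (on_ob M y) i) (cell (on_ob M x) i)"
    "La A (component (on_ar M k) i) = la k" "Ra A (component (on_ar M k) i) = ra k"
    "bd (on_ob M x) i \<bullet> component (on_ar M k) (Suc i) = component (on_ar M k) i \<bullet> bd (on_ob M y) i"
    "csrc (on_ar M k) = on_ob M y" "ctgt (on_ar M k) = on_ob M x"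
    "la k \<in> Hom (vert A) (lo y) (lo x)" "ra k \<in> Hom (vert A) (ro y) (ro x)"
proof -
  have h: "on_ar M k \<in> Hom (Ch A) (on_ob M y) (on_ob M x)" using M.on_ar assms .
  then show cs: "csrc (on_ar M k) = on_ob M y" "ctgt (on_ar M k) = on_ob M x" by (auto simp: Hom_def Ch_def Let_def)
  obtain f g where *: "\<And>i. component (on_ar M k) i \<in> Hom (horz A) (cell (on_ob M y) i) (cell (on_ob M x) i) \<and>
      La A (component (on_ar M k) i) = f \<and> Ra A (component (on_ar M k) i) = g \<and>
      bd (on_ob M x) i \<bullet> component (on_ar M k) (Suc i) = component (on_ar M k) i \<bullet> bd (on_ob M y) i"
    using h cs by (auto simp: Hom_def Ch_def Let_def)
  then show c: "component (on_ar M k) i \<in> Hom (horz A) (cell (on_ob M y) i) (cell (on_ob M x) i)"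
    "La A (component (on_ar M k) i) = la k" "Ra A (component (on_ar M k) i) = ra k"
    "bd (on_ob M x) i \<bullet> component (on_ar M k) (Suc i) = component (on_ar M k) i \<bullet> bd (on_ob M y) i" for i
    by auto
  show "la k \<in> Hom (vert A) (lo y) (lo x)" "ra k \<in> Hom (vert A) (ro y) (ro x)"
    using L.on_ar[OF c(1)] R.on_ar[OF c(1)] by auto
qed

lemma M_cmp:
  assumes "f \<in> Hom C x y" "g \<in> Hom C y z"
  shows "component (on_ar M (g \<cdot>\<^bsub>C\<^esub> f)) i = component (on_ar M g) i \<bullet> component (on_ar M f) i"
    "la (g \<cdot>\<^bsub>C\<^esub> f) = la g \<cdot>\<^bsub>vert A\<^esub> la f" "ra (g \<cdot>\<^bsub>C\<^esub> f) = ra g \<cdot>\<^bsub>vert A\<^esub> ra f"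
proof -
  show c: "component (on_ar M (g \<cdot>\<^bsub>C\<^esub> f)) i = component (on_ar M g) i \<bullet> component (on_ar M f) i" for i
    using M.on_cmp[OF assms] by (simp add: Ch_def Let_def)
  show "la (g \<cdot>\<^bsub>C\<^esub> f) = la g \<cdot>\<^bsub>vert A\<^esub> la f" "ra (g \<cdot>\<^bsub>C\<^esub> f) = ra g \<cdot>\<^bsub>vert A\<^esub> ra f"
    using c L.on_cmp[OF M_Hom(1)[OF assms(1)] M_Hom(1)[OF assms(2)]]
      R.on_cmp[OF M_Hom(1)[OF assms(1)] M_Hom(1)[OF assms(2)]] by auto
qed

lemma amb_loc: "k \<in> Hom C y x \<Longrightarrow> loc (la k) (ra k) = amb x"
  using M_Hom(7,8)[of k y x] by (simp add: ambient_def Hom_def)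

lemma lift:
  assumes k: "k \<in> Hom C y x" and N: "N \<in> ob (amb y)"
  shows "lift k N \<in> Hom (horz A) N (on_ob (push k) N)" "La A (lift k N) = la k" "Ra A (lift k N) = ra k"
    "universal (la k) (ra k) N (lift k N)" "tgt (horz A) (lift k N) = on_ob (push k) N"
    "on_ob (push k) N \<in> ob (amb x)"
proof -
  have 1: "la k \<in> ar (vert A)" "ra k \<in> ar (vert A)" "N \<in> ob (horz A)" "Lo A N = src (vert A) (la k)" "Ro A N = src (vert A) (ra k)"
    using M_Hom(7,8)[OF k] N by (auto simp: ambient_def Hom_def)
  show t: "tgt (horz A) (lift k N) = on_ob (push k) N" by (simp add: pushforward_def extension_ob)
  show "lift k N \<in> Hom (horz A) N (on_ob (push k) N)" "La A (lift k N) = la k" "Ra A (lift k N) = ra k"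
    "universal (la k) (ra k) N (lift k N)" "on_ob (push k) N \<in> ob (amb x)"
    using lift_Hom[OF 1] universal_lift[OF 1] unfolding t amb_loc[OF k] by auto
qed

lemma push_Hom:
  assumes k: "k \<in> Hom C y x" and \<beta>: "\<beta> \<in> Hom (amb y) N N'"
  shows "on_ar (push k) \<beta> \<in> Hom (amb x) (on_ob (push k) N) (on_ob (push k) N')"
    "on_ar (push k) \<beta> \<bullet> lift k N = lift k N' \<bullet> \<beta>"
  using extension_Hom[OF M_Hom(7,8)[OF k], of \<beta> N N'] \<beta>
  by (simp_all add: ambient_def pushforward_def extension_ob)

lemma globular: "\<beta> \<in> Hom (amb y) N N' \<Longrightarrow> \<beta> \<in> Hom (horz A) N N'"
  by (simp add: ambient_def local_ab_Hom)

lemma amb_simps [simp]: "cmp (amb x) = cmp (horz A)" "tgt (amb x) = tgt (horz A)"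
  by (simp_all add: ambient_def)

lemma push_unique:
  assumes k: "k \<in> Hom C y x" and N: "N \<in> ob (amb y)"
    and c: "\<chi> \<in> Hom (amb x) (on_ob (push k) N) Q" "\<chi>' \<in> Hom (amb x) (on_ob (push k) N) Q"
    and eq: "\<chi> \<bullet> lift k N = \<chi>' \<bullet> lift k N"
  shows "\<chi> = \<chi>'"
  using universal_unique[OF lift(4)[OF k N], of \<chi> Q \<chi>'] c eq unfolding amb_loc[OF k] lift(5)[OF k N] by blast

lemma abelian_exact:
  assumes "relative_pair A \<kappa> C M k" "k \<in> Hom C y x"
  shows "abelian_exact_functor (amb y) (amb x) (push k)"
proof -
  have "exact_functor (amb y) (amb x) (push k)" using assms by (simp add: relative_pair_def Hom_def)
  moreover have "abelian_category (amb y)" "abelian_category (amb x)"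
    using amb_complex(2) C.Hom_ob[OF assms(2)] by auto
  ultimately show ?thesis by (simp add: abelian_exact_functor_def)
qed

text \<open>The components of \<open>M k\<close> factor uniquely through the cocartesian arrows, and uniqueness makes the
  factors commute with the differentials.\<close>

lemma factorization:
  assumes p: "relative_pair A \<kappa> C M k" and k: "k \<in> Hom C y x"
  shows "factorization A \<kappa> C M k \<in> Hom (complexes (amb x)) (on_ob (degreewise (push k)) (on_ob M y)) (on_ob M x)"
    "component (factorization A \<kappa> C M k) i \<bullet> lift k (cell (on_ob M y) i) = component (on_ar M k) i"
    "monic (complexes (amb x)) (factorization A \<kappa> C M k)"
proof -
  interpret F: abelian_exact_functor "amb y" "amb x" "push k" using abelian_exact[OF p k] .
  have st: "src C k = y" "tgt C k = x" using k by (auto simp: Hom_def)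
  have ob: "y \<in> ob C" "x \<in> ob C" using C.Hom_ob[OF k] by auto
  let ?P = "\<lambda>\<phi>. \<phi> \<in> Hom (complexes (amb x)) (on_ob (degreewise (push k)) (on_ob M y)) (on_ob M x) \<and>
      \<phi> \<cdot>\<^bsub>Ch A\<^esub> cocartesian_map A \<kappa> C M k = on_ar M k"
  note N = amb_cell[OF ob(1)]
  note Y = F.source.complex_Hom[OF amb_complex(1)[OF ob(1)]] and X = F.target.complex_Hom[OF amb_complex(1)[OF ob(2)]]
  note m = M_Hom[OF k] and l = lift[OF k N]
  have "\<exists>\<chi> \<in> Hom (amb x) (on_ob (push k) (cell (on_ob M y) j)) (cell (on_ob M x) j).
      \<chi> \<bullet> lift k (cell (on_ob M y) j) = component (on_ar M k) j" for j
    using universal_ex[OF l(4) m(1) m(2) m(3)] unfolding amb_loc[OF k] l(5) by metis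
  then obtain \<chi> where \<chi>: "\<And>j. \<chi> j \<in> Hom (amb x) (on_ob (push k) (cell (on_ob M y) j)) (cell (on_ob M x) j)"
      "\<And>j. \<chi> j \<bullet> lift k (cell (on_ob M y) j) = component (on_ar M k) j" by metis
  note pY = push_Hom[OF k Y(1)]
  have chain: "bd (on_ob M x) j \<bullet> \<chi> (Suc j) = \<chi> j \<bullet> on_ar (push k) (bd (on_ob M y) j)" for j
  proof (rule push_unique[OF k N])
    show "bd (on_ob M x) j \<bullet> \<chi> (Suc j) \<in> Hom (amb x) (on_ob (push k) (cell (on_ob M y) (Suc j))) (cell (on_ob M x) j)"
      "\<chi> j \<bullet> on_ar (push k) (bd (on_ob M y) j) \<in> Hom (amb x) (on_ob (push k) (cell (on_ob M y) (Suc j))) (cell (on_ob M x) j)"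
      using F.target.cmp_Hom[OF \<chi>(1) X(1)] F.target.cmp_Hom[OF pY(1) \<chi>(1)] by simp_all
    have "(bd (on_ob M x) j \<bullet> \<chi> (Suc j)) \<bullet> lift k (cell (on_ob M y) (Suc j)) = bd (on_ob M x) j \<bullet> component (on_ar M k) (Suc j)"
      using L.source.cmp_assoc[OF l(1) globular[OF \<chi>(1)] globular[OF X(1)]] \<chi>(2) by simp
    also have "\<dots> = (\<chi> j \<bullet> lift k (cell (on_ob M y) j)) \<bullet> bd (on_ob M y) j" using m(4) \<chi>(2) by simp
    also have "\<dots> = \<chi> j \<bullet> (on_ar (push k) (bd (on_ob M y) j) \<bullet> lift k (cell (on_ob M y) (Suc j)))"
      using L.source.cmp_assoc[OF globular[OF Y(1)] l(1) globular[OF \<chi>(1)]] pY(2) by simp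
    also have "\<dots> = (\<chi> j \<bullet> on_ar (push k) (bd (on_ob M y) j)) \<bullet> lift k (cell (on_ob M y) (Suc j))"
      using L.source.cmp_assoc[OF l(1) globular[OF pY(1)] globular[OF \<chi>(1)]] by simp
    finally show "(bd (on_ob M x) j \<bullet> \<chi> (Suc j)) \<bullet> lift k (cell (on_ob M y) (Suc j))
      = (\<chi> j \<bullet> on_ar (push k) (bd (on_ob M y) j)) \<bullet> lift k (cell (on_ob M y) (Suc j))" .
  qed
  have comp: "component (\<phi> \<cdot>\<^bsub>Ch A\<^esub> cocartesian_map A \<kappa> C M k) j = component \<phi> j \<bullet> lift k (cell (on_ob M y) j)" for \<phi> j
    by (simp add: Ch_def Let_def cocartesian_map_def st)
  define \<phi> where "\<phi> = CMap (on_ob (degreewise (push k)) (on_ob M y)) (on_ob M x) \<chi>"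
  have "\<phi> \<cdot>\<^bsub>Ch A\<^esub> cocartesian_map A \<kappa> C M k = on_ar M k"
  proof (rule cmap_eqI)
    show "csrc (\<phi> \<cdot>\<^bsub>Ch A\<^esub> cocartesian_map A \<kappa> C M k) = csrc (on_ar M k)"
      "ctgt (\<phi> \<cdot>\<^bsub>Ch A\<^esub> cocartesian_map A \<kappa> C M k) = ctgt (on_ar M k)"
      using m(5,6) by (simp_all add: Ch_def Let_def cocartesian_map_def st \<phi>_def)
  qed (simp only: comp, simp add: \<phi>_def \<chi>)
  moreover have "\<phi> \<in> Hom (complexes (amb x)) (on_ob (degreewise (push k)) (on_ob M y)) (on_ob M x)"
    using \<chi>(1) chain F.F_complex[OF amb_complex(1)[OF ob(1)]] amb_complex(1)[OF ob(2)]
    by (simp add: complexes_Hom_iff \<phi>_def)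
  ultimately have P: "?P \<phi>" by simp
  moreover have "\<psi> = \<phi>" if \<psi>: "?P \<psi>" for \<psi>
  proof (rule cmap_eqI)
    show "csrc \<psi> = csrc \<phi>" "ctgt \<psi> = ctgt \<phi>" using \<psi> by (auto simp: complexes_Hom_iff \<phi>_def)
    fix j
    have pj: "component \<psi> j \<in> Hom (amb x) (on_ob (push k) (cell (on_ob M y) j)) (cell (on_ob M x) j)"
      using \<psi> by (auto simp: complexes_Hom_iff)
    have "component \<psi> j \<bullet> lift k (cell (on_ob M y) j) = \<chi> j \<bullet> lift k (cell (on_ob M y) j)"
      using \<psi> comp[of \<psi> j] \<chi>(2) by simp
    then show "component \<psi> j = component \<phi> j"
      using push_unique[OF k N pj \<chi>(1)] by (simp add: \<phi>_def)
  qed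
  ultimately have "factorization A \<kappa> C M k = \<phi>"
    unfolding factorization_def st by (intro the_equality)
  then show "factorization A \<kappa> C M k \<in> Hom (complexes (amb x)) (on_ob (degreewise (push k)) (on_ob M y)) (on_ob M x)"
    "component (factorization A \<kappa> C M k) i \<bullet> lift k (cell (on_ob M y) i) = component (on_ar M k) i"
    using P \<chi>(2) by (auto simp: \<phi>_def)
  show "monic (complexes (amb x)) (factorization A \<kappa> C M k)" using p st by (simp add: relative_pair_def)
qed

text \<open>Pushing forward along a composite agrees with pushing forward in two steps.\<close>

lemma push_push_universal:
  assumes j: "j \<in> Hom C z y" and k: "k \<in> Hom C y x" and N: "N \<in> ob (amb z)"
  shows "universal (la (k \<cdot>\<^bsub>C\<^esub> j)) (ra (k \<cdot>\<^bsub>C\<^esub> j)) N (lift k (on_ob (push j) N) \<bullet> lift j N)"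
    "tgt (horz A) (lift k (on_ob (push j) N) \<bullet> lift j N) = on_ob (push k) (on_ob (push j) N)"
proof -
  note lj = lift[OF j N] and lk = lift[OF k lj(6)]
  show "universal (la (k \<cdot>\<^bsub>C\<^esub> j)) (ra (k \<cdot>\<^bsub>C\<^esub> j)) N (lift k (on_ob (push j) N) \<bullet> lift j N)"
    using universal_cmp[OF M_Hom(7)[OF j] M_Hom(7)[OF k] M_Hom(8)[OF j] M_Hom(8)[OF k], of N] N
    unfolding M_cmp(2,3)[OF j k] lj(5) ambient_def by simp
  show "tgt (horz A) (lift k (on_ob (push j) N) \<bullet> lift j N) = on_ob (push k) (on_ob (push j) N)"
    using L.source.cmp_Hom[OF lj(1) lk(1)] by (simp add: Hom_def)
qed

lemma push_push_isom:
  assumes j: "j \<in> Hom C z y" and k: "k \<in> Hom C y x" and N: "N \<in> ob (amb z)"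
  obtains t where "t \<in> Hom (amb x) (on_ob (push k) (on_ob (push j) N)) (on_ob (push (k \<cdot>\<^bsub>C\<^esub> j)) N)" "isom (amb x) t"
proof -
  have kj: "k \<cdot>\<^bsub>C\<^esub> j \<in> Hom C z x" using C.cmp_Hom j k .
  note u = push_push_universal[OF assms] and l = lift[OF kj N]
  show ?thesis using universal_isom[OF u(1) l(4)] that unfolding u(2) l(5) amb_loc[OF kj] by blast
qed

lemma push_push_unique:
  assumes j: "j \<in> Hom C z y" and k: "k \<in> Hom C y x" and N: "N \<in> ob (amb z)"
    and c: "\<chi> \<in> Hom (amb x) (on_ob (push k) (on_ob (push j) N)) Q" "\<chi>' \<in> Hom (amb x) (on_ob (push k) (on_ob (push j) N)) Q"
    and eq: "\<chi> \<bullet> (lift k (on_ob (push j) N) \<bullet> lift j N) = \<chi>' \<bullet> (lift k (on_ob (push j) N) \<bullet> lift j N)"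
  shows "\<chi> = \<chi>'"
proof -
  have kj: "k \<cdot>\<^bsub>C\<^esub> j \<in> Hom C z x" using C.cmp_Hom j k .
  note u = push_push_universal[OF j k N]
  show ?thesis using universal_unique[OF u(1), of \<chi> Q \<chi>'] c eq unfolding u(2) amb_loc[OF kj] by blast
qed

text \<open>The arrow \<open>a2\<close> exists because the two composites of the square of the cover agree: the arrow to the
  pushforward from the second piece lies over the same vertical arrows as the two-step cocartesian
  arrow through the first piece. Its compatibilities are equations between globular arrows and are
  checked after composing with that cocartesian arrow.\<close>

theorem good_cover_square:
  assumes gc: "good_cover A \<kappa> C M X X1 X2 X12 j1 j2 k1 k2"
  obtains a2 where "pushforward_square (amb X12) (amb X1) (amb X2) (amb X) (push j1) (push k1) (push k2)
    (on_ob M X12) (on_ob M X1) (on_ob M X2) (on_ob M X)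
    (factorization A \<kappa> C M j1) (factorization A \<kappa> C M k1) (factorization A \<kappa> C M k2) a2"
proof -
  have H: "j1 \<in> Hom C X12 X1" "j2 \<in> Hom C X12 X2" "k1 \<in> Hom C X1 X" "k2 \<in> Hom C X2 X"
    and sq: "k1 \<cdot>\<^bsub>C\<^esub> j1 = k2 \<cdot>\<^bsub>C\<^esub> j2"
    and p: "relative_pair A \<kappa> C M j1" "relative_pair A \<kappa> C M j2" "relative_pair A \<kappa> C M k1" "relative_pair A \<kappa> C M k2"
    using gc by (auto simp: good_cover_def)
  have ob: "X12 \<in> ob C" "X1 \<in> ob C" "X2 \<in> ob C" "X \<in> ob C" using C.Hom_ob H by blast+
  interpret G: abelian_exact_functor "amb X12" "amb X1" "push j1" using abelian_exact p H by blast
  interpret F1: abelian_exact_functor "amb X1" "amb X" "push k1" using abelian_exact p H by blast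
  interpret F2: abelian_exact_functor "amb X2" "amb X" "push k2" using abelian_exact p H by blast
  note fj = factorization[OF p(1) H(1)] and f1 = factorization[OF p(3) H(3)] and f2 = factorization[OF p(4) H(4)]
  let ?N = "cell (on_ob M X12)"
  note N12 = amb_cell[OF ob(1)] and N2 = amb_cell[OF ob(3)] and N1 = amb_cell[OF ob(2)]
  note Mj1 = M_Hom[OF H(1)] and Mj2 = M_Hom[OF H(2)] and Mk1 = M_Hom[OF H(3)] and Mk2 = M_Hom[OF H(4)]
  note l2 = lift[OF H(4) N2] and lj = lift[OF H(1) N12] and l1 = lift[OF H(3) N1]
  note lk = lift[OF H(3) lj(6)]
  note uni = push_push_universal[OF H(1,3) N12]
  have kj: "k1 \<cdot>\<^bsub>C\<^esub> j1 \<in> Hom C X12 X" using C.cmp_Hom H by blast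
  define \<psi> where "\<psi> i = lift k2 (cell (on_ob M X2) i) \<bullet> component (on_ar M j2) i" for i
  \<comment> \<open>the two-step cocartesian arrow, through the first piece\<close>
  define e where "e i = lift k1 (on_ob (push j1) (?N i)) \<bullet> lift j1 (?N i)" for i
  have eH: "e i \<in> Hom (horz A) (?N i) (on_ob (push k1) (on_ob (push j1) (?N i)))" for i
    unfolding e_def using L.source.cmp_Hom[OF lj(1) lk(1)] .
  have \<psi>: "\<psi> i \<in> Hom (horz A) (?N i) (on_ob (push k2) (cell (on_ob M X2) i))"
    "La A (\<psi> i) = la (k1 \<cdot>\<^bsub>C\<^esub> j1)" "Ra A (\<psi> i) = ra (k1 \<cdot>\<^bsub>C\<^esub> j1)" for i
    unfolding \<psi>_def sq M_cmp(2,3)[OF H(2,4)]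
    using L.source.cmp_Hom[OF Mj2(1) l2(1), of i] L.on_cmp[OF Mj2(1) l2(1), of i] R.on_cmp[OF Mj2(1) l2(1), of i]
    unfolding l2(2,3) Mj2(2)[of i] Mj2(3)[of i] by auto
  have "\<exists>a \<in> Hom (amb X) (on_ob (push k1) (on_ob (push j1) (?N i))) (on_ob (push k2) (cell (on_ob M X2) i)). a \<bullet> e i = \<psi> i" for i
    using universal_ex[OF uni(1) \<psi>] unfolding uni(2) amb_loc[OF kj] e_def by metis
  then obtain a2 where a2: "\<And>i. a2 i \<in> Hom (amb X) (on_ob (push k1) (on_ob (push j1) (?N i))) (on_ob (push k2) (cell (on_ob M X2) i))"
      "\<And>i. a2 i \<bullet> e i = \<psi> i" by metis
  note d12 = G.source.complex_Hom(1)[OF amb_complex(1)[OF ob(1)]] and d2 = F2.source.complex_Hom(1)[OF amb_complex(1)[OF ob(3)]]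
  note Gd = push_Hom[OF H(1) d12] and F2d = push_Hom[OF H(4) d2]
  note F1Gd = push_Hom[OF H(3) Gd(1)]
  note g = globular
  have e_nat: "on_ar (push k1) (on_ar (push j1) (bd (on_ob M X12) i)) \<bullet> e (Suc i) = e i \<bullet> bd (on_ob M X12) i" for i
    unfolding e_def
    using L.source.cmp_assoc[OF lj(1) lk(1) g[OF F1Gd(1)]] F1Gd(2) L.source.cmp_assoc[OF lj(1) g[OF Gd(1)] lk(1)] Gd(2)
      L.source.cmp_assoc[OF g[OF d12] lj(1) lk(1)] by simp
  have a2_chain: "on_ar (push k2) (bd (on_ob M X2) i) \<bullet> a2 (Suc i) = a2 i \<bullet> on_ar (push k1) (on_ar (push j1) (bd (on_ob M X12) i))" for i
  proof (rule push_push_unique[OF H(1,3) N12])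
    show "on_ar (push k2) (bd (on_ob M X2) i) \<bullet> a2 (Suc i)
        \<in> Hom (amb X) (on_ob (push k1) (on_ob (push j1) (?N (Suc i)))) (on_ob (push k2) (cell (on_ob M X2) i))"
      "a2 i \<bullet> on_ar (push k1) (on_ar (push j1) (bd (on_ob M X12) i))
        \<in> Hom (amb X) (on_ob (push k1) (on_ob (push j1) (?N (Suc i)))) (on_ob (push k2) (cell (on_ob M X2) i))"
      using F1.target.cmp_Hom[OF a2(1) F2d(1)] F1.target.cmp_Hom[OF F1Gd(1) a2(1)] by simp_all
    have "(on_ar (push k2) (bd (on_ob M X2) i) \<bullet> a2 (Suc i)) \<bullet> e (Suc i) = on_ar (push k2) (bd (on_ob M X2) i) \<bullet> \<psi> (Suc i)"
      using L.source.cmp_assoc[OF eH g[OF a2(1)] g[OF F2d(1)]] a2(2) by simp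
    also have "\<dots> = lift k2 (cell (on_ob M X2) i) \<bullet> (bd (on_ob M X2) i \<bullet> component (on_ar M j2) (Suc i))"
      unfolding \<psi>_def using L.source.cmp_assoc[OF Mj2(1) l2(1) g[OF F2d(1)]] F2d(2)
        L.source.cmp_assoc[OF Mj2(1) g[OF d2] l2(1)] by simp
    also have "\<dots> = \<psi> i \<bullet> bd (on_ob M X12) i"
      unfolding \<psi>_def Mj2(4) using L.source.cmp_assoc[OF g[OF d12] Mj2(1) l2(1)] by simp
    also have "\<dots> = a2 i \<bullet> (e i \<bullet> bd (on_ob M X12) i)"
      using L.source.cmp_assoc[OF g[OF d12] eH g[OF a2(1)]] a2(2) by simp
    also have "\<dots> = (a2 i \<bullet> on_ar (push k1) (on_ar (push j1) (bd (on_ob M X12) i))) \<bullet> e (Suc i)"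
      using L.source.cmp_assoc[OF eH g[OF F1Gd(1)] g[OF a2(1)]] e_nat by simp
    finally show "(on_ar (push k2) (bd (on_ob M X2) i) \<bullet> a2 (Suc i)) \<bullet>
          (lift k1 (on_ob (push j1) (?N (Suc i))) \<bullet> lift j1 (?N (Suc i)))
        = (a2 i \<bullet> on_ar (push k1) (on_ar (push j1) (bd (on_ob M X12) i))) \<bullet>
          (lift k1 (on_ob (push j1) (?N (Suc i))) \<bullet> lift j1 (?N (Suc i)))"
      unfolding e_def .
  qed
  have b1H: "component (factorization A \<kappa> C M k1) i \<in> Hom (amb X) (on_ob (push k1) (cell (on_ob M X1) i)) (cell (on_ob M X) i)"
    and b2H: "component (factorization A \<kappa> C M k2) i \<in> Hom (amb X) (on_ob (push k2) (cell (on_ob M X2) i)) (cell (on_ob M X) i)"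
    and fH: "component (factorization A \<kappa> C M j1) i \<in> Hom (amb X1) (on_ob (push j1) (?N i)) (cell (on_ob M X1) i)" for i
    using f1(1) f2(1) fj(1) by (auto simp: complexes_Hom_iff)
  note Ff = push_Hom[OF H(3) fH]
  have square: "component (factorization A \<kappa> C M k1) i \<bullet> on_ar (push k1) (component (factorization A \<kappa> C M j1) i)
      = component (factorization A \<kappa> C M k2) i \<bullet> a2 i" for i
  proof (rule push_push_unique[OF H(1,3) N12])
    let ?b1 = "component (factorization A \<kappa> C M k1) i" and ?b2 = "component (factorization A \<kappa> C M k2) i"
      and ?f = "component (factorization A \<kappa> C M j1) i"
    show "?b1 \<bullet> on_ar (push k1) ?f \<in> Hom (amb X) (on_ob (push k1) (on_ob (push j1) (?N i))) (cell (on_ob M X) i)"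
      "?b2 \<bullet> a2 i \<in> Hom (amb X) (on_ob (push k1) (on_ob (push j1) (?N i))) (cell (on_ob M X) i)"
      using F1.target.cmp_Hom[OF Ff(1) b1H] F1.target.cmp_Hom[OF a2(1) b2H] by simp_all
    have "(?b1 \<bullet> on_ar (push k1) ?f) \<bullet> e i = ?b1 \<bullet> ((on_ar (push k1) ?f \<bullet> lift k1 (on_ob (push j1) (?N i))) \<bullet> lift j1 (?N i))"
      unfolding e_def using L.source.cmp_assoc[OF eH[unfolded e_def] g[OF Ff(1)] g[OF b1H]]
        L.source.cmp_assoc[OF lj(1) lk(1) g[OF Ff(1)]] by simp
    also have "\<dots> = ?b1 \<bullet> (lift k1 (cell (on_ob M X1) i) \<bullet> component (on_ar M j1) i)"
      unfolding Ff(2) using L.source.cmp_assoc[OF lj(1) g[OF fH] l1(1)] fj(2) by simp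
    also have "\<dots> = component (on_ar M k1) i \<bullet> component (on_ar M j1) i"
      using L.source.cmp_assoc[OF Mj1(1) l1(1) g[OF b1H]] f1(2) by simp
    also have "\<dots> = component (on_ar M k2) i \<bullet> component (on_ar M j2) i"
      using M_cmp(1)[OF H(1,3), of i] M_cmp(1)[OF H(2,4), of i] sq by simp
    also have "\<dots> = ?b2 \<bullet> \<psi> i"
      unfolding \<psi>_def using L.source.cmp_assoc[OF Mj2(1) l2(1) g[OF b2H]] f2(2) by simp
    also have "\<dots> = (?b2 \<bullet> a2 i) \<bullet> e i"
      using L.source.cmp_assoc[OF eH g[OF a2(1)] g[OF b2H]] a2(2) by simp
    finally show "(?b1 \<bullet> on_ar (push k1) ?f) \<bullet> (lift k1 (on_ob (push j1) (?N i)) \<bullet> lift j1 (?N i))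
        = (?b2 \<bullet> a2 i) \<bullet> (lift k1 (on_ob (push j1) (?N i)) \<bullet> lift j1 (?N i))"
      unfolding e_def .
  qed
  have "pushforward_square (amb X12) (amb X1) (amb X2) (amb X) (push j1) (push k1) (push k2)
    (on_ob M X12) (on_ob M X1) (on_ob M X2) (on_ob M X)
    (factorization A \<kappa> C M j1) (factorization A \<kappa> C M k1) (factorization A \<kappa> C M k2) a2"
    by unfold_locales (use amb_complex(1) ob fj f1 f2 a2(1) a2_chain square in simp_all)
  then show ?thesis using that by blast
qed

end

theorem theorem5p10:
  fixes A :: "('o, 'v, 'm, 'c) ab_dblcat"
    and \<kappa> :: "'v \<Rightarrow> 'v \<Rightarrow> 'm \<Rightarrow> 'c"
    and C :: "('x, 'y) cat"
    and M :: "('x, 'y, ('m, 'c) cplx, ('m, 'c) cmap) fnctr"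
    and X X1 X2 X12 :: 'x
    and j1 j2 k1 k2 :: 'y
  assumes "abelian_framed_bicategory A"
    and "cocartesian_choice A \<kappa>"
    and "category C"
    and "cat_functor C (Ch A) M"
    and "good_cover A \<kappa> C M X X1 X2 X12 j1 j2 k1 k2"
  shows "\<exists>\<delta> \<alpha> \<beta> :: nat \<Rightarrow> 'c.
    (\<forall>i. \<delta> i \<in> Hom (ambient A M X)
                 (obj_homology A M X (Suc i))
                 (push_homology A \<kappa> C M (k1 \<cdot>\<^bsub>C\<^esub> j1) i) \<and>
         \<alpha> i \<in> Hom (ambient A M X)
                 (push_homology A \<kappa> C M (k1 \<cdot>\<^bsub>C\<^esub> j1) i)
                 (direct_sum (ambient A M X)
                    (push_homology A \<kappa> C M k1 i) (push_homology A \<kappa> C M k2 i)) \<and>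
         \<beta> i \<in> Hom (ambient A M X)
                 (direct_sum (ambient A M X)
                    (push_homology A \<kappa> C M k1 i) (push_homology A \<kappa> C M k2 i))
                 (obj_homology A M X i) \<and>
         exact_at (ambient A M X) (\<beta> (Suc i)) (\<delta> i) \<and>
         exact_at (ambient A M X) (\<delta> i) (\<alpha> i) \<and>
         exact_at (ambient A M X) (\<alpha> i) (\<beta> i)) \<and>
    exact_at (ambient A M X) (\<beta> 0)
      (pzero (ambient A M X) (obj_homology A M X 0) (zero_ob (ambient A M X)))"
proof -
  interpret homology_theory A \<kappa> C M
    using assms(1-4) by (simp add: homology_theory_def framed_with_lifts_def framed_with_lifts_axioms_def)
  have H: "j1 \<in> Hom C X12 X1" "j2 \<in> Hom C X12 X2" "k1 \<in> Hom C X1 X" "k2 \<in> Hom C X2 X"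
    and ex: "excisive A \<kappa> C M j1 k1 k2"
    using assms(5) by (auto simp: good_cover_def)
  have ob: "X12 \<in> ob C" "X1 \<in> ob C" "X2 \<in> ob C" "X \<in> ob C" using C.Hom_ob H by blast+
  have kj: "k1 \<cdot>\<^bsub>C\<^esub> j1 \<in> Hom C X12 X" using C.cmp_Hom H by blast
  have st: "tgt C j1 = X1" "src C k1 = X1" "tgt C k1 = X" "src C k2 = X2" "tgt C k2 = X" "src C (k1 \<cdot>\<^bsub>C\<^esub> j1) = X12"
    using H kj by (auto simp: Hom_def)
  obtain a2 where "pushforward_square (amb X12) (amb X1) (amb X2) (amb X) (push j1) (push k1) (push k2)
    (on_ob M X12) (on_ob M X1) (on_ob M X2) (on_ob M X)
    (factorization A \<kappa> C M j1) (factorization A \<kappa> C M k1) (factorization A \<kappa> C M k2) a2"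
    using good_cover_square[OF assms(5)] .
  then interpret S: pushforward_square "amb X12" "amb X1" "amb X2" "amb X" "push j1" "push k1" "push k2"
    "on_ob M X12" "on_ob M X1" "on_ob M X2" "on_ob M X"
    "factorization A \<kappa> C M j1" "factorization A \<kappa> C M k1" "factorization A \<kappa> C M k2" a2 .
  have iso: "isom (amb X) (induced_on_homology (amb X1) (amb X) (push k1) (ctgt S.q1) S.excision i)" for i
    using ex unfolding excisive_def excision_map_def S.excision_def rel_complex_def rel_quotient_def Let_def st by blast
  have "\<exists>t. t \<in> Hom (amb X) (on_ob (push k1) (on_ob (push j1) (homology (amb X12) (on_ob M X12) i)))
      (push_homology A \<kappa> C M (k1 \<cdot>\<^bsub>C\<^esub> j1) i) \<and> isom (amb X) t" for i
  proof -
    have "homology_proj (amb X12) (on_ob M X12) i \<in> Hom (amb X12) (src (amb X12) (cycle_incl (amb X12) (on_ob M X12) i))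
        (homology (amb X12) (on_ob M X12) i)"
      using S.G.source.presents_homology[OF S.M12, of i] by (auto simp: S.G.source.presents_def)
    then have "homology (amb X12) (on_ob M X12) i \<in> ob (amb X12)" using S.G.source.Hom_ob by blast
    then show ?thesis
      using push_push_isom[OF H(1,3)] unfolding push_homology_def obj_homology_def st by metis
  qed
  then obtain \<theta> where \<theta>: "\<And>i. \<theta> i \<in> Hom (amb X) (on_ob (push k1) (on_ob (push j1) (homology (amb X12) (on_ob M X12) i)))
      (push_homology A \<kappa> C M (k1 \<cdot>\<^bsub>C\<^esub> j1) i)" "\<And>i. isom (amb X) (\<theta> i)" by metis
  let ?S = "\<lambda>i. direct_sum (amb X) (push_homology A \<kappa> C M k1 i) (push_homology A \<kappa> C M k2 i)"
  have pH: "push_homology A \<kappa> C M k1 i = on_ob (push k1) (homology (amb X1) (on_ob M X1) i)"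
    "push_homology A \<kappa> C M k2 i = on_ob (push k2) (homology (amb X2) (on_ob M X2) i)" for i
    by (simp_all add: push_homology_def obj_homology_def st)
  have "\<exists>\<iota>1 \<iota>2 \<pi>1 \<pi>2. is_biproduct (amb X) (push_homology A \<kappa> C M k1 i) (push_homology A \<kappa> C M k2 i) (?S i) \<iota>1 \<iota>2 \<pi>1 \<pi>2" for i
  proof -
    have h1: "homology (amb X1) (on_ob M X1) i \<in> ob (amb X1)"
      using S.D1.presents_homology[OF S.M1, of i] S.D1.Hom_ob unfolding S.D1.presents_def by blast
    have h2: "homology (amb X2) (on_ob M X2) i \<in> ob (amb X2)"
      using S.F2.source.presents_homology[OF S.M2, of i] S.F2.source.Hom_ob unfolding S.F2.source.presents_def by blast
    have "push_homology A \<kappa> C M k1 i \<in> ob (amb X)" "push_homology A \<kappa> C M k2 i \<in> ob (amb X)"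
      unfolding pH using S.F1.on_ob h1 S.F2.on_ob h2 by auto
    then show ?thesis unfolding direct_sum_def
      by (intro someI_ex[of "\<lambda>s. \<exists>i j p q. is_biproduct (amb X) _ _ s i j p q"] S.D.ex_biproduct)
  qed
  then obtain \<iota>1 \<iota>2 \<pi>1 \<pi>2 where bip: "\<And>i. is_biproduct (amb X) (on_ob (push k1) (homology (amb X1) (on_ob M X1) i))
      (on_ob (push k2) (homology (amb X2) (on_ob M X2) i)) (?S i) (\<iota>1 i) (\<iota>2 i) (\<pi>1 i) (\<pi>2 i)"
    unfolding pH by metis
  show ?thesis
  proof (rule S.mayer_vietoris[OF iso \<theta>(2,1) bip], goal_cases)
    case (1 \<delta> \<alpha> \<beta>)
    then show ?case unfolding obj_homology_def by blast
  qed
qed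


end
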